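(* Let $d\ge1$ and let $\gamma$ be the standard Gaussian measure on $\mathbb{R}^d$. For every centered probability measure $\nu$ on $\mathbb{R}^d$ admitting a Stein kernel $\tau_\nu$, with associated Stein discrepancy ${\rm S}(\nu\,|\,\gamma)$, $$ {\rm W}_2(\nu,\gamma)\,\le\,{\rm S}(\nu\,|\,\gamma). $$
   Context: It is not assumed that $\nu$ has a density. Centered means $\int x_j\,d\nu=0$ for all $j$. A measurable matrix-valued map $\tau_\nu=(\tau_\nu^{ij})_{1\le i,j\le d}$ on $\mathbb{R}^d$ is a Stein kernel for $\nu$ if $\tau_\nu^{ij}\in L^1(\nu)$ for all $i,j$ and, for every smooth test function $\varphi:\mathbb{R}^d\to\mathbb{R}$ (the coordinate functions $x_i$ and the products $x_ix_j$ being admissible), $$\int_{\mathbb{R}^d} x\cdot\nabla\varphi\,d\nu=\int_{\mathbb{R}^d}\langle\tau_\nu,{\rm Hess}(\varphi)\rangle_{\rm HS}\,d\nu,$$ with $\langle\cdot,\cdot\rangle_{\rm HS}$, $\|\cdot\|_{\rm HS}$ the Hilbert-Schmidt scalar product and norm; without loss of generality $\tau_\nu$ is taken symmetric $\nu$-a.e. The Stein discrepancy is ${\rm S}(\nu|\gamma)=\big(\int\|\tau_\nu-{\rm Id}\|_{\rm HS}^2\,d\nu\big)^{1/2}\in[0,\infty]$. The quadratic Wasserstein distance is ${\rm W}_2(\nu,\mu)=\inf_\pi\big(\int_{\mathbb{R}^d\times\mathbb{R}^d}|x-y|^2d\pi(x,y)\big)^{1/2}$, the infimum being over all couplings $\pi$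 of $\nu$ and $\mu$. *)

theory Defs
  imports "HOL-Probability.Probability"
begin

section \<open>Smooth functions, gradient and Hessian on Euclidean space\<close>

definition partial_deriv :: "'n::finite \<Rightarrow> (real^'n \<Rightarrow> real) \<Rightarrow> real^'n \<Rightarrow> real" where
  "partial_deriv i f x = frechet_derivative f (at x) (axis i 1)"

fun iterated_partial :: "'n::finite list \<Rightarrow> (real^'n \<Rightarrow> real) \<Rightarrow> real^'n \<Rightarrow> real" where
  "iterated_partial [] f = f"
| "iterated_partial (i # is) f = partial_deriv i (iterated_partial is f)"

text \<open>Differentiability of all iterated partial derivatives entails their continuity, so this is
  the usual class of infinitely differentiable functions.\<close>

definition smooth :: "(real^'n::finite \<Rightarrow> real) \<Rightarrow> bool" where
  "smooth f \<longleftrightarrow> (\<forall>is x. iterated_partial is f differentiable (at x))"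

definition grad :: "(real^'n::finite \<Rightarrow> real) \<Rightarrow> real^'n \<Rightarrow> real^'n" where
  "grad f x = (\<chi> i. partial_deriv i f x)"

definition hessian :: "(real^'n::finite \<Rightarrow> real) \<Rightarrow> real^'n \<Rightarrow> real^'n^'n" where
  "hessian f x = (\<chi> i j. partial_deriv i (partial_deriv j f) x)"

section \<open>Stein kernels and Stein discrepancy\<close>

definition centered :: "(real^'n::finite) measure \<Rightarrow> bool" where
  "centered \<nu> \<longleftrightarrow> (\<forall>j. integrable \<nu> (\<lambda>x. x $ j) \<and> (\<integral>x. x $ j \<partial>\<nu>) = 0)"

text \<open>Test functions are the smooth compactly supported functions, together with the coordinate
  functions and their pairwise products (for which the Stein identity presupposes finite second
  moments).\<close>

definition stein_test_functions :: "(real^'n::finite \<Rightarrow> real) set" where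
  "stein_test_functions =
     {\<phi>. smooth \<phi> \<and> compact (closure {x. \<phi> x \<noteq> 0})}
     \<union> range (\<lambda>i x. x $ i) \<union> range (\<lambda>(i, j) x. x $ i * x $ j)"

text \<open>The inner product and the norm of the type \<open>real^'n^'n\<close> are the Hilbert-Schmidt ones.
  The two integrability clauses express that the Stein identity is meaningful: otherwise the
  Bochner integral would silently be 0. Symmetry of the kernel is not required: replacing it by
  its symmetric part preserves the identity and does not increase the discrepancy.\<close>

definition stein_kernel :: "(real^'n::finite) measure \<Rightarrow> (real^'n \<Rightarrow> real^'n^'n) \<Rightarrow> bool" where
  "stein_kernel \<nu> \<tau> \<longleftrightarrow>
     \<tau> \<in> borel_measurable \<nu> \<and>
     (\<forall>i j. integrable \<nu> (\<lambda>x. \<tau> x $ i $ j)) \<and>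
     (\<forall>\<phi>\<in>stein_test_functions.
        integrable \<nu> (\<lambda>x. x \<bullet> grad \<phi> x) \<and>
        integrable \<nu> (\<lambda>x. \<tau> x \<bullet> hessian \<phi> x) \<and>
        (\<integral>x. x \<bullet> grad \<phi> x \<partial>\<nu>) = (\<integral>x. \<tau> x \<bullet> hessian \<phi> x \<partial>\<nu>))"

definition ennreal_sqrt :: "ennreal \<Rightarrow> ennreal" where
  "ennreal_sqrt a = (if a = \<top> then \<top> else ennreal (sqrt (enn2real a)))"

text \<open>The discrepancy with respect to the standard Gaussian measure, as determined by the chosen
  kernel.\<close>

definition stein_discrepancy ::
  "(real^'n::finite) measure \<Rightarrow> (real^'n \<Rightarrow> real^'n^'n) \<Rightarrow> ennreal" where
  "stein_discrepancy \<nu> \<tau> = ennreal_sqrt (\<integral>\<^sup>+x. ennreal ((norm (\<tau> x - mat 1))\<^sup>2) \<partial>\<nu>)"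

section \<open>Standard Gaussian measure and quadratic Wasserstein distance\<close>

definition std_gaussian :: "(real^'n::finite) measure" where
  "std_gaussian = density lborel
     (\<lambda>x. ennreal ((2 * pi) powr (- real CARD('n) / 2) * exp (- (norm x)\<^sup>2 / 2)))"

definition couplings :: "'a measure \<Rightarrow> 'b measure \<Rightarrow> ('a \<times> 'b) measure set" where
  "couplings M N =
     {\<pi>. sets \<pi> = sets (M \<Otimes>\<^sub>M N) \<and> distr \<pi> M fst = M \<and> distr \<pi> N snd = N}"

definition wasserstein2 ::
  "(real^'n::finite) measure \<Rightarrow> (real^'n) measure \<Rightarrow> ennreal" where
  "wasserstein2 \<mu> \<nu> =
     (INF \<pi>\<in>couplings \<mu> \<nu>.
        ennreal_sqrt (\<integral>\<^sup>+z. ennreal ((norm (fst z - snd z))\<^sup>2) \<partial>\<pi>))"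

end

(* Let X have law nu, let Z be an independent standard Gaussian vector, and put
   phi_s(y) = -eps log (sum_b exp (-(|y - b|^2 / (2 s) - g(b)) / eps)) for a finite set of points b.
   By Jensen's inequality phi is a smooth subsolution of the Hamilton-Jacobi equation,
   d/ds phi + |grad phi|^2 / 2 <= 0.  Along Y = cos(t) X + sin(t) Z with s = 1 - (1 - delta) sin t,
   the Stein identity in X followed by one Gaussian integration by parts in Z turns
   d/dt E phi_s(Y) into an expression containing only E <(tau(X) - Id)^T Z, grad phi_s(Y)>; Young's
   inequality absorbs the gradient into the Hamilton-Jacobi term and leaves at most
   cos(t) S^2 / (2 (1 - delta)).  Integrating over t in [0, pi/2] gives
   E phi_1(X) - E phi_delta(Z) <= S^2 / (2 (1 - delta)).
   The left-hand side is, up to small errors, the dual value of the entropy-regularised transport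
   problem between nu and a finite-range approximation of the Gaussian, and maximising over g yields
   a coupling whose cost is bounded by that value. *)
theory Submission
  imports Defs
begin

section \<open>Differentiation under the integral sign\<close>

text \<open>Since \<open>\<nu>\<close> may be singular, all smoothness is put into the test
  function: a soft minimum of finitely many quadratics has a bounded Hessian, and truncation extends
  the Stein identity to it. The circular parametrisation reaches the Gaussian in finite time. The
  factor sin t of dY/dt is used up as the chain-rule factor of the integration by parts in Z, while
  the Stein identity supplies the chain-rule factor cos t. Thus cos t can be pulled out of the whole
  derivative. This is why s moves at a speed proportional to cos t: Young's inequality then has the
  same weight at every time, and the sharp constant is the integral of cos t, which is 1. The time s
  stops at delta because the bounds on the potential blow up as s tends to 0. No general duality
  theorem is invoked: with finitely many target points the dual problem maximises a continuous
  function of finitely many variables, and its optimality condition is the marginal constraint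
  itself, so the Gibbs weights of the maximiser already form a transport plan. This plan is finally
  spread over the cells of the approximation in proportion to the Gaussian mass.\<close>

lemma has_real_derivative_integral:
  fixes F D :: "real \<Rightarrow> 'a \<Rightarrow> real"
  assumes r: "r > 0"
    and int: "\<And>t. \<bar>t - t0\<bar> < r \<Longrightarrow> integrable M (F t)"
    and der: "\<And>t x. \<bar>t - t0\<bar> < r \<Longrightarrow> x \<in> space M \<Longrightarrow> ((\<lambda>t. F t x) has_real_derivative D t x) (at t)"
    and bd: "\<And>t x. \<bar>t - t0\<bar> < r \<Longrightarrow> x \<in> space M \<Longrightarrow> \<bar>D t x\<bar> \<le> B x"
    and B: "integrable M B"
  shows "integrable M (D t0)"
    and "((\<lambda>t. \<integral>x. F t x \<partial>M) has_real_derivative (\<integral>x. D t0 x \<partial>M)) (at t0)"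
proof -
  \<comment> \<open>Working along sequences makes dominated convergence available. Measurability of
    \<open>D t0\<close> comes from the limit, and the mean value inequality bounds the quotients by
    \<open>B\<close>.\<close>
  have quot: "integrable M (D t0) \<and> (\<lambda>i. ((\<integral>x. F (X i) x \<partial>M) - (\<integral>x. F t0 x \<partial>M)) / (X i - t0)) \<longlonglongrightarrow> (\<integral>x. D t0 x \<partial>M)"
    if X: "\<And>i. X i \<noteq> t0" "\<And>i. \<bar>X i - t0\<bar> < r" "X \<longlonglongrightarrow> t0" for X
  proof -
    define q where "q i x = (F (X i) x - F t0 x) / (X i - t0)" for i x
    have qm [measurable]: "q i \<in> borel_measurable M" for i
      using int[OF X(2)[of i]] int[of t0] r unfolding q_def by auto
    have lim: "(\<lambda>i. q i x) \<longlonglongrightarrow> D t0 x" if x: "x \<in> space M" for x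
    proof -
      have "((\<lambda>t. (F t x - F t0 x) / (t - t0)) \<longlongrightarrow> D t0 x) (at t0)"
        using der[of t0 x] r x by (simp add: has_field_derivative_iff)
      then show ?thesis
        using X unfolding tendsto_at_iff_sequentially q_def comp_def by auto
    qed
    have Dm [measurable]: "D t0 \<in> borel_measurable M"
      by (rule borel_measurable_LIMSEQ_real[OF lim]) auto
    have bound: "\<bar>q i x\<bar> \<le> B x" if x: "x \<in> space M" for i x
    proof -
      have "norm (F (X i) x - F t0 x) \<le> B x * norm (X i - t0)"
      proof (rule field_differentiable_bound[where S = "{t. \<bar>t - t0\<bar> < r}" and f' = "\<lambda>t. D t x"])
        have "{t. \<bar>t - t0\<bar> < r} = ball t0 r"
          by (auto simp: dist_real_def)
        then show "convex {t. \<bar>t - t0\<bar> < r}" by simp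
      qed (use X r x in \<open>auto intro!: bd DERIV_subset[OF der]\<close>)
      then show ?thesis
        using X(1)[of i] by (simp add: q_def divide_simps)
    qed
    have I: "integrable M (D t0)"
      by (rule integrable_dominated_convergence[where s = q and w = B]) (use B lim bound in auto)
    have L: "(\<lambda>i. \<integral>x. q i x \<partial>M) \<longlonglongrightarrow> (\<integral>x. D t0 x \<partial>M)"
      by (rule integral_dominated_convergence[where w = B]) (use B lim bound in auto)
    have "(\<integral>x. q i x \<partial>M) = ((\<integral>x. F (X i) x \<partial>M) - (\<integral>x. F t0 x \<partial>M)) / (X i - t0)" for i
      unfolding q_def using int[OF X(2)[of i]] int[of t0] r by simp
    with L I show ?thesis by simp
  qed
  have "integrable M (D t0)"
  proof (rule quot[THEN conjunct1])
    show "(\<lambda>n. t0 + r / 2 * inverse (real (Suc n))) \<longlonglongrightarrow> t0"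
      using tendsto_add[OF tendsto_const tendsto_mult[OF tendsto_const LIMSEQ_inverse_real_of_nat], of t0 "r / 2"]
      by simp
    fix i
    have "r / 2 * inverse (real (Suc i)) \<le> r / 2"
      using r by (simp add: field_simps)
    moreover have "r / 2 * inverse (real (Suc i)) > 0"
      using r by simp
    ultimately show "t0 + r / 2 * inverse (real (Suc i)) \<noteq> t0"
      "\<bar>t0 + r / 2 * inverse (real (Suc i)) - t0\<bar> < r" 
      using r by linarith+
  qed
  then show "integrable M (D t0)" .
  have "((\<lambda>t. ((\<integral>x. F t x \<partial>M) - (\<integral>x. F t0 x \<partial>M)) / (t - t0)) \<longlongrightarrow> (\<integral>x. D t0 x \<partial>M)) (at t0 within {t. \<bar>t - t0\<bar> < r})"
    unfolding tendsto_at_iff_sequentially comp_def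
  proof (intro allI impI)
    fix X assume "\<forall>i. X i \<in> {t. \<bar>t - t0\<bar> < r} - {t0}" "X \<longlonglongrightarrow> t0"
    then show "(\<lambda>i. ((\<integral>x. F (X i) x \<partial>M) - (\<integral>x. F t0 x \<partial>M)) / (X i - t0)) \<longlonglongrightarrow> (\<integral>x. D t0 x \<partial>M)"
      using quot[of X] by auto
  qed
  moreover have "at t0 within {t. \<bar>t - t0\<bar> < r} = at t0"
  proof (rule at_within_open)
    have "{t. \<bar>t - t0\<bar> < r} = ball t0 r"
      by (auto simp: dist_real_def)
    then show "open {t. \<bar>t - t0\<bar> < r}" by simp
  qed (use r in auto)
  ultimately show "((\<lambda>t. \<integral>x. F t x \<partial>M) has_real_derivative (\<integral>x. D t0 x \<partial>M)) (at t0)"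
    by (simp add: has_field_derivative_iff)
qed

section \<open>Elementary smooth functions\<close>

text \<open>Negative powers of y times the classical flat function exp(-1/y). The index
  \<open>k\<close> makes the family closed under differentiation up to linear combinations, as the
  class \<open>elementary\<close> requires.\<close>

definition flat :: "nat \<Rightarrow> real \<Rightarrow> real" where
  "flat k y = (if y > 0 then exp (- 1 / y) / y ^ k else 0)"

lemma flat_nonneg: "flat k y \<ge> 0"
  by (simp add: flat_def)

text \<open>The single term of order k + 1 in the exponential series at 1/y already suffices. One
  power of y is left over, so the bound tends to 0 at the origin.\<close>

lemma flat_le: "flat k y \<le> fact (Suc k) * \<bar>y\<bar>"
proof (cases "y > 0")
  case True
  have "(1 / y) ^ Suc k / fact (Suc k) \<le> exp (1 / y)"
  proof -
    have "(\<Sum>n\<in>{Suc k}. (1 / y) ^ n /\<^sub>R fact n) \<le> exp (1 / y)"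
      unfolding exp_def
      by (rule sum_le_suminf) (use True in \<open>auto intro!: summable_exp_generic scaleR_nonneg_nonneg simp del: real_scaleR_def\<close>)
    then show ?thesis by (simp add: divide_inverse mult.commute)
  qed
  then have "1 \<le> fact (Suc k) * y ^ Suc k * exp (1 / y)"
    using True by (simp add: power_one_over pos_divide_le_eq divide_le_eq mult_ac del: fact_Suc power_Suc)
  then have "exp (- 1 / y) \<le> fact (Suc k) * y ^ Suc k"
    using mult_right_mono[of 1 "fact (Suc k) * y ^ Suc k * exp (1 / y)" "exp (- 1 / y)"]
    by (simp add: mult.assoc flip: exp_add del: fact_Suc power_Suc)
  then show ?thesis
    using True by (simp add: flat_def pos_divide_le_eq mult_ac del: fact_Suc)
qed (auto simp: flat_def not_less intro!: mult_nonneg_nonpos simp del: fact_Suc)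

lemma flat_has_real_derivative:
  "(flat k has_real_derivative flat (k + 2) y - real k * flat (k + 1) y) (at y)"
proof -
  consider "y > 0" | "y < 0" | "y = 0" by linarith
  then show ?thesis
  proof cases
    case 1
    have "((\<lambda>y. exp (- 1 / y) / y ^ k) has_real_derivative flat (k + 2) y - real k * flat (k + 1) y) (at y)"
      using 1
      apply (auto intro!: derivative_eq_intros simp: flat_def)
      apply (cases k)
      apply (auto simp: field_simps power2_eq_square)
      done
    then show ?thesis
    proof (rule has_field_derivative_transform_within_open[where S = "{0<..}"])
    qed (use 1 in \<open>auto simp: flat_def\<close>)
  next
    case 2
    have "((\<lambda>y. 0) has_real_derivative flat (k + 2) y - real k * flat (k + 1) y) (at y)"
      using 2 by (simp add: flat_def)
    then show ?thesis
    proof (rule has_field_derivative_transform_within_open[where S = "{..<0}"])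
    qed (use 2 in \<open>auto simp: flat_def\<close>)
  next
    case 3
    \<comment> \<open>At the origin the difference quotient of \<open>flat k\<close> is
      \<open>flat (Suc k)\<close>, which the linear bound squeezes to 0; both terms of the claimed
      derivative vanish there.\<close>
    have "((\<lambda>h. fact (k + 2) * \<bar>h\<bar>) \<longlongrightarrow> fact (k + 2) * \<bar>0\<bar>) (at (0::real))"
      by (intro tendsto_intros)
    then have "((\<lambda>h. flat (Suc k) h) \<longlongrightarrow> 0) (at 0)"
      using tendsto_sandwich[of "\<lambda>_. 0" "flat (Suc k)" "at 0" "\<lambda>h. fact (k + 2) * \<bar>h\<bar>" 0]
        flat_le[of "Suc k"] flat_nonneg by (simp del: fact_Suc)
    moreover have "flat (Suc k) h = flat k h / h" for h
      by (simp add: flat_def)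
    ultimately show ?thesis
      using 3 by (simp add: has_field_derivative_iff) (simp add: flat_def)
  qed
qed

text \<open>A class of functions closed under partial derivatives, hence consisting of smooth functions,
  that contains the potentials and the cutoffs used below.\<close>

inductive elementary :: "(real^'n::finite \<Rightarrow> real) \<Rightarrow> bool" where
  const: "elementary (\<lambda>x. c)"
| coord: "elementary (\<lambda>x. x $ i)"
| add: "elementary f \<Longrightarrow> elementary g \<Longrightarrow> elementary (\<lambda>x. f x + g x)"
| mult: "elementary f \<Longrightarrow> elementary g \<Longrightarrow> elementary (\<lambda>x. f x * g x)"
| exp: "elementary f \<Longrightarrow> elementary (\<lambda>x. exp (f x))"
| inverse: "elementary f \<Longrightarrow> (\<And>x. f x \<noteq> 0) \<Longrightarrow> elementary (\<lambda>x. inverse (f x))"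
| ln: "elementary f \<Longrightarrow> (\<And>x. f x > 0) \<Longrightarrow> elementary (\<lambda>x. ln (f x))"
| flat: "elementary f \<Longrightarrow> elementary (\<lambda>x. flat k (f x))"

lemma elementary_cmult: "elementary f \<Longrightarrow> elementary (\<lambda>x. c * f x)"
  by (intro elementary.intros)

lemma elementary_diff: "elementary f \<Longrightarrow> elementary g \<Longrightarrow> elementary (\<lambda>x. f x - g x)"
  using elementary.add[OF _ elementary_cmult[of g "-1"], of f] by simp

lemma elementary_sum:
  "finite I \<Longrightarrow> (\<And>i. i \<in> I \<Longrightarrow> elementary (f i)) \<Longrightarrow> elementary (\<lambda>x. \<Sum>i\<in>I. f i x)"
  by (induction I rule: finite_induct) (auto intro: elementary.intros)

text \<open>The direction \<open>h\<close> is fixed while the base point varies. In this form each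
  directional derivative belongs to the class again, so differentiation can be iterated.\<close>

lemma elementary_has_derivative:
  assumes "elementary f"
  shows "\<exists>D. (\<forall>x. (f has_derivative D x) (at x)) \<and> (\<forall>h. elementary (\<lambda>x. D x h))"
  using assms
proof induction
  case (const c)
  then show ?case
    by (intro exI[of _ "\<lambda>x h. 0"]) (auto intro: elementary.intros)
next
  case (coord i)
  then show ?case
    by (intro exI[of _ "\<lambda>x h. h $ i"]) (auto intro: elementary.intros bounded_linear_imp_has_derivative bounded_linear_vec_nth)
next
  case (add f g)
  then obtain Df Dg where "\<And>x. (f has_derivative Df x) (at x)" "\<And>h. elementary (\<lambda>x. Df x h)"
    "\<And>x. (g has_derivative Dg x) (at x)" "\<And>h. elementary (\<lambda>x. Dg x h)" by blast
  then show ?case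
    by (intro exI[of _ "\<lambda>x h. Df x h + Dg x h"]) (auto intro!: elementary.intros derivative_intros)
next
  case (mult f g)
  then obtain Df Dg where "\<And>x. (f has_derivative Df x) (at x)" "\<And>h. elementary (\<lambda>x. Df x h)"
    "\<And>x. (g has_derivative Dg x) (at x)" "\<And>h. elementary (\<lambda>x. Dg x h)" by blast
  with mult show ?case
    by (intro exI[of _ "\<lambda>x h. f x * Dg x h + Df x h * g x"]) (auto intro!: elementary.intros derivative_intros)
next
  case (exp f)
  then obtain Df where "\<And>x. (f has_derivative Df x) (at x)" "\<And>h. elementary (\<lambda>x. Df x h)" by blast
  with exp show ?case
    by (intro exI[of _ "\<lambda>x h. Df x h * exp (f x)"]) (auto intro!: elementary.intros derivative_eq_intros)
next
  case (inverse f)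
  then obtain Df where "\<And>x. (f has_derivative Df x) (at x)" "\<And>h. elementary (\<lambda>x. Df x h)" by blast
  with inverse show ?case
    by (intro exI[of _ "\<lambda>x h. (- 1) * (inverse (f x) * Df x h * inverse (f x))"] conjI allI
        elementary.intros) (auto intro!: derivative_eq_intros)
next
  case (ln f)
  then obtain Df where *: "\<And>x. (f has_derivative Df x) (at x)" "\<And>h. elementary (\<lambda>x. Df x h)" by blast
  have "elementary (\<lambda>x. inverse (f x))"
    using ln by (intro elementary.intros) (auto simp: less_imp_neq[symmetric])
  with ln * show ?case
    by (intro exI[of _ "\<lambda>x h. Df x h * inverse (f x)"]) (auto intro!: elementary.intros derivative_eq_intros)
next
  case (flat f k)
  then obtain Df where *: "\<And>x. (f has_derivative Df x) (at x)" "\<And>h. elementary (\<lambda>x. Df x h)" by blast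
  have "((\<lambda>x. flat k (f x)) has_derivative (\<lambda>h. Df x h * (flat (k + 2) (f x) - real k * flat (k + 1) (f x)))) (at x)" for x
    using has_derivative_compose[OF *(1) flat_has_real_derivative[unfolded has_field_derivative_def]]
    by (simp add: mult.commute)
  with flat * show ?case
    by (intro exI[of _ "\<lambda>x h. Df x h * (flat (k + 2) (f x) - real k * flat (k + 1) (f x))"])
      (auto intro!: elementary.intros elementary_diff)
qed

section \<open>Partial derivatives of elementary functions\<close>

lemma partial_deriv_eq: "(f has_derivative D) (at x) \<Longrightarrow> partial_deriv i f x = D (axis i 1)"
  using frechet_derivative_at[of f D x] by (simp add: partial_deriv_def)

lemma elementary_partial_deriv: "elementary f \<Longrightarrow> elementary (partial_deriv i f)"
proof -
  assume "elementary f"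
  then obtain D where "\<And>x. (f has_derivative D x) (at x)" "\<And>h. elementary (\<lambda>x. D x h)"
    using elementary_has_derivative by blast
  then have "partial_deriv i f = (\<lambda>x. D x (axis i 1))" "elementary (\<lambda>x. D x (axis i 1))"
    using partial_deriv_eq by blast+
  then show ?thesis by simp
qed

lemma elementary_differentiable: "elementary f \<Longrightarrow> f differentiable (at x)"
  using elementary_has_derivative[of f] unfolding differentiable_def by blast

lemma elementary_imp_smooth:
  assumes "elementary f"
  shows "smooth f"
proof -
  have "elementary (iterated_partial is f)" for "is"
    by (induction "is") (simp_all add: assms elementary_partial_deriv)
  then show ?thesis
    by (simp add: smooth_def elementary_differentiable)
qed

lemma elementary_continuous: "elementary f \<Longrightarrow> continuous_on S f"
  using elementary_differentiable differentiable_imp_continuous_on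
  by (metis differentiable_at_withinI differentiable_on_def)

lemma elementary_borel [measurable]: "elementary f \<Longrightarrow> f \<in> borel_measurable borel"
  using elementary_continuous borel_measurable_continuous_onI by blast

lemma has_derivative_axis_sum:
  fixes f :: "real^'n::finite \<Rightarrow> real"
  assumes "(f has_derivative D) (at x)"
  shows "D h = (\<Sum>i\<in>UNIV. h $ i * D (axis i 1))"
proof -
  interpret bounded_linear D using assms by (rule has_derivative_bounded_linear)
  have "D h = D (\<Sum>i\<in>UNIV. h $ i *\<^sub>R axis i 1)"
    using basis_expansion[of h] by (simp add: scalar_mult_eq_scaleR)
  also have "\<dots> = (\<Sum>i\<in>UNIV. h $ i * D (axis i 1))"
    by (simp add: sum scaleR)
  finally show ?thesis .
qed

lemma elementary_has_derivative_partial: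
  assumes "elementary f"
  shows "(f has_derivative (\<lambda>h. \<Sum>i\<in>UNIV. h $ i * partial_deriv i f x)) (at x)"
proof -
  obtain D where D: "(f has_derivative D) (at x)"
    using elementary_has_derivative[OF assms] by blast
  then have "D = (\<lambda>h. \<Sum>i\<in>UNIV. h $ i * partial_deriv i f x)"
    unfolding partial_deriv_eq[OF D] by (intro ext has_derivative_axis_sum[OF D])
  with D show ?thesis by simp
qed

lemma sum_axis_mult: "(\<Sum>k\<in>UNIV. axis i 1 $ k * c k) = (c i :: real)"
proof -
  have "axis i 1 $ k * c k = (if k = i then c k else 0)" for k
    by (simp add: axis_def)
  then show ?thesis by simp
qed

lemma partial_deriv_mult:
  assumes "elementary f" "elementary g"
  shows "partial_deriv i (\<lambda>x. f x * g x) = (\<lambda>x. f x * partial_deriv i g x + partial_deriv i f x * g x)"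
proof
  fix x
  have "((\<lambda>x. f x * g x) has_derivative (\<lambda>h. f x * (\<Sum>i\<in>UNIV. h $ i * partial_deriv i g x) + (\<Sum>i\<in>UNIV. h $ i * partial_deriv i f x) * g x)) (at x)"
    by (intro has_derivative_mult elementary_has_derivative_partial assms)
  from partial_deriv_eq[OF this, of i]
  show "partial_deriv i (\<lambda>x. f x * g x) x = f x * partial_deriv i g x + partial_deriv i f x * g x"
    by (simp only: sum_axis_mult)
qed

lemma partial_deriv_add:
  assumes "elementary f" "elementary g"
  shows "partial_deriv i (\<lambda>x. f x + g x) = (\<lambda>x. partial_deriv i f x + partial_deriv i g x)"
proof
  fix x
  have "((\<lambda>x. f x + g x) has_derivative (\<lambda>h. (\<Sum>i\<in>UNIV. h $ i * partial_deriv i f x) + (\<Sum>i\<in>UNIV. h $ i * partial_deriv i g x))) (at x)"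
    by (intro has_derivative_add elementary_has_derivative_partial assms)
  from partial_deriv_eq[OF this, of i]
  show "partial_deriv i (\<lambda>x. f x + g x) x = partial_deriv i f x + partial_deriv i g x"
    by (simp only: sum_axis_mult)
qed

text \<open>A convex domain is allowed because the growth estimate uses balls whose radius depends
  on the point. The cardinality arises from bounding the operator norm by a sum over the
  coordinates.\<close>

lemma elementary_lipschitz:
  fixes f :: "real^'n::finite \<Rightarrow> real"
  assumes f: "elementary f" and S: "convex S" "x \<in> S" "y \<in> S"
    and C: "\<And>z i. z \<in> S \<Longrightarrow> \<bar>partial_deriv i f z\<bar> \<le> C"
  shows "\<bar>f x - f y\<bar> \<le> real CARD('n) * C * norm (x - y)"
proof -
  have "norm (f x - f y) \<le> real CARD('n) * C * norm (x - y)"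
  proof (rule differentiable_bound[OF S(1) _ _ S(2,3)])
    fix z assume z: "z \<in> S"
    show "(f has_derivative (\<lambda>h. \<Sum>i\<in>UNIV. h $ i * partial_deriv i f z)) (at z within S)"
      using elementary_has_derivative_partial[OF f] by (rule has_derivative_at_withinI)
    show "onorm (\<lambda>h. \<Sum>i\<in>UNIV. h $ i * partial_deriv i f z) \<le> real CARD('n) * C"
    proof (rule onorm_le)
      fix h :: "real^'n"
      have "norm (\<Sum>i\<in>UNIV. h $ i * partial_deriv i f z) \<le> (\<Sum>i\<in>(UNIV::'n set). norm h * C)"
      proof (rule sum_norm_le)
        fix i
        show "norm (h $ i * partial_deriv i f z) \<le> norm h * C"
          using component_le_norm_cart[of h i] C[OF z, of i]
          by (simp add: abs_mult mult_mono)
      qed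
      then show "norm (\<Sum>i\<in>UNIV. h $ i * partial_deriv i f z) \<le> real CARD('n) * C * norm h"
        by (simp add: mult_ac)
    qed
  qed
  then show ?thesis by simp
qed

section \<open>Growth of functions with bounded second derivatives\<close>

lemma mult_add_one_le: "(1 + r) * r \<le> 2 * (1 + r\<^sup>2)" for r :: real
proof -
  have "2 * (1 + r\<^sup>2) - (1 + r) * r = (r - 1 / 2)\<^sup>2 + 7 / 4"
    by (simp add: power2_eq_square field_simps)
  moreover have "(r - 1 / 2)\<^sup>2 \<ge> 0" by simp
  ultimately show ?thesis by linarith
qed

text \<open>The mean value inequality from the origin is used twice: for the gradient on the whole
  space, then for the function on the ball of radius \<open>norm x\<close>, where the gradient is at
  most of order 1 + \<open>norm x\<close>.\<close>

lemma elementary_quadratic_growth: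
  fixes f :: "real^'n::finite \<Rightarrow> real"
  assumes f: "elementary f" and C: "\<And>x i j. \<bar>partial_deriv i (partial_deriv j f) x\<bar> \<le> C"
  obtains A where "A \<ge> 0" "\<And>x. \<bar>f x\<bar> \<le> A * (1 + (norm x)\<^sup>2)"
    "\<And>x j. \<bar>partial_deriv j f x\<bar> \<le> A * (1 + norm x)"
proof -
  define N where "N = real CARD('n)"
  define A1 where "A1 = (\<Sum>j\<in>UNIV. \<bar>partial_deriv j f 0\<bar>) + N * C"
  define A where "A = \<bar>f 0\<bar> + 2 * N * A1 + A1"
  have C0: "C \<ge> 0" using C[of undefined undefined undefined] by linarith
  have N: "N \<ge> 0" by (simp add: N_def)
  have A10: "A1 \<ge> 0" using C0 N by (auto simp: A1_def intro!: add_nonneg_nonneg sum_nonneg)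
  have g: "\<bar>partial_deriv j f x\<bar> \<le> A1 * (1 + norm x)" for x j
  proof -
    have "\<bar>partial_deriv j f x - partial_deriv j f 0\<bar> \<le> N * C * norm x"
      using elementary_lipschitz[where S = UNIV and y = 0 and f = "partial_deriv j f", OF elementary_partial_deriv[OF f] _ _ _ C]
      by (simp add: N_def)
    moreover have "\<bar>partial_deriv j f 0\<bar> \<le> (\<Sum>j\<in>UNIV. \<bar>partial_deriv j f 0\<bar>)"
      by (rule member_le_sum) auto
    moreover have "0 \<le> (\<Sum>j\<in>UNIV. \<bar>partial_deriv j f 0\<bar>) * norm x" "0 \<le> N * C"
      using C0 N by (auto intro!: mult_nonneg_nonneg sum_nonneg)
    moreover have "A1 * (1 + norm x) = (\<Sum>j\<in>UNIV. \<bar>partial_deriv j f 0\<bar>) + N * C + (\<Sum>j\<in>UNIV. \<bar>partial_deriv j f 0\<bar>) * norm x + N * C * norm x"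
      by (simp add: A1_def distrib_left distrib_right)
    ultimately show ?thesis
      by linarith
  qed
  have h: "\<bar>f x\<bar> \<le> \<bar>f 0\<bar> + 2 * N * A1 * (1 + (norm x)\<^sup>2)" for x
  proof -
    have "\<bar>f x - f 0\<bar> \<le> N * (A1 * (1 + norm x)) * norm (x - 0)"
      unfolding N_def
    proof (rule elementary_lipschitz[where S = "cball 0 (norm x)", OF f])
      fix z :: "real^'n" and i assume "z \<in> cball 0 (norm x)"
      then have "A1 * (1 + norm z) \<le> A1 * (1 + norm x)"
        using A10 by (intro mult_left_mono) auto
      with g[of i z] show "\<bar>partial_deriv i f z\<bar> \<le> A1 * (1 + norm x)" by linarith
    qed auto
    also have "\<dots> = N * A1 * ((1 + norm x) * norm x)" by simp
    also have "\<dots> \<le> N * A1 * (2 * (1 + (norm x)\<^sup>2))"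
    proof (rule mult_left_mono)
      show "(1 + norm x) * norm x \<le> 2 * (1 + (norm x)\<^sup>2)"
        by (rule mult_add_one_le)
    qed (use N A10 in simp)
    also have "\<dots> = 2 * N * A1 * (1 + (norm x)\<^sup>2)" by simp
    finally show ?thesis by linarith
  qed
  show ?thesis
  proof
    show "A \<ge> 0" using A10 N by (simp add: A_def)
    show "\<bar>f x\<bar> \<le> A * (1 + (norm x)\<^sup>2)" for x
    proof -
      have "A * (1 + (norm x)\<^sup>2) = (\<bar>f 0\<bar> + 2 * N * A1 * (1 + (norm x)\<^sup>2)) + (\<bar>f 0\<bar> * (norm x)\<^sup>2 + A1 * (1 + (norm x)\<^sup>2))"
        by (simp add: A_def algebra_simps)
      moreover have "0 \<le> \<bar>f 0\<bar> * (norm x)\<^sup>2 + A1 * (1 + (norm x)\<^sup>2)"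
        using A10 by (intro add_nonneg_nonneg mult_nonneg_nonneg) auto
      ultimately show ?thesis
        using h[of x] by linarith
    qed
    show "\<bar>partial_deriv j f x\<bar> \<le> A * (1 + norm x)" for x j
    proof -
      have "A * (1 + norm x) = A1 * (1 + norm x) + (\<bar>f 0\<bar> + 2 * N * A1) * (1 + norm x)"
        by (simp add: A_def algebra_simps)
      moreover have "0 \<le> (\<bar>f 0\<bar> + 2 * N * A1) * (1 + norm x)"
        using A10 N by (intro add_nonneg_nonneg mult_nonneg_nonneg) auto
      ultimately show ?thesis
        using g[of j x] by linarith
    qed
  qed
qed

text \<open>The cutoff has no plateau; it suffices that it tends to 1 pointwise as \<open>R\<close> grows.\<close>

definition cutoff :: "real \<Rightarrow> real^'n::finite \<Rightarrow> real" where
  "cutoff R x = exp 1 * flat 0 (1 - (norm x)\<^sup>2 / R\<^sup>2)"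

lemma norm_sq_cart: "(norm (x::real^'n::finite))\<^sup>2 = (\<Sum>i\<in>UNIV. x $ i * x $ i)"
  by (simp add: power2_norm_eq_inner inner_vec_def)

lemma elementary_norm_sq: "elementary (\<lambda>x::real^'n::finite. (norm x)\<^sup>2)"
  unfolding norm_sq_cart by (intro elementary_sum elementary.intros) auto

lemma elementary_cutoff: "elementary (cutoff R)"
proof -
  have "elementary (\<lambda>x. exp 1 * flat 0 (1 - inverse (R\<^sup>2) * (norm x)\<^sup>2))"
    by (intro elementary.intros elementary_diff elementary_norm_sq)
  then show ?thesis
    by (simp add: cutoff_def[abs_def] divide_inverse mult.commute)
qed

lemma flat_norm_sq_has_derivative:
  "((\<lambda>x::real^'n::finite. flat k (1 - (norm x)\<^sup>2 / R\<^sup>2)) has_derivative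
     (\<lambda>h. (flat (k + 2) (1 - (norm x)\<^sup>2 / R\<^sup>2) - real k * flat (k + 1) (1 - (norm x)\<^sup>2 / R\<^sup>2)) * (- (2 / R\<^sup>2) * (x \<bullet> h)))) (at x)"
proof (rule has_derivative_compose[where g = "flat k", OF _ flat_has_real_derivative[unfolded has_field_derivative_def]])
  have "((\<lambda>x. 1 - c * (x \<bullet> x)) has_derivative (\<lambda>h. - (2 * c) * (x \<bullet> h))) (at x)" for c
    by (auto intro!: derivative_eq_intros simp: inner_commute)
  from this[of "inverse (R\<^sup>2)"]
  show "((\<lambda>x. 1 - (norm x)\<^sup>2 / R\<^sup>2) has_derivative (\<lambda>h. - (2 / R\<^sup>2) * (x \<bullet> h))) (at x)"
    by (simp add: power2_norm_eq_inner divide_inverse mult.commute)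
qed

lemma partial_deriv_cutoff:
  "partial_deriv j (cutoff R) = (\<lambda>x. - (2 * exp 1 / R\<^sup>2) * (flat 2 (1 - (norm x)\<^sup>2 / R\<^sup>2) * x $ j))"
proof
  fix x :: "real^'a"
  have "(cutoff R has_derivative (\<lambda>h. exp 1 * ((flat 2 (1 - (norm x)\<^sup>2 / R\<^sup>2)) * (- (2 / R\<^sup>2) * (x \<bullet> h))))) (at x)"
    using has_derivative_mult_right[OF flat_norm_sq_has_derivative[of 0 R x], of "exp 1"]
    by (simp add: cutoff_def[abs_def] numeral_2_eq_2)
  from partial_deriv_eq[OF this, of j]
  show "partial_deriv j (cutoff R) x = - (2 * exp 1 / R\<^sup>2) * (flat 2 (1 - (norm x)\<^sup>2 / R\<^sup>2) * x $ j)"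
    by (simp add: inner_axis)
qed

text \<open>The ratios \<open>x $ i / R\<close> are at most 1 in absolute value on the ball carrying
  the cutoff, so this form makes the decay in \<open>R\<close> explicit.\<close>

lemma partial_deriv2_cutoff:
  "partial_deriv i (partial_deriv j (cutoff R)) x =
    exp 1 / R\<^sup>2 * (4 * (flat 4 (1 - (norm x)\<^sup>2 / R\<^sup>2) - 2 * flat 3 (1 - (norm x)\<^sup>2 / R\<^sup>2)) * (x $ i / R) * (x $ j / R)
      - 2 * flat 2 (1 - (norm x)\<^sup>2 / R\<^sup>2) * (if i = j then 1 else 0))"
proof -
  have "(partial_deriv j (cutoff R) has_derivative (\<lambda>h. - (2 * exp 1 / R\<^sup>2) * 
      (flat 2 (1 - (norm x)\<^sup>2 / R\<^sup>2) * h $ j + ((flat 4 (1 - (norm x)\<^sup>2 / R\<^sup>2) - 2 * flat 3 (1 - (norm x)\<^sup>2 / R\<^sup>2)) * (- (2 / R\<^sup>2) * (x \<bullet> h))) * x $ j))) (at x)"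
    unfolding partial_deriv_cutoff
    using has_derivative_mult_right[OF has_derivative_mult[OF flat_norm_sq_has_derivative[of 2 R x] bounded_linear_imp_has_derivative[OF bounded_linear_vec_nth[of j]]], of "- (2 * exp 1 / R\<^sup>2)"]
    by simp
  from partial_deriv_eq[OF this, of i]
  have "partial_deriv i (partial_deriv j (cutoff R)) x = - (2 * exp 1 / R\<^sup>2) * 
      (flat 2 (1 - (norm x)\<^sup>2 / R\<^sup>2) * (if i = j then 1 else 0) + ((flat 4 (1 - (norm x)\<^sup>2 / R\<^sup>2) - 2 * flat 3 (1 - (norm x)\<^sup>2 / R\<^sup>2)) * (- (2 / R\<^sup>2) * x $ i)) * x $ j)"
    by (simp add: inner_axis) (auto simp: axis_def)
  \<comment> \<open>For \<open>R = 0\<close> both sides are 0 by the convention for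
    division.\<close>
  then show ?thesis
    by (cases "R = 0") (auto simp: divide_simps power2_eq_square algebra_simps)
qed

lemma flat_le_fact: "y \<le> 1 \<Longrightarrow> \<bar>flat k y\<bar> \<le> fact (Suc k)"
proof -
  assume y: "y \<le> 1"
  show ?thesis
  proof (cases "y > 0")
    case True
    then have "fact (Suc k) * \<bar>y\<bar> \<le> fact (Suc k) * 1"
      using y by (intro mult_left_mono) auto
    then show ?thesis using flat_le[of k y] flat_nonneg[of k y] by linarith
  qed (simp add: flat_def)
qed

text \<open>The constant 700 is a common round bound. The factorial estimates 6, 24 and 120 for
  \<open>flat 2\<close>, \<open>flat 3\<close> and \<open>flat 4\<close> give 4 * (120 + 2 * 24) + 2
  * 6 = 684 in the second derivative, and the other cases are smaller.\<close>

lemma cutoff_bounds: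
  fixes x :: "real^'n::finite"
  assumes R: "R > 0"
  shows "\<bar>cutoff R x\<bar> \<le> 700 * exp 1"
    and "\<bar>partial_deriv j (cutoff R) x\<bar> \<le> 700 * exp 1 / R"
    and "\<bar>partial_deriv i (partial_deriv j (cutoff R)) x\<bar> \<le> 700 * exp 1 / R\<^sup>2"
    and "norm x \<ge> R \<Longrightarrow> cutoff R x = 0"
    and "norm x \<ge> R \<Longrightarrow> partial_deriv j (cutoff R) x = 0"
    and "norm x \<ge> R \<Longrightarrow> partial_deriv i (partial_deriv j (cutoff R)) x = 0"
proof -
  define u where "u = 1 - (norm x)\<^sup>2 / R\<^sup>2"
  have u1: "u \<le> 1" by (simp add: u_def)
  have z: "flat k u = 0" if "norm x \<ge> R" for k
  proof -
    have "R\<^sup>2 \<le> (norm x)\<^sup>2" using that R by (intro power_mono) auto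
    then have "u \<le> 0" using R by (simp add: u_def divide_simps)
    then show ?thesis by (simp add: flat_def)
  qed
  show "norm x \<ge> R \<Longrightarrow> cutoff R x = 0"
    by (simp add: cutoff_def u_def[symmetric] z)
  show "norm x \<ge> R \<Longrightarrow> partial_deriv j (cutoff R) x = 0"
    by (simp add: partial_deriv_cutoff u_def[symmetric] z)
  show "norm x \<ge> R \<Longrightarrow> partial_deriv i (partial_deriv j (cutoff R)) x = 0"
    by (simp add: partial_deriv2_cutoff u_def[symmetric] z)
  have f: "\<bar>flat 0 u\<bar> \<le> 1" "\<bar>flat 2 u\<bar> \<le> 6" "\<bar>flat 3 u\<bar> \<le> 24" "\<bar>flat 4 u\<bar> \<le> 120"
    using flat_le_fact[OF u1, of 0] flat_le_fact[OF u1, of 2] flat_le_fact[OF u1, of 3] flat_le_fact[OF u1, of 4]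
    by (simp_all add: fact_numeral eval_nat_numeral)
  show "\<bar>cutoff R x\<bar> \<le> 700 * exp 1"
    using f(1) by (simp add: cutoff_def u_def[symmetric] abs_mult)
  have c: "norm x < R \<Longrightarrow> \<bar>x $ k / R\<bar> \<le> 1" for k
    using component_le_norm_cart[of x k] R by simp
  show "\<bar>partial_deriv j (cutoff R) x\<bar> \<le> 700 * exp 1 / R"
  proof (cases "norm x < R")
    case True
    have "\<bar>flat 2 u * (x $ j / R)\<bar> \<le> 6 * 1"
      unfolding abs_mult using f c[OF True, of j] by (intro mult_mono) auto
    then have "2 * exp 1 / R * \<bar>flat 2 u * (x $ j / R)\<bar> \<le> 2 * exp 1 / R * 350"
      using R by (intro mult_left_mono) auto
    moreover have "\<bar>partial_deriv j (cutoff R) x\<bar> = 2 * exp 1 / R * \<bar>flat 2 u * (x $ j / R)\<bar>"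
      using R by (simp add: partial_deriv_cutoff u_def abs_mult power2_eq_square)
    ultimately show ?thesis by simp
  next
    case False
    then show ?thesis using R
      by (simp only: partial_deriv_cutoff u_def[symmetric] z) simp
  qed
  show "\<bar>partial_deriv i (partial_deriv j (cutoff R)) x\<bar> \<le> 700 * exp 1 / R\<^sup>2"
  proof (cases "norm x < R")
    case True
    have "\<bar>4 * (flat 4 u - 2 * flat 3 u) * (x $ i / R) * (x $ j / R)\<bar> \<le> 672 * 1 * 1"
      unfolding abs_mult using f c[OF True, of j] c[OF True, of i] by (intro mult_mono) auto
    then have "\<bar>4 * (flat 4 u - 2 * flat 3 u) * (x $ i / R) * (x $ j / R) - 2 * flat 2 u * (if i = j then 1 else 0)\<bar> \<le> 700"
      using f by (auto simp: abs_if split: if_splits)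
    then have "exp 1 / R\<^sup>2 * \<bar>4 * (flat 4 u - 2 * flat 3 u) * (x $ i / R) * (x $ j / R) - 2 * flat 2 u * (if i = j then 1 else 0)\<bar>
       \<le> exp 1 / R\<^sup>2 * 700"
      using R by (intro mult_left_mono) auto
    then show ?thesis
      unfolding partial_deriv2_cutoff u_def[symmetric] abs_mult by (simp add: mult.commute)
  next
    case False
    then show ?thesis using R
      by (simp only: partial_deriv2_cutoff u_def[symmetric] z) simp
  qed
qed

text \<open>The factor \<open>exp 1\<close> in \<open>cutoff\<close> is the normalisation:
  \<open>flat 0 1\<close> equals exp(-1), and \<open>flat 0\<close> is continuous at 1.\<close>

lemma cutoff_tendsto: "(\<lambda>n. cutoff (real (Suc n)) x) \<longlonglongrightarrow> 1"
proof -
  have "(\<lambda>n. 1 - (norm x)\<^sup>2 * (inverse (real (Suc n)))\<^sup>2) \<longlonglongrightarrow> 1 - (norm x)\<^sup>2 * 0\<^sup>2"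
    by (intro tendsto_intros LIMSEQ_inverse_real_of_nat)
  then have "(\<lambda>n. 1 - (norm x)\<^sup>2 / (real (Suc n))\<^sup>2) \<longlonglongrightarrow> 1"
    by (simp add: divide_inverse power_inverse)
  moreover have "isCont (flat 0) 1"
    using flat_has_real_derivative by (rule DERIV_isCont)
  ultimately have "(\<lambda>n. flat 0 (1 - (norm x)\<^sup>2 / (real (Suc n))\<^sup>2)) \<longlonglongrightarrow> flat 0 1"
    by (rule isCont_tendsto_compose[rotated])
  from tendsto_mult[OF tendsto_const this, of "exp 1"]
  show ?thesis
    by (simp add: cutoff_def flat_def flip: exp_add)
qed

section \<open>The Stein identity for functions with bounded second derivatives\<close>

lemma inner_grad: "x \<bullet> grad \<phi> x = (\<Sum>j\<in>UNIV. x $ j * partial_deriv j \<phi> x)"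
  by (simp add: inner_vec_def grad_def)

lemma inner_hessian: "T \<bullet> hessian \<phi> x = (\<Sum>i\<in>UNIV. \<Sum>j\<in>UNIV. T $ i $ j * partial_deriv i (partial_deriv j \<phi>) x)"
  by (simp add: inner_vec_def hessian_def)

text \<open>For the admissible test function \<open>x $ i * x $ i\<close>, the integrand x . grad of
  the Stein identity is twice that function, so its integrability clause is the moment
  bound.\<close>

lemma stein_kernel_second_moment:
  fixes \<nu> :: "(real^'n::finite) measure"
  assumes "stein_kernel \<nu> \<tau>"
  shows "integrable \<nu> (\<lambda>x. (norm x)\<^sup>2)"
proof -
  have "integrable \<nu> (\<lambda>x. x $ i * x $ i)" for i
  proof -
    have "(\<lambda>x::real^'n. x $ i * x $ i) \<in> stein_test_functions"
      unfolding stein_test_functions_def by (auto intro!: image_eqI[of _ _ "(i, i)"])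
    then have "integrable \<nu> (\<lambda>x. x \<bullet> grad (\<lambda>x. x $ i * x $ i) x)"
      using assms unfolding stein_kernel_def by blast
    moreover have "x \<bullet> grad (\<lambda>x::real^'n. x $ i * x $ i) x = 2 * (x $ i * x $ i)" for x
    proof -
      have "((\<lambda>x::real^'n. x $ i * x $ i) has_derivative (\<lambda>h. x $ i * h $ i + h $ i * x $ i)) (at x)"
        by (intro has_derivative_mult bounded_linear_imp_has_derivative bounded_linear_vec_nth)
      from partial_deriv_eq[OF this]
      have "x $ j * partial_deriv j (\<lambda>x::real^'n. x $ i * x $ i) x = (if j = i then 2 * (x $ i * x $ i) else 0)" for j
        by (simp add: axis_def)
      then show ?thesis
        unfolding inner_grad by simp
    qed
    ultimately show ?thesis by simp
  qed
  then show ?thesis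
    unfolding norm_sq_cart by simp
qed

lemma partial_deriv2_mult:
  assumes "elementary f" "elementary g"
  shows "partial_deriv i (partial_deriv j (\<lambda>x. f x * g x)) x =
    f x * partial_deriv i (partial_deriv j g) x + partial_deriv i f x * partial_deriv j g x
    + partial_deriv j f x * partial_deriv i g x + partial_deriv i (partial_deriv j f) x * g x"
  using assms
  by (simp add: partial_deriv_mult partial_deriv_add elementary_partial_deriv elementary.mult)

lemma mult_cutoff_in_stein_test_functions:
  assumes "elementary f" "R > 0"
  shows "(\<lambda>x. f x * cutoff R x) \<in> stein_test_functions"
proof -
  have "{x. f x * cutoff R x \<noteq> 0} \<subseteq> cball 0 R"
    using cutoff_bounds(4)[OF assms(2)] by (force simp: not_le intro: less_imp_le)
  then have "closure {x. f x * cutoff R x \<noteq> 0} \<subseteq> cball 0 R"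
    by (intro closure_minimal) auto
  then have "compact (closure {x. f x * cutoff R x \<noteq> 0})"
    using compact_closure bounded_subset[OF bounded_cball] closure_subset by (meson order_trans)
  then show ?thesis
    unfolding stein_test_functions_def
    using assms by (auto intro!: elementary_imp_smooth elementary.mult elementary_cutoff)
qed

text \<open>The function is multiplied by cutoffs of growing radius. A derivative of order k of the
  cutoff is of order R^(-k) and vanishes outside the ball of radius R, which compensates the growth
  of \<open>f\<close> and of its gradient. The Hessians of the products are therefore bounded
  uniformly in R, their gradients grow at most linearly, and both sides of the identity pass to the
  limit by dominated convergence.\<close>

lemma stein_kernel_elementary:
  fixes \<nu> :: "(real^'n::finite) measure"
  assumes "prob_space \<nu>" and [measurable_cong]: "sets \<nu> = sets borel" and st: "stein_kernel \<nu> \<tau>"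
    and f: "elementary f" and C: "\<And>x i j. \<bar>partial_deriv i (partial_deriv j f) x\<bar> \<le> C"
  shows "(\<integral>x. x \<bullet> grad f x \<partial>\<nu>) = (\<integral>x. \<tau> x \<bullet> hessian f x \<partial>\<nu>)"
proof -
  interpret prob_space \<nu> by fact
  obtain A where A: "A \<ge> 0" "\<And>x. \<bar>f x\<bar> \<le> A * (1 + (norm x)\<^sup>2)"
    "\<And>x j. \<bar>partial_deriv j f x\<bar> \<le> A * (1 + norm x)"
    using elementary_quadratic_growth[OF f C] by blast
  define K :: real where "K = 700 * exp 1"
  have K: "K > 0" by (simp add: K_def)
  have C0: "C \<ge> 0" using C[of undefined undefined undefined] by linarith
  define ct :: "nat \<Rightarrow> real^'n \<Rightarrow> real" where "ct n = cutoff (real (Suc n))" for n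
  define N where "N = real CARD('n)"
  note [measurable] = elementary_borel[OF f] elementary_borel[OF elementary_partial_deriv[OF f]]
    elementary_borel[OF elementary_partial_deriv[OF elementary_partial_deriv[OF f]]]
  have ct: "elementary (ct n)" for n
    unfolding ct_def by (rule elementary_cutoff)
  have [measurable]: "ct n \<in> borel_measurable borel" "partial_deriv i (ct n) \<in> borel_measurable borel"
    "partial_deriv i (partial_deriv j (ct n)) \<in> borel_measurable borel" for n i j
    by (intro elementary_borel elementary_partial_deriv ct)+
  have \<tau>_meas [measurable]: "\<tau> \<in> borel_measurable \<nu>" and \<tau>_int: "integrable \<nu> (\<lambda>x. \<tau> x $ i $ j)" for i j
    using st by (auto simp: stein_kernel_def)
  have [measurable]: "(\<lambda>x. \<tau> x $ i $ j) \<in> borel_measurable \<nu>" for i j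
    using \<tau>_int by (rule borel_measurable_integrable)
  have [measurable]: "(\<lambda>x. x $ j) \<in> borel_measurable \<nu>" for j
    by (rule measurable_compose[OF _ borel_measurable_continuous_onI[OF continuous_on_component]]) simp_all
  have m2: "integrable \<nu> (\<lambda>x. 1 + (norm x)\<^sup>2)"
    using stein_kernel_second_moment[OF st] by simp
  have b0: "\<bar>ct n x\<bar> \<le> K" for n x
    unfolding ct_def K_def by (rule cutoff_bounds) simp
  \<comment> \<open>Inside the ball 1 + \<open>norm x\<close> is at most twice the radius, which
    cancels the decay of the derivative; outside the derivative is 0.\<close>
  have b1: "\<bar>partial_deriv j (ct n) x\<bar> * (1 + norm x) \<le> 2 * K" for n x j
  proof (cases "norm x \<ge> real (Suc n)")
    case True
    then show ?thesis using cutoff_bounds(5)[OF _ True] K by (simp add: ct_def)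
  next
    case False
    have "\<bar>partial_deriv j (ct n) x\<bar> * (1 + norm x) \<le> K / real (Suc n) * (2 * real (Suc n))"
      unfolding ct_def K_def using False by (intro mult_mono cutoff_bounds) auto
    also have "\<dots> = 2 * K" by (simp add: divide_simps)
    finally show ?thesis .
  qed
  have b2: "\<bar>partial_deriv i (partial_deriv j (ct n)) x\<bar> * (1 + (norm x)\<^sup>2) \<le> 2 * K" for n x i j
  proof (cases "norm x \<ge> real (Suc n)")
    case True
    then show ?thesis using cutoff_bounds(6)[OF _ True] K by (simp add: ct_def)
  next
    case False
    have "(norm x)\<^sup>2 \<le> (real (Suc n))\<^sup>2" "1 \<le> (real (Suc n))\<^sup>2"
      using False by (auto intro!: power_mono one_le_power simp del: of_nat_Suc) 
    then have *: "1 + (norm x)\<^sup>2 \<le> 2 * (real (Suc n))\<^sup>2" by linarith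
    have "\<bar>partial_deriv i (partial_deriv j (ct n)) x\<bar> * (1 + (norm x)\<^sup>2) \<le> K / (real (Suc n))\<^sup>2 * (2 * (real (Suc n))\<^sup>2)"
      unfolding ct_def K_def by (intro mult_mono cutoff_bounds *) auto
    also have "\<dots> = 2 * K" by (simp add: divide_simps)
    finally show ?thesis .
  qed
  have l1: "(\<lambda>n. partial_deriv j (ct n) x) \<longlonglongrightarrow> 0" for j x
  proof (rule tendsto_rabs_zero_cancel, rule tendsto_sandwich[of "\<lambda>_. 0"])
    show "(\<lambda>n. K * inverse (real (Suc n))) \<longlonglongrightarrow> 0"
      using tendsto_mult[OF tendsto_const LIMSEQ_inverse_real_of_nat, of K] by simp
    show "\<forall>\<^sub>F n in sequentially. \<bar>partial_deriv j (ct n) x\<bar> \<le> K * inverse (real (Suc n))"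
      using cutoff_bounds(2)[of "real (Suc _)"] by (intro always_eventually allI) (simp add: ct_def K_def divide_inverse)
  qed auto
  have l2: "(\<lambda>n. partial_deriv i (partial_deriv j (ct n)) x) \<longlonglongrightarrow> 0" for i j x
  proof (rule tendsto_rabs_zero_cancel, rule tendsto_sandwich[of "\<lambda>_. 0"])
    show "(\<lambda>n. K * (inverse (real (Suc n)))\<^sup>2) \<longlonglongrightarrow> 0"
      using tendsto_mult[OF tendsto_const tendsto_power[OF LIMSEQ_inverse_real_of_nat], of K 2] by simp
    show "\<forall>\<^sub>F n in sequentially. \<bar>partial_deriv i (partial_deriv j (ct n)) x\<bar> \<le> K * (inverse (real (Suc n)))\<^sup>2"
      using cutoff_bounds(3)[of "real (Suc _)"] by (intro always_eventually allI) (simp add: ct_def K_def divide_inverse power_inverse)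
  qed auto
  define P where "P n = (\<lambda>x. f x * ct n x)" for n
  have P: "(\<integral>x. x \<bullet> grad (P n) x \<partial>\<nu>) = (\<integral>x. \<tau> x \<bullet> hessian (P n) x \<partial>\<nu>)" for n
    using st mult_cutoff_in_stein_test_functions[OF f, of "real (Suc n)"]
    unfolding stein_kernel_def P_def ct_def by simp
  have d1: "partial_deriv j (P n) x = f x * partial_deriv j (ct n) x + partial_deriv j f x * ct n x" for j n x
    unfolding P_def partial_deriv_mult[OF f ct] ..
  have d2: "partial_deriv i (partial_deriv j (P n)) x =
    f x * partial_deriv i (partial_deriv j (ct n)) x + partial_deriv i f x * partial_deriv j (ct n) x
    + partial_deriv j f x * partial_deriv i (ct n) x + partial_deriv i (partial_deriv j f) x * ct n x" for i j n x
    unfolding P_def partial_deriv2_mult[OF f ct] ..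
  have B1: "\<bar>partial_deriv j (P n) x\<bar> \<le> 3 * A * K * (1 + norm x)" for j n x
  proof -
    have "\<bar>f x * partial_deriv j (ct n) x\<bar> \<le> (A * (1 + (norm x)\<^sup>2)) * \<bar>partial_deriv j (ct n) x\<bar>"
      unfolding abs_mult by (intro mult_right_mono A) auto
    also have "\<dots> \<le> (A * ((1 + norm x) * (1 + norm x))) * \<bar>partial_deriv j (ct n) x\<bar>"
      using A(1) by (intro mult_right_mono mult_left_mono) (auto simp: power2_eq_square algebra_simps)
    also have "\<dots> = (A * (1 + norm x)) * (\<bar>partial_deriv j (ct n) x\<bar> * (1 + norm x))" by simp
    also have "\<dots> \<le> (A * (1 + norm x)) * (2 * K)"
      using A(1) b1 by (intro mult_left_mono) auto
    finally have 1: "\<bar>f x * partial_deriv j (ct n) x\<bar> \<le> 2 * (A * K * (1 + norm x))" by (simp add: mult_ac)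
    have "\<bar>partial_deriv j f x * ct n x\<bar> \<le> (A * (1 + norm x)) * K"
      unfolding abs_mult using A b0 K by (intro mult_mono) auto
    also have "\<dots> = A * K * (1 + norm x)" by simp
    finally have 2: "\<bar>partial_deriv j f x * ct n x\<bar> \<le> A * K * (1 + norm x)" .
    have "3 * A * K * (1 + norm x) = 3 * (A * K * (1 + norm x))" by simp
    with 1 2 show ?thesis unfolding d1 by linarith
  qed
  have B2: "\<bar>partial_deriv i (partial_deriv j (P n)) x\<bar> \<le> 6 * A * K + C * K" for i j n x
  proof -
    have "\<bar>f x * partial_deriv i (partial_deriv j (ct n)) x\<bar> \<le> (A * (1 + (norm x)\<^sup>2)) * \<bar>partial_deriv i (partial_deriv j (ct n)) x\<bar>"
      unfolding abs_mult by (intro mult_right_mono A) auto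
    also have "\<dots> = A * (\<bar>partial_deriv i (partial_deriv j (ct n)) x\<bar> * (1 + (norm x)\<^sup>2))" by simp
    also have "\<dots> \<le> A * (2 * K)" using A(1) b2 by (intro mult_left_mono) auto
    finally have 1: "\<bar>f x * partial_deriv i (partial_deriv j (ct n)) x\<bar> \<le> 2 * (A * K)" by simp
    have 2: "\<bar>partial_deriv i f x * partial_deriv j (ct n) x\<bar> \<le> 2 * (A * K)" for i j
    proof -
      have "\<bar>partial_deriv i f x * partial_deriv j (ct n) x\<bar> \<le> (A * (1 + norm x)) * \<bar>partial_deriv j (ct n) x\<bar>"
        unfolding abs_mult by (intro mult_right_mono A) auto
      also have "\<dots> = A * (\<bar>partial_deriv j (ct n) x\<bar> * (1 + norm x))" by simp
      also have "\<dots> \<le> A * (2 * K)" using A(1) b1 by (intro mult_left_mono) auto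
      finally show ?thesis by simp
    qed
    have 3: "\<bar>partial_deriv i (partial_deriv j f) x * ct n x\<bar> \<le> C * K"
      unfolding abs_mult using C b0 K C0 by (intro mult_mono) auto
    show ?thesis unfolding d2
      using 1 2[of i j] 2[of j i] 3 by linarith
  qed
  have lim1: "(\<lambda>n. partial_deriv j (P n) x) \<longlonglongrightarrow> partial_deriv j f x" for j x
  proof -
    have "(\<lambda>n. f x * partial_deriv j (ct n) x + partial_deriv j f x * ct n x) \<longlonglongrightarrow> f x * 0 + partial_deriv j f x * 1"
      by (intro tendsto_intros l1) (simp only: ct_def cutoff_tendsto)
    then show ?thesis unfolding d1 by simp
  qed
  have lim2: "(\<lambda>n. partial_deriv i (partial_deriv j (P n)) x) \<longlonglongrightarrow> partial_deriv i (partial_deriv j f) x" for i j x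
  proof -
    have "(\<lambda>n. f x * partial_deriv i (partial_deriv j (ct n)) x + partial_deriv i f x * partial_deriv j (ct n) x
    + partial_deriv j f x * partial_deriv i (ct n) x + partial_deriv i (partial_deriv j f) x * ct n x) \<longlonglongrightarrow>
      f x * 0 + partial_deriv i f x * 0 + partial_deriv j f x * 0 + partial_deriv i (partial_deriv j f) x * 1"
      by (intro tendsto_intros l1 l2) (simp only: ct_def cutoff_tendsto)
    then show ?thesis unfolding d2 by simp
  qed
  have [measurable]: "partial_deriv j (P n) \<in> borel_measurable \<nu>" "partial_deriv i (partial_deriv j (P n)) \<in> borel_measurable \<nu>" for i j n
    unfolding P_def
    by (subst measurable_cong_sets[OF \<open>sets \<nu> = sets borel\<close> refl], intro elementary_borel elementary_partial_deriv elementary.mult f ct)+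
  have "(\<lambda>n. \<integral>x. x \<bullet> grad (P n) x \<partial>\<nu>) \<longlonglongrightarrow> (\<integral>x. x \<bullet> grad f x \<partial>\<nu>)"
    unfolding inner_grad
  proof (rule integral_dominated_convergence[where w = "\<lambda>x. N * (6 * A * K * (1 + (norm x)\<^sup>2))"])
    show "AE x in \<nu>. (\<lambda>n. \<Sum>j\<in>UNIV. x $ j * partial_deriv j (P n) x) \<longlonglongrightarrow> (\<Sum>j\<in>UNIV. x $ j * partial_deriv j f x)"
      by (intro AE_I2 tendsto_sum tendsto_mult tendsto_const lim1)
    fix n
    have "norm (\<Sum>j\<in>UNIV. x $ j * partial_deriv j (P n) x) \<le> N * (6 * A * K * (1 + (norm x)\<^sup>2))" for x :: "real^'n"
    proof -
      have "norm (\<Sum>j\<in>UNIV. x $ j * partial_deriv j (P n) x) \<le> (\<Sum>j\<in>(UNIV::'n set). 6 * A * K * (1 + (norm x)\<^sup>2))"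
      proof (rule sum_norm_le)
        fix j
        have "norm (x $ j * partial_deriv j (P n) x) \<le> norm x * (3 * A * K * (1 + norm x))"
          unfolding norm_mult using B1[of j n x] component_le_norm_cart[of x j] by (intro mult_mono) auto
        also have "\<dots> = 3 * A * K * (norm x * (1 + norm x))" by simp
        also have "\<dots> \<le> 3 * A * K * (2 * (1 + (norm x)\<^sup>2))"
          using A(1) K mult_add_one_le[of "norm x"] by (intro mult_left_mono) (auto simp: mult.commute)
        also have "\<dots> = 6 * A * K * (1 + (norm x)\<^sup>2)" by simp
        finally show "norm (x $ j * partial_deriv j (P n) x) \<le> 6 * A * K * (1 + (norm x)\<^sup>2)" by simp
      qed
      then show ?thesis by (simp add: N_def)
    qed
    then show "AE x in \<nu>. norm (\<Sum>j\<in>UNIV. x $ j * partial_deriv j (P n) x) \<le> N * (6 * A * K * (1 + (norm x)\<^sup>2))"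
      by simp
  qed (use m2 in \<open>auto intro!: integrable_mult_right\<close>)
  \<comment> \<open>The entries of \<open>\<tau>\<close> are merely integrable here, so the
    domination rests on the uniform Hessian bound \<open>B2\<close>.\<close>
  moreover have "(\<lambda>n. \<integral>x. \<tau> x \<bullet> hessian (P n) x \<partial>\<nu>) \<longlonglongrightarrow> (\<integral>x. \<tau> x \<bullet> hessian f x \<partial>\<nu>)"
    unfolding inner_hessian
  proof (rule integral_dominated_convergence[where w = "\<lambda>x. \<Sum>i\<in>UNIV. \<Sum>j\<in>UNIV. \<bar>\<tau> x $ i $ j\<bar> * (6 * A * K + C * K)"])
    show "AE x in \<nu>. (\<lambda>n. \<Sum>i\<in>UNIV. \<Sum>j\<in>UNIV. \<tau> x $ i $ j * partial_deriv i (partial_deriv j (P n)) x)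
      \<longlonglongrightarrow> (\<Sum>i\<in>UNIV. \<Sum>j\<in>UNIV. \<tau> x $ i $ j * partial_deriv i (partial_deriv j f) x)"
      by (intro AE_I2 tendsto_sum tendsto_mult tendsto_const lim2)
    show "AE x in \<nu>. norm (\<Sum>i\<in>UNIV. \<Sum>j\<in>UNIV. \<tau> x $ i $ j * partial_deriv i (partial_deriv j (P n)) x)
      \<le> (\<Sum>i\<in>UNIV. \<Sum>j\<in>UNIV. \<bar>\<tau> x $ i $ j\<bar> * (6 * A * K + C * K))" for n
      using B2 by (intro AE_I2 sum_norm_le) (auto simp: abs_mult intro!: mult_left_mono)
  qed (auto intro!: integrable_mult_left integrable_sum integrable_abs \<tau>_int)
  ultimately show ?thesis
    using LIMSEQ_unique unfolding P by blast
qed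

section \<open>Gaussian integration by parts\<close>

text \<open>Two variances are used later: 1 for the normalisation of the standard Gaussian, and 2
  for the majorant in \<open>integrable_std_gaussian_exp\<close>.\<close>

lemma nn_integral_gaussian:
  assumes "\<sigma> > 0"
  shows "(\<integral>\<^sup>+x. ennreal (exp (- (norm (x::real^'n::finite))\<^sup>2 / (2 * \<sigma>\<^sup>2))) \<partial>lborel) = ennreal (sqrt (2 * pi * \<sigma>\<^sup>2) ^ CARD('n))"
proof -
  have 1: "(\<integral>\<^sup>+y. ennreal (exp (- y\<^sup>2 / (2 * \<sigma>\<^sup>2))) \<partial>lborel) = ennreal (sqrt (2 * pi * \<sigma>\<^sup>2))"
  proof -
    interpret N: prob_space "density lborel (normal_density 0 \<sigma>)"
      using assms by (rule prob_space_normal_density)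
    have "1 = (\<integral>\<^sup>+y. ennreal (normal_density 0 \<sigma> y) \<partial>lborel)"
      using N.emeasure_space_1 by (simp add: emeasure_density)
    then have "ennreal (sqrt (2 * pi * \<sigma>\<^sup>2)) = ennreal (sqrt (2 * pi * \<sigma>\<^sup>2)) * (\<integral>\<^sup>+y. ennreal (normal_density 0 \<sigma> y) \<partial>lborel)"
      by simp
    also have "\<dots> = (\<integral>\<^sup>+y. ennreal (sqrt (2 * pi * \<sigma>\<^sup>2)) * ennreal (normal_density 0 \<sigma> y) \<partial>lborel)"
      by (rule nn_integral_cmult[symmetric]) simp
    also have "\<dots> = (\<integral>\<^sup>+y. ennreal (exp (- y\<^sup>2 / (2 * \<sigma>\<^sup>2))) \<partial>lborel)"
      using assms by (intro nn_integral_cong) (simp add: normal_density_def flip: ennreal_mult')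
    finally show ?thesis ..
  qed
  have "(\<integral>\<^sup>+x. ennreal (exp (- (norm (x::real^'n))\<^sup>2 / (2 * \<sigma>\<^sup>2))) \<partial>lborel)
     = (\<integral>\<^sup>+x. (\<Prod>b\<in>Basis. ennreal (exp (- (x \<bullet> b)\<^sup>2 / (2 * \<sigma>\<^sup>2)))) \<partial>(lborel :: (real^'n) measure))"
  proof (rule nn_integral_cong)
    fix x :: "real^'n"
    have "(norm x)\<^sup>2 = (\<Sum>b\<in>Basis. (x \<bullet> b)\<^sup>2)"
      unfolding power2_norm_eq_inner by (subst euclidean_inner) (simp add: power2_eq_square)
    then show "ennreal (exp (- (norm x)\<^sup>2 / (2 * \<sigma>\<^sup>2))) = (\<Prod>b\<in>Basis. ennreal (exp (- (x \<bullet> b)\<^sup>2 / (2 * \<sigma>\<^sup>2))))"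
      by (simp add: prod_ennreal exp_sum[symmetric] sum_divide_distrib sum_negf)
  qed
  also have "\<dots> = (\<Prod>b\<in>(Basis :: (real^'n) set). \<integral>\<^sup>+y. ennreal (exp (- y\<^sup>2 / (2 * \<sigma>\<^sup>2))) \<partial>lborel)"
    by (rule nn_integral_lborel_prod) auto
  also have "\<dots> = (\<Prod>b\<in>(Basis :: (real^'n) set). ennreal (sqrt (2 * pi * \<sigma>\<^sup>2)))"
    by (simp only: 1)
  also have "\<dots> = ennreal (sqrt (2 * pi * \<sigma>\<^sup>2) ^ CARD('n))"
    by (simp add: ennreal_power)
  finally show ?thesis .
qed

section \<open>The standard Gaussian measure: integrability, translation, integration by
  parts\<close>

definition gaussian_density :: "real^'n::finite \<Rightarrow> real" where
  "gaussian_density x = (2 * pi) powr (- real CARD('n) / 2) * exp (- (norm x)\<^sup>2 / 2)"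

lemma std_gaussian_eq: "std_gaussian = density lborel (\<lambda>x. ennreal (gaussian_density x))"
  by (simp add: std_gaussian_def gaussian_density_def)

lemma gaussian_density_nonneg: "gaussian_density x \<ge> 0"
  by (simp add: gaussian_density_def)

lemma gaussian_density_borel [measurable]: "gaussian_density \<in> borel_measurable borel"
  unfolding gaussian_density_def[abs_def] by measurable

lemma sets_std_gaussian [simp, measurable_cong]: "sets std_gaussian = sets borel"
  by (simp add: std_gaussian_def)

lemma space_std_gaussian [simp]: "space std_gaussian = UNIV"
  by (simp add: std_gaussian_def)

lemma prob_space_std_gaussian: "prob_space (std_gaussian :: (real^'n::finite) measure)"
proof
  have "emeasure (std_gaussian :: (real^'n) measure) UNIV = (\<integral>\<^sup>+x. ennreal (gaussian_density (x::real^'n)) \<partial>lborel)"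
    unfolding std_gaussian_eq by (subst emeasure_density) auto
  also have "\<dots> = ennreal ((2 * pi) powr (- real CARD('n) / 2)) * (\<integral>\<^sup>+x. ennreal (exp (- (norm (x::real^'n))\<^sup>2 / (2 * 1\<^sup>2))) \<partial>lborel)"
    by (subst nn_integral_cmult[symmetric]) (auto simp: gaussian_density_def ennreal_mult)
  also have "\<dots> = ennreal ((2 * pi) powr (- real CARD('n) / 2) * sqrt (2 * pi) ^ CARD('n))"
    by (subst nn_integral_gaussian) (auto simp: ennreal_mult)
  also have "sqrt (2 * pi) ^ CARD('n) = (2 * pi) powr (real CARD('n) / 2)"
    by (simp add: powr_half_sqrt[symmetric] powr_powr flip: powr_realpow)
  also have "(2 * pi) powr (- real CARD('n) / 2) * (2 * pi) powr (real CARD('n) / 2) = 1"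
    by (simp flip: powr_add)
  finally show "emeasure (std_gaussian :: (real^'n) measure) (space std_gaussian) = 1" by simp
qed

text \<open>The rate 3 is dictated by the integration by parts below, where one factor
  exp(\<open>norm z\<close>) each is spent on the growth of the function, on the ratio of translated
  densities and on the derivative of that ratio.\<close>

lemma integrable_std_gaussian_exp:
  fixes f :: "real^'n::finite \<Rightarrow> real"
  assumes [measurable]: "f \<in> borel_measurable borel" and bd: "\<And>x. \<bar>f x\<bar> \<le> A * exp (3 * norm x)"
  shows "integrable std_gaussian f"
proof -
  have "\<bar>f 0\<bar> \<le> A" using bd[of 0] by simp
  then have A: "A \<ge> 0" by linarith
  define k where "k = (2 * pi) powr (- real CARD('n) / 2)"
  have "integrable lborel (\<lambda>x::real^'n. exp (- (norm x)\<^sup>2 / (2 * (sqrt 2)\<^sup>2)))"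
    by (rule integrableI_bounded) (measurable, simp only: real_norm_def abs_exp_cancel nn_integral_gaussian[of "sqrt 2"] real_sqrt_gt_0_iff zero_less_numeral infinity_ennreal_def ennreal_less_top)
  then have int: "integrable lborel (\<lambda>x::real^'n. k * A * exp 9 * exp (- (norm x)\<^sup>2 / 4))"
    by simp
  have "integrable lborel (\<lambda>x. gaussian_density x * f x)"
  proof (rule Bochner_Integration.integrable_bound[OF int])
    show "AE x in lborel. norm (gaussian_density x * f x) \<le> norm (k * A * exp 9 * exp (- (norm x)\<^sup>2 / 4))"
    proof (rule AE_I2)
      fix x :: "real^'n"
      have "norm (gaussian_density x * f x) = k * (exp (- (norm x)\<^sup>2 / 2) * \<bar>f x\<bar>)"
        by (simp add: gaussian_density_def k_def abs_mult)
      also have "\<dots> \<le> k * (exp (- (norm x)\<^sup>2 / 2) * (A * exp (3 * norm x)))"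
        by (intro mult_left_mono bd) (auto simp: k_def)
      also have "\<dots> = k * A * exp (3 * norm x - (norm x)\<^sup>2 / 2)"
        by (simp add: add.commute[of _ "3 * norm x"] flip: exp_add)
      also have "\<dots> \<le> k * A * exp (9 + - (norm x)\<^sup>2 / 4)"
      proof (intro mult_left_mono, subst exp_le_cancel_iff)
        \<comment> \<open>Completing the square: half of the Gaussian exponent absorbs the linear
          term at the cost of the constant 9.\<close>
        have "9 + - (norm x)\<^sup>2 / 4 - (3 * norm x - (norm x)\<^sup>2 / 2) = (norm x / 2 - 3)\<^sup>2"
          by (simp add: power2_eq_square field_simps)
        moreover have "(norm x / 2 - 3)\<^sup>2 \<ge> 0" by simp
        ultimately show "3 * norm x - (norm x)\<^sup>2 / 2 \<le> 9 + - (norm x)\<^sup>2 / 4" by linarith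
      qed (use A in \<open>simp add: k_def\<close>)
      also have "\<dots> = norm (k * A * exp 9 * exp (- (norm x)\<^sup>2 / 4))"
        unfolding exp_add using A by (simp add: k_def abs_mult)
      finally show "norm (gaussian_density x * f x) \<le> norm (k * A * exp 9 * exp (- (norm x)\<^sup>2 / 4))" .
    qed
  qed simp
  then show ?thesis
    unfolding std_gaussian_eq
    by (subst integrable_density) (auto simp: gaussian_density_nonneg)
qed

lemma integrable_std_gaussian_quadratic:
  fixes f :: "real^'n::finite \<Rightarrow> real"
  assumes [measurable]: "f \<in> borel_measurable borel" and bd: "\<And>x. \<bar>f x\<bar> \<le> A * (1 + (norm x)\<^sup>2)"
  shows "integrable std_gaussian f"
proof (rule integrable_std_gaussian_exp)
  have "\<bar>f 0\<bar> \<le> A" using bd[of 0] by simp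
  then have A: "A \<ge> 0" by linarith
  show "\<bar>f x\<bar> \<le> A * exp (3 * norm x)" for x
  proof -
    have "1 + (norm x)\<^sup>2 \<le> (1 + norm x)\<^sup>2"
      by (simp add: power2_eq_square algebra_simps)
    also have "\<dots> \<le> (exp (norm x))\<^sup>2"
      by (intro power_mono exp_ge_add_one_self) simp
    also have "\<dots> = exp (2 * norm x)" by (simp add: exp_double)
    also have "\<dots> \<le> exp (3 * norm x)" by simp
    finally have "A * (1 + (norm x)\<^sup>2) \<le> A * exp (3 * norm x)"
      using A by (rule mult_left_mono)
    with bd[of x] show ?thesis by linarith
  qed
qed fact

text \<open>The Cameron-Martin formula along a coordinate axis: Lebesgue measure is translation
  invariant, and the exponential is the ratio of the translated density to the original one.\<close>

lemma std_gaussian_shift: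
  fixes f :: "real^'n::finite \<Rightarrow> real"
  assumes [measurable]: "f \<in> borel_measurable borel"
  shows "(\<integral>z. f (z + t *\<^sub>R axis i 1) \<partial>std_gaussian) = (\<integral>z. f z * exp (t * z $ i - t\<^sup>2 / 2) \<partial>std_gaussian)"
proof -
  have sh: "gaussian_density (z - t *\<^sub>R axis i 1) = gaussian_density z * exp (t * z $ i - t\<^sup>2 / 2)" for z :: "real^'n"
  proof -
    have "(norm (z - t *\<^sub>R axis i 1))\<^sup>2 = (norm z)\<^sup>2 - 2 * (t * z $ i) + t\<^sup>2"
      by (simp add: power2_norm_eq_inner inner_diff_left inner_diff_right inner_axis inner_axis' power2_eq_square[of t] algebra_simps)
    then have "- (norm (z - t *\<^sub>R axis i 1))\<^sup>2 / 2 = - (norm z)\<^sup>2 / 2 + (t * z $ i - t\<^sup>2 / 2)"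
      by (simp add: field_simps)
    then show ?thesis
      unfolding gaussian_density_def by (simp only: exp_add mult.assoc)
  qed
  have "(\<integral>z. f (z + t *\<^sub>R axis i 1) \<partial>std_gaussian) = (\<integral>z. gaussian_density z * f (t *\<^sub>R axis i 1 + z) \<partial>lborel)"
    unfolding std_gaussian_eq by (subst integral_density) (auto simp: gaussian_density_nonneg add.commute)
  also have "\<dots> = (\<integral>z. gaussian_density (z - t *\<^sub>R axis i 1) * f z \<partial>distr lborel borel ((+) (t *\<^sub>R axis i 1)))"
    by (subst integral_distr) auto
  also have "\<dots> = (\<integral>z. gaussian_density z * (f z * exp (t * z $ i - t\<^sup>2 / 2)) \<partial>lborel)"
    unfolding lborel_distr_plus sh by (simp add: mult_ac)
  also have "\<dots> = (\<integral>z. f z * exp (t * z $ i - t\<^sup>2 / 2) \<partial>std_gaussian)"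
    unfolding std_gaussian_eq by (subst integral_density) (auto simp: gaussian_density_nonneg)
  finally show ?thesis .
qed

text \<open>Both sides of the Cameron-Martin formula are differentiated at t = 0 under the integral
  sign. The left side yields the partial derivative, the right side the factor \<open>z $ i\<close>;
  no boundary terms have to be discussed.\<close>

lemma std_gaussian_integration_by_parts:
  fixes f :: "real^'n::finite \<Rightarrow> real"
  assumes f: "elementary f" and C: "\<And>z i. \<bar>partial_deriv i f z\<bar> \<le> C"
  shows "(\<integral>z. z $ i * f z \<partial>std_gaussian) = (\<integral>z. partial_deriv i f z \<partial>std_gaussian)"
proof -
  interpret G: prob_space "std_gaussian :: (real^'n) measure"
    by (rule prob_space_std_gaussian)
  note [measurable] = elementary_borel[OF f] elementary_borel[OF elementary_partial_deriv[OF f]]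
  define A where "A = \<bar>f 0\<bar> + real CARD('n) * C"
  have C0: "C \<ge> 0" using C[of undefined undefined] by linarith
  then have A0: "A \<ge> 0" by (simp add: A_def)
  have growth: "\<bar>f z\<bar> \<le> A * exp (norm z)" for z
  proof -
    have "\<bar>f z - f 0\<bar> \<le> real CARD('n) * C * norm (z - 0)"
      by (rule elementary_lipschitz[where S = UNIV]) (auto intro: f C)
    then have "\<bar>f z\<bar> \<le> \<bar>f 0\<bar> * 1 + real CARD('n) * C * norm z" by simp
    also have "\<dots> \<le> \<bar>f 0\<bar> * exp (norm z) + real CARD('n) * C * exp (norm z)"
      using exp_ge_add_one_self[of "norm z"] C0 by (intro add_mono mult_left_mono) (auto intro: order_trans[OF _ exp_ge_add_one_self])
    finally show ?thesis by (simp add: A_def distrib_right)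
  qed
  have d1: "((\<lambda>t. f (z + t *\<^sub>R axis i 1)) has_real_derivative partial_deriv i f (z + t *\<^sub>R axis i 1)) (at t)" for z t
  proof -
    have "((\<lambda>t. z + t *\<^sub>R axis i (1::real)) has_derivative (\<lambda>h. h *\<^sub>R axis i 1)) (at t)"
      by (auto intro!: derivative_eq_intros)
    from has_derivative_compose[OF this elementary_has_derivative_partial[OF f]]
    have "((\<lambda>t. f (z + t *\<^sub>R axis i 1)) has_derivative (\<lambda>h. h * (\<Sum>k\<in>UNIV. axis i 1 $ k * partial_deriv k f (z + t *\<^sub>R axis i 1)))) (at t)"
      by (simp add: sum_distrib_left mult.assoc)
    then show ?thesis
      unfolding sum_axis_mult by (rule has_derivative_imp_has_field_derivative) simp
  qed
  have "((\<lambda>t. \<integral>z. f (z + t *\<^sub>R axis i 1) \<partial>std_gaussian) has_real_derivative (\<integral>z. partial_deriv i f (z + 0 *\<^sub>R axis i 1) \<partial>std_gaussian)) (at 0)"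
  proof (rule has_real_derivative_integral(2)[where r = 1 and B = "\<lambda>_. C"])
    fix t :: real assume t: "\<bar>t - 0\<bar> < 1"
    show "integrable std_gaussian (\<lambda>z. f (z + t *\<^sub>R axis i 1))"
    proof (rule integrable_std_gaussian_exp)
      fix z :: "real^'n"
      have "norm (z + t *\<^sub>R axis i 1) \<le> norm z + norm (t *\<^sub>R axis i (1::real) :: real^'n)"
        by (rule norm_triangle_ineq)
      also have "\<dots> \<le> 3 * norm z + 1" using t by (simp add: norm_axis_1) (smt (verit) norm_ge_zero)
      finally have "exp (norm (z + t *\<^sub>R axis i 1)) \<le> exp 1 * exp (3 * norm z)"
        by (simp add: add.commute flip: exp_add)
      then have "A * exp (norm (z + t *\<^sub>R axis i 1)) \<le> A * (exp 1 * exp (3 * norm z))"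
        using A0 by (rule mult_left_mono)
      with growth[of "z + t *\<^sub>R axis i 1"]
      show "\<bar>f (z + t *\<^sub>R axis i 1)\<bar> \<le> A * exp 1 * exp (3 * norm z)" by (simp add: mult.assoc)
    qed simp
  qed (auto intro: d1 C)
  moreover have "((\<lambda>t. \<integral>z. f z * exp (t * z $ i - t\<^sup>2 / 2) \<partial>std_gaussian) has_real_derivative
      (\<integral>z. f z * (exp (0 * z $ i - 0\<^sup>2 / 2) * (z $ i - 0)) \<partial>std_gaussian)) (at 0)"
  proof (rule has_real_derivative_integral(2)[where r = 1 and B = "\<lambda>z. A * exp (3 * norm z)"])
    have le: "\<bar>exp (t * z $ i - t\<^sup>2 / 2)\<bar> \<le> exp (norm z)" if "\<bar>t\<bar> < 1" for t and z :: "real^'n"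
    proof -
      have "t * z $ i \<le> \<bar>t\<bar> * \<bar>z $ i\<bar>" by (metis abs_ge_self abs_mult)
      also have "\<dots> \<le> 1 * norm z" using that by (intro mult_mono component_le_norm_cart) auto
      finally have "t * z $ i - t\<^sup>2 / 2 \<le> norm z" using zero_le_power2[of t] by linarith
      then show ?thesis by simp
    qed
    fix t :: real assume t: "\<bar>t - 0\<bar> < 1"
    show "integrable std_gaussian (\<lambda>z. f z * exp (t * z $ i - t\<^sup>2 / 2))"
    proof (rule integrable_std_gaussian_exp)
      fix z :: "real^'n"
      have "\<bar>f z * exp (t * z $ i - t\<^sup>2 / 2)\<bar> \<le> (A * exp (norm z)) * exp (norm z)"
        unfolding abs_mult using t A0 by (intro mult_mono growth le) auto
      also have "\<dots> = A * exp (2 * norm z)" by (simp add: exp_double power2_eq_square)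
      also have "\<dots> \<le> A * exp (3 * norm z)" using A0 by (intro mult_left_mono) auto
      finally show "\<bar>f z * exp (t * z $ i - t\<^sup>2 / 2)\<bar> \<le> A * exp (3 * norm z)" .
    qed measurable
    fix z :: "real^'n"
    show "((\<lambda>t. f z * exp (t * z $ i - t\<^sup>2 / 2)) has_real_derivative f z * (exp (t * z $ i - t\<^sup>2 / 2) * (z $ i - t))) (at t)"
      by (auto intro!: derivative_eq_intros)
    have "\<bar>z $ i - t\<bar> \<le> 1 + norm z"
      using component_le_norm_cart[of z i] t by linarith
    then have "\<bar>z $ i - t\<bar> \<le> exp (norm z)"
      using exp_ge_add_one_self[of "norm z"] by linarith
    then have "\<bar>f z * (exp (t * z $ i - t\<^sup>2 / 2) * (z $ i - t))\<bar> \<le> (A * exp (norm z)) * (exp (norm z) * exp (norm z))"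
      unfolding abs_mult using t A0 by (intro mult_mono growth le[unfolded abs_mult]) auto
    also have "\<dots> = A * exp (norm z + norm z + norm z)" unfolding exp_add by simp
    finally show "\<bar>f z * (exp (t * z $ i - t\<^sup>2 / 2) * (z $ i - t))\<bar> \<le> A * exp (3 * norm z)"
      by (simp add: mult.commute)
  next
    show "integrable std_gaussian (\<lambda>z::real^'n. A * exp (3 * norm z))"
      by (rule integrable_std_gaussian_exp) (auto simp: A0)
  qed simp
  ultimately show ?thesis
    unfolding std_gaussian_shift[OF elementary_borel[OF f]]
    using DERIV_unique by (force simp: mult.commute)
qed

lemma std_gaussian_covariance:
  "(\<integral>z. z $ i * z $ j \<partial>(std_gaussian :: (real^'n::finite) measure)) = (if i = j then 1 else 0)"
proof -
  have "((\<lambda>z::real^'n. z $ j) has_derivative (\<lambda>h. h $ j)) (at x)" for x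
    by (intro bounded_linear_imp_has_derivative bounded_linear_vec_nth)
  from partial_deriv_eq[OF this]
  have p: "partial_deriv k (\<lambda>z::real^'n. z $ j) = (\<lambda>_. if k = j then 1 else 0)" for k
    by (auto simp: axis_def)
  interpret G: prob_space "std_gaussian :: (real^'n) measure"
    by (rule prob_space_std_gaussian)
  show ?thesis
    using std_gaussian_integration_by_parts[OF elementary.coord, of j 1 i] G.prob_space
    unfolding p by (simp split: if_splits)
qed

section \<open>Soft minima of quadratic functions\<close>

text \<open>The free energy at temperature \<open>\<epsilon>\<close> of the energies
  \<open>u\<close>, also known as log-sum-exp; a smooth substitute for the minimum over
  \<open>B\<close>.\<close>

definition softmin :: "real \<Rightarrow> 'b set \<Rightarrow> ('b \<Rightarrow> real) \<Rightarrow> real" where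
  "softmin \<epsilon> B u = - \<epsilon> * ln (\<Sum>b\<in>B. exp (- u b / \<epsilon>))"

text \<open>The Gibbs weights, which are the partial derivatives of \<open>softmin\<close> in the
  entries of \<open>u\<close>. Absorbing the normalising sum into \<open>softmin\<close> makes each
  weight a single exponential, hence visibly positive and easy to differentiate.\<close>

definition softmin_weight :: "real \<Rightarrow> 'b set \<Rightarrow> ('b \<Rightarrow> real) \<Rightarrow> 'b \<Rightarrow> real" where
  "softmin_weight \<epsilon> B u b = exp ((softmin \<epsilon> B u - u b) / \<epsilon>)"

context
  fixes \<epsilon> :: real and B :: "'b set"
  assumes \<epsilon>: "\<epsilon> > 0" and B: "finite B" "B \<noteq> {}"
begin

lemma softmin_sum_pos: "(\<Sum>b\<in>B. exp (- u b / \<epsilon>)) > 0"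
  using B by (intro sum_pos) auto

lemma exp_softmin: "exp (softmin \<epsilon> B u / \<epsilon>) = inverse (\<Sum>b\<in>B. exp (- u b / \<epsilon>))"
  using \<epsilon> softmin_sum_pos[of u] by (simp add: softmin_def exp_minus)

lemma softmin_weight_eq: "softmin_weight \<epsilon> B u b = exp (- u b / \<epsilon>) / (\<Sum>b\<in>B. exp (- u b / \<epsilon>))"
proof -
  have "softmin_weight \<epsilon> B u b = exp (softmin \<epsilon> B u / \<epsilon>) * exp (- u b / \<epsilon>)"
    by (simp add: softmin_weight_def diff_divide_distrib flip: exp_add)
  then show ?thesis
    unfolding exp_softmin by (simp add: divide_inverse)
qed

lemma softmin_weight_pos: "softmin_weight \<epsilon> B u b > 0"
  by (simp add: softmin_weight_def)

lemma sum_softmin_weight: "(\<Sum>b\<in>B. softmin_weight \<epsilon> B u b) = 1"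
  using softmin_sum_pos[of u] by (simp add: softmin_weight_eq flip: sum_divide_distrib)

lemma softmin_weight_le_1: "b \<in> B \<Longrightarrow> softmin_weight \<epsilon> B u b \<le> 1"
  using member_le_sum[of b B "softmin_weight \<epsilon> B u"] B(1) softmin_weight_pos[of u]
  by (simp add: sum_softmin_weight less_imp_le)

lemma softmin_le: "b \<in> B \<Longrightarrow> softmin \<epsilon> B u \<le> u b"
  using softmin_weight_le_1[of b u] \<epsilon> by (simp add: softmin_weight_def divide_le_0_iff)

text \<open>Monotonicity and compatibility with constants in one inequality. It later gives both the
  Lipschitz bound and the normalisation of the dual variable.\<close>

lemma softmin_mono:
  assumes "\<And>b. b \<in> B \<Longrightarrow> u b \<le> v b + c"
  shows "softmin \<epsilon> B u \<le> softmin \<epsilon> B v + c"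
proof -
  have "(\<Sum>b\<in>B. exp (- v b / \<epsilon>)) \<le> (\<Sum>b\<in>B. exp (c / \<epsilon>) * exp (- u b / \<epsilon>))"
  proof (rule sum_mono)
    fix b assume "b \<in> B"
    then have "- v b / \<epsilon> \<le> c / \<epsilon> + - u b / \<epsilon>"
      using assms \<epsilon> by (simp add: field_simps)
    then show "exp (- v b / \<epsilon>) \<le> exp (c / \<epsilon>) * exp (- u b / \<epsilon>)"
      by (simp flip: exp_add)
  qed
  then have "ln (\<Sum>b\<in>B. exp (- v b / \<epsilon>)) \<le> ln (exp (c / \<epsilon>) * (\<Sum>b\<in>B. exp (- u b / \<epsilon>)))"
    using softmin_sum_pos[of v] softmin_sum_pos[of u] by (simp add: sum_distrib_left)
  also have "\<dots> = c / \<epsilon> + ln (\<Sum>b\<in>B. exp (- u b / \<epsilon>))"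
    using softmin_sum_pos[of u] by (simp add: ln_mult)
  finally have "\<epsilon> * ln (\<Sum>b\<in>B. exp (- v b / \<epsilon>)) \<le> \<epsilon> * (c / \<epsilon> + ln (\<Sum>b\<in>B. exp (- u b / \<epsilon>)))"
    using \<epsilon> by (intro mult_left_mono) auto
  then show ?thesis
    using \<epsilon> by (simp add: softmin_def distrib_left)
qed

text \<open>Every term of the entropy of the weights is at most 1, since
  \<open>ln (1 / w) \<le> 1 / w - 1\<close>.\<close>

lemma sum_softmin_weight_mult_le:
  "(\<Sum>b\<in>B. softmin_weight \<epsilon> B u b * u b) \<le> softmin \<epsilon> B u + \<epsilon> * card B"
proof -
  have "softmin_weight \<epsilon> B u b * u b \<le> softmin_weight \<epsilon> B u b * softmin \<epsilon> B u + \<epsilon>" for b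
  proof -
    define r where "r = (u b - softmin \<epsilon> B u) / \<epsilon>"
    have "exp (- r) * r \<le> exp (- r) * exp r"
      using exp_ge_add_one_self[of r] by (intro mult_left_mono) (linarith, simp)
    then have "\<epsilon> * (exp (- r) * r) \<le> \<epsilon> * 1"
      using \<epsilon> by (intro mult_left_mono) (auto simp flip: exp_add)
    moreover have "softmin_weight \<epsilon> B u b = exp (- r)"
      by (simp add: softmin_weight_def r_def minus_divide_left)
    moreover have "u b = softmin \<epsilon> B u + \<epsilon> * r"
      using \<epsilon> by (simp add: r_def)
    ultimately show ?thesis
      by (simp add: algebra_simps)
  qed
  then have "(\<Sum>b\<in>B. softmin_weight \<epsilon> B u b * u b) \<le> (\<Sum>b\<in>B. softmin_weight \<epsilon> B u b * softmin \<epsilon> B u + \<epsilon>)"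
    by (rule sum_mono)
  also have "\<dots> = softmin \<epsilon> B u + \<epsilon> * card B"
    by (simp add: sum.distrib sum_softmin_weight mult.commute[of \<epsilon>] flip: sum_distrib_right)
  finally show ?thesis .
qed

text \<open>The lower bound passes through the mean of \<open>u\<close> under the Gibbs weights,
  which exceeds the soft minimum by at most the entropy term.\<close>

lemma abs_softmin_le: "\<bar>softmin \<epsilon> B u\<bar> \<le> (\<Sum>b\<in>B. \<bar>u b\<bar>) + \<epsilon> * card B"
proof -
  obtain b where b: "b \<in> B" using B by blast
  have "softmin \<epsilon> B u \<le> \<bar>u b\<bar>" using softmin_le[OF b, of u] by linarith
  also have "\<dots> \<le> (\<Sum>b\<in>B. \<bar>u b\<bar>)" using b B by (intro member_le_sum) auto
  finally have 1: "softmin \<epsilon> B u \<le> (\<Sum>b\<in>B. \<bar>u b\<bar>)" .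
  have "- (\<Sum>b\<in>B. softmin_weight \<epsilon> B u b * u b) \<le> (\<Sum>b\<in>B. \<bar>u b\<bar>)"
    unfolding sum_negf[symmetric]
  proof (rule sum_mono)
    fix b assume "b \<in> B"
    then have "softmin_weight \<epsilon> B u b * \<bar>u b\<bar> \<le> 1 * \<bar>u b\<bar>"
      by (intro mult_right_mono softmin_weight_le_1) auto
    moreover have "\<bar>softmin_weight \<epsilon> B u b * u b\<bar> = softmin_weight \<epsilon> B u b * \<bar>u b\<bar>"
      using softmin_weight_pos[of u b] by (simp add: abs_mult)
    ultimately show "- (softmin_weight \<epsilon> B u b * u b) \<le> \<bar>u b\<bar>" by linarith
  qed
  with 1 sum_softmin_weight_mult_le[of u] show ?thesis
    using \<epsilon> by (simp add: abs_le_iff add_increasing2)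
qed

lemma softmin_has_derivative:
  fixes u :: "'a::real_normed_vector \<Rightarrow> 'b \<Rightarrow> real"
  assumes "\<And>b. b \<in> B \<Longrightarrow> ((\<lambda>x. u x b) has_derivative u' b) (at x)"
  shows "((\<lambda>x. softmin \<epsilon> B (u x)) has_derivative (\<lambda>h. \<Sum>b\<in>B. softmin_weight \<epsilon> B (u x) b * u' b h)) (at x)"
proof -
  define Z where "Z = (\<Sum>b\<in>B. exp (- u x b / \<epsilon>))"
  have Z: "Z > 0" unfolding Z_def by (rule softmin_sum_pos)
  have "((\<lambda>x. \<Sum>b\<in>B. exp (- u x b / \<epsilon>)) has_derivative (\<lambda>h. \<Sum>b\<in>B. exp (- u x b / \<epsilon>) * (- u' b h / \<epsilon>))) (at x)"
  proof (rule has_derivative_sum)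
    fix b assume "b \<in> B"
    from assms[OF this] show "((\<lambda>x. exp (- u x b / \<epsilon>)) has_derivative (\<lambda>h. exp (- u x b / \<epsilon>) * (- u' b h / \<epsilon>))) (at x)"
      using \<epsilon> by (auto intro!: derivative_eq_intros)
  qed
  then have "((\<lambda>x. - \<epsilon> * ln (\<Sum>b\<in>B. exp (- u x b / \<epsilon>))) has_derivative (\<lambda>h. - \<epsilon> * ((\<Sum>b\<in>B. exp (- u x b / \<epsilon>) * (- u' b h / \<epsilon>)) * inverse Z))) (at x)"
    using Z unfolding Z_def by (intro has_derivative_mult_right has_derivative_ln)
  moreover have "- \<epsilon> * ((\<Sum>b\<in>B. exp (- u x b / \<epsilon>) * (- u' b h / \<epsilon>)) * inverse Z) = (\<Sum>b\<in>B. softmin_weight \<epsilon> B (u x) b * u' b h)" for h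
    using \<epsilon> Z unfolding softmin_weight_eq Z_def[symmetric] sum_distrib_left sum_distrib_right
    by (intro sum.cong) (auto simp: field_simps)
  ultimately show ?thesis
    by (simp add: softmin_def)
qed

end

text \<open>An entropic version of the Hopf-Lax formula at time \<open>s\<close>, with initial datum
  -g carried by the finite set \<open>B\<close>.\<close>

definition potential :: "real \<Rightarrow> (real^'n::finite) set \<Rightarrow> (real^'n \<Rightarrow> real) \<Rightarrow> real \<Rightarrow> real^'n \<Rightarrow> real" where
  "potential \<epsilon> B g s y = softmin \<epsilon> B (\<lambda>b. (norm (y - b))\<^sup>2 / (2 * s) - g b)"

definition potential_weight :: "real \<Rightarrow> (real^'n::finite) set \<Rightarrow> (real^'n \<Rightarrow> real) \<Rightarrow> real \<Rightarrow> real^'n \<Rightarrow> real^'n \<Rightarrow> real" where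
  "potential_weight \<epsilon> B g s y = softmin_weight \<epsilon> B (\<lambda>b. (norm (y - b))\<^sup>2 / (2 * s) - g b)"

definition potential_grad :: "real \<Rightarrow> (real^'n::finite) set \<Rightarrow> (real^'n \<Rightarrow> real) \<Rightarrow> real \<Rightarrow> real^'n \<Rightarrow> real^'n" where
  "potential_grad \<epsilon> B g s y = (\<Sum>b\<in>B. potential_weight \<epsilon> B g s y b *\<^sub>R ((y - b) /\<^sub>R s))"

text \<open>The Gibbs mean of the squared velocity (y - b)/s. Minus one half of it is the exact time
  derivative of \<open>potential\<close>.\<close>

definition potential_energy :: "real \<Rightarrow> (real^'n::finite) set \<Rightarrow> (real^'n \<Rightarrow> real) \<Rightarrow> real \<Rightarrow> real^'n \<Rightarrow> real" where
  "potential_energy \<epsilon> B g s y = (\<Sum>b\<in>B. potential_weight \<epsilon> B g s y b * (norm ((y - b) /\<^sub>R s))\<^sup>2)"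

context
  fixes \<epsilon> :: real and B :: "(real^'n::finite) set" and g :: "real^'n \<Rightarrow> real"
  assumes \<epsilon>: "\<epsilon> > 0" and B: "finite B" "B \<noteq> {}"
begin

lemma sum_potential_weight: "(\<Sum>b\<in>B. potential_weight \<epsilon> B g s y b) = 1"
  unfolding potential_weight_def by (rule sum_softmin_weight[OF \<epsilon> B])

lemma potential_weight_pos: "potential_weight \<epsilon> B g s y b > 0"
  by (simp add: potential_weight_def softmin_weight_def)

text \<open>The difference of the two sides is the variance of the velocities (y - b)/s under the
  Gibbs weights. This is the Hamilton-Jacobi inequality for \<open>potential\<close>.\<close>

lemma potential_grad_energy: "(norm (potential_grad \<epsilon> B g s y))\<^sup>2 \<le> potential_energy \<epsilon> B g s y"
proof -
  define w v m where "w = potential_weight \<epsilon> B g s y" and "v b = (y - b) /\<^sub>R s"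
    and "m = potential_grad \<epsilon> B g s y" for b
  have w1: "(\<Sum>b\<in>B. w b) = 1" unfolding w_def by (rule sum_potential_weight)
  have m: "m = (\<Sum>b\<in>B. w b *\<^sub>R v b)" by (simp add: m_def w_def v_def potential_grad_def)
  have "0 \<le> (\<Sum>b\<in>B. w b * (norm (v b - m))\<^sup>2)"
    by (intro sum_nonneg mult_nonneg_nonneg) (auto simp: w_def potential_weight_pos less_imp_le)
  also have "\<dots> = (\<Sum>b\<in>B. w b * (norm (v b))\<^sup>2 - 2 * (w b * (v b \<bullet> m)) + w b * (norm m)\<^sup>2)"
    by (intro sum.cong refl) (simp add: power2_norm_eq_inner inner_diff_left inner_diff_right inner_commute algebra_simps)
  also have "\<dots> = (\<Sum>b\<in>B. w b * (norm (v b))\<^sup>2) - 2 * (\<Sum>b\<in>B. w b * (v b \<bullet> m)) + (\<Sum>b\<in>B. w b) * (norm m)\<^sup>2"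
    by (simp add: sum.distrib sum_subtractf sum_distrib_left sum_distrib_right)
  also have "(\<Sum>b\<in>B. w b * (v b \<bullet> m)) = (norm m)\<^sup>2"
    by (simp add: power2_norm_eq_inner) (subst (2) m, simp add: inner_sum_left)
  finally show ?thesis
    by (simp add: w1 m_def[symmetric] potential_energy_def w_def[symmetric] v_def[symmetric])
qed

text \<open>Time and position may both depend on a parameter in any normed space. A constant time
  gives the spatial gradient; a real parameter gives the derivative along the flow.\<close>

lemma potential_has_derivative:
  fixes \<sigma> :: "'a::real_normed_vector \<Rightarrow> real"
  assumes s: "(\<sigma> has_derivative \<sigma>') (at x)" and y: "(y has_derivative y') (at x)" and s0: "\<sigma> x \<noteq> 0"
  shows "((\<lambda>x. potential \<epsilon> B g (\<sigma> x) (y x)) has_derivative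
    (\<lambda>h. potential_grad \<epsilon> B g (\<sigma> x) (y x) \<bullet> y' h - \<sigma>' h * potential_energy \<epsilon> B g (\<sigma> x) (y x) / 2)) (at x)"
proof -
  let ?w = "potential_weight \<epsilon> B g (\<sigma> x) (y x)"
  have nrm: "(norm ((y x - b) /\<^sub>R \<sigma> x))\<^sup>2 = (norm (y x - b))\<^sup>2 / (\<sigma> x)\<^sup>2" for b
    unfolding norm_scaleR power_mult_distrib power2_abs by (simp add: power_inverse divide_inverse)
  have "((\<lambda>x. potential \<epsilon> B g (\<sigma> x) (y x)) has_derivative
    (\<lambda>h. \<Sum>b\<in>B. ?w b * (((y x - b) \<bullet> y' h) / \<sigma> x - \<sigma>' h * (norm (y x - b))\<^sup>2 / (2 * (\<sigma> x)\<^sup>2)))) (at x)"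
    unfolding potential_def potential_weight_def
  proof (rule softmin_has_derivative[OF \<epsilon> B])
    fix b
    have "((\<lambda>x. ((y x - b) \<bullet> (y x - b)) / (2 * \<sigma> x) - g b) has_derivative
      (\<lambda>h. ((y x - b) \<bullet> y' h) / \<sigma> x - \<sigma>' h * ((y x - b) \<bullet> (y x - b)) / (2 * (\<sigma> x)\<^sup>2))) (at x)"
      using s0 by (auto intro!: derivative_eq_intros s y simp: inner_commute field_simps power2_eq_square)
    then show "((\<lambda>x. (norm (y x - b))\<^sup>2 / (2 * \<sigma> x) - g b) has_derivative
      (\<lambda>h. ((y x - b) \<bullet> y' h) / \<sigma> x - \<sigma>' h * (norm (y x - b))\<^sup>2 / (2 * (\<sigma> x)\<^sup>2))) (at x)"
      by (simp add: power2_norm_eq_inner)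
  qed
  moreover have "(\<Sum>b\<in>B. ?w b * (((y x - b) \<bullet> y' h) / \<sigma> x - \<sigma>' h * (norm (y x - b))\<^sup>2 / (2 * (\<sigma> x)\<^sup>2)))
    = potential_grad \<epsilon> B g (\<sigma> x) (y x) \<bullet> y' h - \<sigma>' h * potential_energy \<epsilon> B g (\<sigma> x) (y x) / 2" for h
    unfolding potential_grad_def potential_energy_def inner_sum_left sum_distrib_left sum_divide_distrib sum_subtractf[symmetric] nrm
    unfolding inner_scaleR_left using s0
    by (intro sum.cong refl) (simp add: divide_simps, simp add: algebra_simps power2_eq_square)
  ultimately show ?thesis by (simp only:)
qed

lemma potential_has_derivative_space:
  assumes "s \<noteq> 0"
  shows "(potential \<epsilon> B g s has_derivative (\<lambda>h. potential_grad \<epsilon> B g s y \<bullet> h)) (at y)"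
  using potential_has_derivative[OF has_derivative_const has_derivative_ident, of s y] assms by simp

lemma partial_deriv_potential:
  "s \<noteq> 0 \<Longrightarrow> partial_deriv j (potential \<epsilon> B g s) = (\<lambda>y. potential_grad \<epsilon> B g s y $ j)"
  using partial_deriv_eq[OF potential_has_derivative_space] by (auto simp: inner_axis)

lemma elementary_potential:
  assumes "s > 0"
  shows "elementary (potential \<epsilon> B g s)"
proof -
  have "elementary (\<lambda>x. - \<epsilon> * ln (\<Sum>b\<in>B. exp ((- 1 / \<epsilon>) * (1 / (2 * s) * (\<Sum>i\<in>UNIV. (x $ i - b $ i) * (x $ i - b $ i)) - g b))))"
    by (intro elementary.intros elementary_sum elementary_diff B sum_pos) (auto intro: B)
  moreover have "(- 1 / \<epsilon>) * (1 / (2 * s) * (\<Sum>i\<in>UNIV. (x $ i - b $ i) * (x $ i - b $ i)) - g b)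
    = - ((norm (x - b))\<^sup>2 / (2 * s) - g b) / \<epsilon>" for x b
    unfolding norm_sq_cart using \<epsilon> by (simp add: field_simps)
  ultimately show ?thesis
    by (simp add: potential_def[abs_def] softmin_def)
qed

lemma potential_weight_has_derivative:
  assumes "s \<noteq> 0"
  shows "((\<lambda>y. potential_weight \<epsilon> B g s y b) has_derivative
    (\<lambda>h. potential_weight \<epsilon> B g s y b * ((potential_grad \<epsilon> B g s y - (y - b) /\<^sub>R s) \<bullet> h) / \<epsilon>)) (at y)"
proof -
  have "((\<lambda>y. c * ((y - b) \<bullet> (y - b)) - g b) has_derivative (\<lambda>h. 2 * c * ((y - b) \<bullet> h))) (at y)" for c
    by (auto intro!: derivative_eq_intros simp: inner_commute)
  from this[of "1 / (2 * s)"]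
  have 1: "((\<lambda>y. (norm (y - b))\<^sup>2 / (2 * s) - g b) has_derivative (\<lambda>h. ((y - b) /\<^sub>R s) \<bullet> h)) (at y)"
    by (simp add: power2_norm_eq_inner inverse_eq_divide)
  have 2: "((\<lambda>y. softmin \<epsilon> B (\<lambda>b. (norm (y - b))\<^sup>2 / (2 * s) - g b)) has_derivative (\<lambda>h. potential_grad \<epsilon> B g s y \<bullet> h)) (at y)"
    using potential_has_derivative_space[OF assms, of y] by (simp add: potential_def[abs_def])
  have "((\<lambda>y. (softmin \<epsilon> B (\<lambda>b. (norm (y - b))\<^sup>2 / (2 * s) - g b) - ((norm (y - b))\<^sup>2 / (2 * s) - g b)) * inverse \<epsilon>)
    has_derivative (\<lambda>h. ((potential_grad \<epsilon> B g s y - (y - b) /\<^sub>R s) \<bullet> h) * inverse \<epsilon>)) (at y)"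
    unfolding inner_diff_left by (intro has_derivative_mult_left has_derivative_diff 2) (use 1 in \<open>simp add: inner_diff_left\<close>)
  from has_derivative_exp[OF this] show ?thesis
    unfolding potential_weight_def softmin_weight_def divide_inverse by (simp only: mult_ac)
qed

text \<open>This isolates the unbounded part: what is subtracted from y is the Gibbs barycentre,
  which stays in any ball about the origin that contains \<open>B\<close>.\<close>

lemma potential_grad_affine:
  assumes "s \<noteq> 0"
  shows "potential_grad \<epsilon> B g s y = (y - (\<Sum>b\<in>B. potential_weight \<epsilon> B g s y b *\<^sub>R b)) /\<^sub>R s"
proof -
  have "potential_grad \<epsilon> B g s y = (\<Sum>b\<in>B. potential_weight \<epsilon> B g s y b *\<^sub>R (y - b)) /\<^sub>R s"
    by (simp add: potential_grad_def scaleR_sum_right mult.commute)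
  also have "(\<Sum>b\<in>B. potential_weight \<epsilon> B g s y b *\<^sub>R (y - b)) = (\<Sum>b\<in>B. potential_weight \<epsilon> B g s y b) *\<^sub>R y - (\<Sum>b\<in>B. potential_weight \<epsilon> B g s y b *\<^sub>R b)"
    by (simp add: scaleR_diff_right sum_subtractf scaleR_sum_left)
  finally show ?thesis by (simp add: sum_potential_weight)
qed

lemma norm_weighted_mean_le:
  assumes "\<And>b. b \<in> B \<Longrightarrow> norm b \<le> R"
  shows "norm (\<Sum>b\<in>B. potential_weight \<epsilon> B g s y b *\<^sub>R b) \<le> R"
proof -
  have "norm (\<Sum>b\<in>B. potential_weight \<epsilon> B g s y b *\<^sub>R b) \<le> (\<Sum>b\<in>B. potential_weight \<epsilon> B g s y b * R)"
    using assms potential_weight_pos by (intro sum_norm_le) (simp add: less_imp_le)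
  then show ?thesis by (simp add: sum_potential_weight flip: sum_distrib_right)
qed

text \<open>The Hessian is Id/s minus the Gibbs covariance of the points b divided by
  \<open>\<epsilon>\<close> s^2, and the covariance is bounded because \<open>B\<close> lies in a
  ball of radius \<open>R\<close>.\<close>

lemma partial_deriv2_potential_bound:
  assumes s: "s > 0" and R: "\<And>b. b \<in> B \<Longrightarrow> norm b \<le> R"
  shows "\<bar>partial_deriv i (partial_deriv j (potential \<epsilon> B g s)) y\<bar> \<le> 1 / s + 2 * R\<^sup>2 / (s\<^sup>2 * \<epsilon>)"
proof -
  obtain b0 where "b0 \<in> B" using B by blast
  from R[OF this] have R0: "R \<ge> 0" using norm_ge_zero order_trans by blast
  let ?w = "potential_weight \<epsilon> B g s y" and ?G = "potential_grad \<epsilon> B g s y"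
  have 1: "(\<lambda>y. potential_grad \<epsilon> B g s y $ j) = (\<lambda>y. (y $ j - (\<Sum>b\<in>B. potential_weight \<epsilon> B g s y b * b $ j)) / s)"
    using s by (simp add: potential_grad_affine divide_inverse mult.commute)
  have "((\<lambda>y. (y $ j - (\<Sum>b\<in>B. potential_weight \<epsilon> B g s y b * b $ j)) / s) has_derivative
     (\<lambda>h. (h $ j - (\<Sum>b\<in>B. ?w b * ((?G - (y - b) /\<^sub>R s) \<bullet> h) / \<epsilon> * b $ j)) / s)) (at y)"
    using s by (auto intro!: derivative_eq_intros has_derivative_sum potential_weight_has_derivative
        bounded_linear_imp_has_derivative[OF bounded_linear_vec_nth])
  from partial_deriv_eq[OF this, of i]
  have "partial_deriv i (partial_deriv j (potential \<epsilon> B g s)) y =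
    (axis i 1 $ j - (\<Sum>b\<in>B. ?w b * ((?G - (y - b) /\<^sub>R s) $ i) / \<epsilon> * b $ j)) / s"
    using s unfolding partial_deriv_potential[OF less_imp_neq[OF s, symmetric]] 1
    by (simp add: inner_axis)
  moreover have "\<bar>\<Sum>b\<in>B. ?w b * ((?G - (y - b) /\<^sub>R s) $ i) / \<epsilon> * b $ j\<bar> \<le> 2 * R\<^sup>2 / (s * \<epsilon>)"
  proof -
    have "norm (\<Sum>b\<in>B. ?w b * ((?G - (y - b) /\<^sub>R s) $ i) / \<epsilon> * b $ j) \<le> (\<Sum>b\<in>B. ?w b * (2 * R\<^sup>2 / (s * \<epsilon>)))"
    proof (rule sum_norm_le)
      fix b assume b: "b \<in> B"
      have "?G - (y - b) /\<^sub>R s = (b - (\<Sum>b\<in>B. ?w b *\<^sub>R b)) /\<^sub>R s"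
        using s by (simp add: potential_grad_affine flip: scaleR_diff_right)
      then have "norm (?G - (y - b) /\<^sub>R s) \<le> 2 * R / s"
        using norm_triangle_ineq4[of b "\<Sum>b\<in>B. ?w b *\<^sub>R b"] R[OF b] norm_weighted_mean_le[OF R, of s y] s
        by (simp add: divide_simps)
      then have "\<bar>(?G - (y - b) /\<^sub>R s) $ i\<bar> \<le> 2 * R / s"
        using component_le_norm_cart order_trans by blast
      moreover have "\<bar>b $ j\<bar> \<le> R" using component_le_norm_cart R[OF b] order_trans by blast
      ultimately have "\<bar>(?G - (y - b) /\<^sub>R s) $ i\<bar> * \<bar>b $ j\<bar> \<le> 2 * R / s * R"
        using R0 s by (intro mult_mono) auto
      then have "?w b * (\<bar>(?G - (y - b) /\<^sub>R s) $ i\<bar> * \<bar>b $ j\<bar> / \<epsilon>) \<le> ?w b * (2 * R / s * R / \<epsilon>)"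
        using \<epsilon> potential_weight_pos[of s y b] by (intro mult_left_mono divide_right_mono) auto
      then show "norm (?w b * ((?G - (y - b) /\<^sub>R s) $ i) / \<epsilon> * b $ j) \<le> ?w b * (2 * R\<^sup>2 / (s * \<epsilon>))"
        using \<epsilon> potential_weight_pos[of s y b] by (simp add: abs_mult power2_eq_square mult_ac)
    qed
    also have "\<dots> = 2 * R\<^sup>2 / (s * \<epsilon>)"
      by (simp only: sum_distrib_right[symmetric] sum_potential_weight mult_1)
    finally show ?thesis by simp
  qed
  moreover have "\<bar>axis i (1::real) $ j\<bar> \<le> 1" by (simp add: axis_def)
  ultimately have "\<bar>partial_deriv i (partial_deriv j (potential \<epsilon> B g s)) y\<bar> \<le> (1 + 2 * R\<^sup>2 / (s * \<epsilon>)) / s"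
    using s by (simp add: abs_divide) (intro divide_right_mono, linarith, simp)
  then show ?thesis
    by (simp add: add_divide_distrib power2_eq_square mult_ac)
qed

end

section \<open>Interpolation along the Ornstein-Uhlenbeck flow\<close>

lemma elementary_affine:
  assumes "elementary f"
  shows "elementary (\<lambda>x. f (a *\<^sub>R x + v))"
  using assms
proof induction
  case (coord i)
  have "elementary (\<lambda>x. a * x $ i + v $ i)"
    by (intro elementary.intros)
  then show ?case by simp
qed (auto intro: elementary.intros)

text \<open>The prefactor \<open>c\<close> lets the rule be applied to its own result, which gives
  the second derivatives.\<close>

lemma partial_deriv_affine:
  assumes "elementary f"
  shows "partial_deriv j (\<lambda>x. c * f (a *\<^sub>R x + v)) = (\<lambda>x. c * a * partial_deriv j f (a *\<^sub>R x + v))"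
proof
  fix x
  have "((\<lambda>x. a *\<^sub>R x + v) has_derivative (\<lambda>h. a *\<^sub>R h)) (at x)"
    by (auto intro!: derivative_eq_intros)
  from has_derivative_mult_right[OF has_derivative_compose[OF this elementary_has_derivative_partial[OF assms]], of c]
  have "((\<lambda>x. c * f (a *\<^sub>R x + v)) has_derivative (\<lambda>h. c * (\<Sum>i\<in>UNIV. (a *\<^sub>R h) $ i * partial_deriv i f (a *\<^sub>R x + v)))) (at x)" .
  from partial_deriv_eq[OF this, of j]
  have "partial_deriv j (\<lambda>x. c * f (a *\<^sub>R x + v)) x = c * (\<Sum>i\<in>UNIV. axis j 1 $ i * (a * partial_deriv i f (a *\<^sub>R x + v)))"
    by (simp add: mult_ac)
  then show "partial_deriv j (\<lambda>x. c * f (a *\<^sub>R x + v)) x = c * a * partial_deriv j f (a *\<^sub>R x + v)"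
    unfolding sum_axis_mult by simp
qed

text \<open>The substitution produces the factor a in the gradient and a^2 in the Hessian;
  cancelling one a leaves the chain-rule factor that becomes cos \<theta> below.\<close>

lemma stein_kernel_affine:
  fixes \<nu> :: "(real^'n::finite) measure"
  assumes "prob_space \<nu>" "sets \<nu> = sets borel" "stein_kernel \<nu> \<tau>"
    and f: "elementary f" and C: "\<And>x i j. \<bar>partial_deriv i (partial_deriv j f) x\<bar> \<le> C" and a: "a \<noteq> 0"
  shows "(\<integral>x. x \<bullet> grad f (a *\<^sub>R x + v) \<partial>\<nu>) = a * (\<integral>x. \<tau> x \<bullet> hessian f (a *\<^sub>R x + v) \<partial>\<nu>)"
proof -
  have d1: "partial_deriv j (\<lambda>x. f (a *\<^sub>R x + v)) = (\<lambda>x. a * partial_deriv j f (a *\<^sub>R x + v))" for j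
    using partial_deriv_affine[OF f, of j 1 a v] by simp
  have d2: "partial_deriv i (partial_deriv j (\<lambda>x. f (a *\<^sub>R x + v))) = (\<lambda>x. a * a * partial_deriv i (partial_deriv j f) (a *\<^sub>R x + v))" for i j
    unfolding d1 by (rule partial_deriv_affine[OF elementary_partial_deriv[OF f]])
  have "(\<integral>x. x \<bullet> grad (\<lambda>x. f (a *\<^sub>R x + v)) x \<partial>\<nu>) = (\<integral>x. \<tau> x \<bullet> hessian (\<lambda>x. f (a *\<^sub>R x + v)) x \<partial>\<nu>)"
  proof (rule stein_kernel_elementary[OF assms(1-3) elementary_affine[OF f]])
    show "\<bar>partial_deriv i (partial_deriv j (\<lambda>x. f (a *\<^sub>R x + v))) x\<bar> \<le> \<bar>a * a\<bar> * C" for x i j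
      unfolding d2 abs_mult[of "a * a"] by (intro mult_left_mono C) auto
  qed
  moreover have "grad (\<lambda>x. f (a *\<^sub>R x + v)) x = a *\<^sub>R grad f (a *\<^sub>R x + v)" for x
    by (simp add: grad_def d1 vec_eq_iff)
  moreover have "hessian (\<lambda>x. f (a *\<^sub>R x + v)) x = (a * a) *\<^sub>R hessian f (a *\<^sub>R x + v)" for x
    by (simp add: hessian_def d2 vec_eq_iff)
  ultimately show ?thesis
    using a by simp
qed

lemma std_gaussian_integration_by_parts_affine:
  assumes f: "elementary f" and C: "\<And>x i. \<bar>partial_deriv i f x\<bar> \<le> C"
  shows "(\<integral>z. z $ i * f (a *\<^sub>R z + v) \<partial>std_gaussian) = a * (\<integral>z. partial_deriv i f (a *\<^sub>R z + v) \<partial>std_gaussian)"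
proof -
  have d1: "partial_deriv j (\<lambda>x. f (a *\<^sub>R x + v)) = (\<lambda>x. a * partial_deriv j f (a *\<^sub>R x + v))" for j
    using partial_deriv_affine[OF f, of j 1 a v] by simp
  have "\<bar>partial_deriv j (\<lambda>x. f (a *\<^sub>R x + v)) z\<bar> \<le> \<bar>a\<bar> * C" for z j
    unfolding d1 abs_mult by (intro mult_left_mono C) auto
  from std_gaussian_integration_by_parts[OF elementary_affine[OF f] this, of i]
  show ?thesis unfolding d1 by simp
qed

lemma (in pair_prob_space) integrable_product:
  fixes f h :: "_ \<Rightarrow> real"
  assumes f: "integrable M1 f" and h: "integrable M2 h"
  shows "integrable (M1 \<Otimes>\<^sub>M M2) (\<lambda>(x, y). f x * h y)"
    and "(\<integral>(x, y). f x * h y \<partial>(M1 \<Otimes>\<^sub>M M2)) = (\<integral>x. f x \<partial>M1) * (\<integral>y. h y \<partial>M2)"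
proof -
  have [measurable]: "f \<in> borel_measurable M1" "h \<in> borel_measurable M2"
    using f h by auto
  show 1: "integrable (M1 \<Otimes>\<^sub>M M2) (\<lambda>(x, y). f x * h y)"
    by (rule Fubini_integrable) (use f h in \<open>auto simp: abs_mult intro!: integrable_mult_left\<close>)
  show "(\<integral>(x, y). f x * h y \<partial>(M1 \<Otimes>\<^sub>M M2)) = (\<integral>x. f x \<partial>M1) * (\<integral>y. h y \<partial>M2)"
    using integral_fst[OF 1] by simp
qed

lemma one_plus_square_le: "(1 + r)\<^sup>2 \<le> 2 * (1 + r\<^sup>2)" for r :: real
proof -
  have "2 * (1 + r\<^sup>2) - (1 + r)\<^sup>2 = (1 - r)\<^sup>2"
    by (simp add: power2_eq_square algebra_simps)
  then show ?thesis using zero_le_power2[of "1 - r"] by linarith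
qed

text \<open>Uniformity over all times \<open>s\<close> above \<open>\<delta>\<close> supplies
  majorants that do not depend on the position along the flow. The constants contain inverse powers
  of \<open>\<delta>\<close>, which is why the flow must not reach time 0.\<close>

lemma potential_bounds:
  fixes B :: "(real^'n::finite) set"
  assumes \<epsilon>: "\<epsilon> > 0" and B: "finite B" "B \<noteq> {}" and \<delta>: "\<delta> > 0"
  obtains K where "K \<ge> 0"
    "\<And>s y. s \<ge> \<delta> \<Longrightarrow> \<bar>potential \<epsilon> B g s y\<bar> \<le> K * (1 + (norm y)\<^sup>2)"
    "\<And>s y. s \<ge> \<delta> \<Longrightarrow> norm (potential_grad \<epsilon> B g s y) \<le> K * (1 + norm y)"
    "\<And>s y. s \<ge> \<delta> \<Longrightarrow> \<bar>potential_energy \<epsilon> B g s y\<bar> \<le> K * (1 + (norm y)\<^sup>2)"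
    "\<And>s y i j. s \<ge> \<delta> \<Longrightarrow> \<bar>partial_deriv i (partial_deriv j (potential \<epsilon> B g s)) y\<bar> \<le> K"
proof -
  define R where "R = (\<Sum>b\<in>B. norm b)"
  have R: "norm b \<le> R" if "b \<in> B" for b
    unfolding R_def using that B by (intro member_le_sum) auto
  have R0: "R \<ge> 0" by (simp add: R_def sum_nonneg)
  define K1 where "K1 = (\<Sum>b\<in>B. (1 + R)\<^sup>2 / \<delta> + \<bar>g b\<bar>) + \<epsilon> * card B"
  define K2 where "K2 = (1 + R) / \<delta>"
  define K3 where "K3 = 2 * K2\<^sup>2"
  define K4 where "K4 = 1 / \<delta> + 2 * R\<^sup>2 / (\<delta>\<^sup>2 * \<epsilon>)"
  have pos: "K1 \<ge> 0" "K2 \<ge> 0" "K3 \<ge> 0" "K4 \<ge> 0"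
    using \<delta> \<epsilon> R0 by (auto simp: K1_def K2_def K3_def K4_def intro!: add_nonneg_nonneg sum_nonneg)
  have d: "norm ((y - b) /\<^sub>R s) \<le> K2 * (1 + norm y)" if b: "b \<in> B" and s: "s \<ge> \<delta>" for b s and y :: "real^'n"
  proof -
    have "norm (y - b) \<le> norm y + R"
      using norm_triangle_ineq4[of y b] R[OF b] by linarith
    also have "\<dots> \<le> (1 + R) * (1 + norm y)"
      using R0 by (simp add: algebra_simps)
    finally have "norm (y - b) / s \<le> (1 + R) * (1 + norm y) / \<delta>"
      using \<delta> s R0 by (intro frac_le) auto
    then show ?thesis
      using \<delta> s by (simp add: K2_def divide_inverse mult_ac)
  qed
  have 1: "\<bar>potential \<epsilon> B g s y\<bar> \<le> K1 * (1 + (norm y)\<^sup>2)" if s: "s \<ge> \<delta>" for s y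
  proof -
    have "\<bar>potential \<epsilon> B g s y\<bar> \<le> (\<Sum>b\<in>B. \<bar>(norm (y - b))\<^sup>2 / (2 * s) - g b\<bar>) + \<epsilon> * card B"
      unfolding potential_def by (rule abs_softmin_le[OF \<epsilon> B])
    also have "\<dots> \<le> (\<Sum>b\<in>B. ((1 + R)\<^sup>2 / \<delta> + \<bar>g b\<bar>) * (1 + (norm y)\<^sup>2)) + \<epsilon> * card B * (1 + (norm y)\<^sup>2)"
    proof (intro add_mono sum_mono)
      fix b assume b: "b \<in> B"
      have "norm (y - b) \<le> norm y + R"
        using norm_triangle_ineq4[of y b] R[OF b] by linarith
      also have "\<dots> \<le> (1 + R) * (1 + norm y)"
        using R0 by (simp add: algebra_simps)
      finally have "(norm (y - b))\<^sup>2 \<le> ((1 + R) * (1 + norm y))\<^sup>2" by (rule power_mono) simp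
      also have "\<dots> \<le> (1 + R)\<^sup>2 * (2 * (1 + (norm y)\<^sup>2))"
        unfolding power_mult_distrib by (intro mult_left_mono one_plus_square_le) simp
      finally have "(norm (y - b))\<^sup>2 / (2 * s) \<le> (1 + R)\<^sup>2 * (2 * (1 + (norm y)\<^sup>2)) / (2 * \<delta>)"
        using \<delta> s by (intro frac_le) auto
      also have "\<dots> = (1 + R)\<^sup>2 / \<delta> * (1 + (norm y)\<^sup>2)"
        using \<delta> by (simp add: divide_simps)
      finally have 1: "(norm (y - b))\<^sup>2 / (2 * s) \<le> (1 + R)\<^sup>2 / \<delta> * (1 + (norm y)\<^sup>2)" .
      have 2: "\<bar>g b\<bar> \<le> \<bar>g b\<bar> * (1 + (norm y)\<^sup>2)" by (simp add: algebra_simps)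
      have 3: "(norm (y - b))\<^sup>2 / (2 * s) \<ge> 0" using \<delta> s by simp
      show "\<bar>(norm (y - b))\<^sup>2 / (2 * s) - g b\<bar> \<le> ((1 + R)\<^sup>2 / \<delta> + \<bar>g b\<bar>) * (1 + (norm y)\<^sup>2)"
        unfolding distrib_right using 1 2 3 by linarith
    next
      show "\<epsilon> * card B \<le> \<epsilon> * card B * (1 + (norm y)\<^sup>2)"
        using \<epsilon> by (simp add: distrib_left)
    qed
    also have "\<dots> = K1 * (1 + (norm y)\<^sup>2)"
      unfolding K1_def distrib_right[of _ _ "1 + (norm y)\<^sup>2"] sum_distrib_right ..
    finally show ?thesis .
  qed
  have 2: "norm (potential_grad \<epsilon> B g s y) \<le> K2 * (1 + norm y)" if s: "s \<ge> \<delta>" for s y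
  proof -
    have "norm (potential_grad \<epsilon> B g s y) \<le> (\<Sum>b\<in>B. potential_weight \<epsilon> B g s y b * (K2 * (1 + norm y)))"
      unfolding potential_grad_def
    proof (rule sum_norm_le)
      fix b assume "b \<in> B"
      then show "norm (potential_weight \<epsilon> B g s y b *\<^sub>R ((y - b) /\<^sub>R s)) \<le> potential_weight \<epsilon> B g s y b * (K2 * (1 + norm y))"
        using d[of b s y] s potential_weight_pos[OF \<epsilon> B, of g s y b] unfolding norm_scaleR[of "potential_weight \<epsilon> B g s y b"]
        by (simp add: mult_left_mono)
    qed
    then show ?thesis
      by (simp add: sum_potential_weight[OF \<epsilon> B] flip: sum_distrib_right)
  qed
  have 3: "\<bar>potential_energy \<epsilon> B g s y\<bar> \<le> K3 * (1 + (norm y)\<^sup>2)" if s: "s \<ge> \<delta>" for s y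
  proof -
    have "norm (potential_energy \<epsilon> B g s y) \<le> (\<Sum>b\<in>B. potential_weight \<epsilon> B g s y b * (K2 * (1 + norm y))\<^sup>2)"
      unfolding potential_energy_def
    proof (rule sum_norm_le)
      fix b assume "b \<in> B"
      then have "(norm ((y - b) /\<^sub>R s))\<^sup>2 \<le> (K2 * (1 + norm y))\<^sup>2"
        using d s by (intro power_mono) auto
      then show "norm (potential_weight \<epsilon> B g s y b * (norm ((y - b) /\<^sub>R s))\<^sup>2) \<le> potential_weight \<epsilon> B g s y b * (K2 * (1 + norm y))\<^sup>2"
        using potential_weight_pos[OF \<epsilon> B, of g s y b] unfolding norm_mult
        by (simp add: mult_left_mono del: norm_scaleR)
    qed
    also have "\<dots> = K2\<^sup>2 * (1 + norm y)\<^sup>2"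
      by (simp add: sum_potential_weight[OF \<epsilon> B] power_mult_distrib flip: sum_distrib_right)
    also have "\<dots> \<le> K2\<^sup>2 * (2 * (1 + (norm y)\<^sup>2))"
      by (intro mult_left_mono one_plus_square_le) simp
    also have "\<dots> = K3 * (1 + (norm y)\<^sup>2)"
      by (simp add: K3_def)
    finally show ?thesis by simp
  qed
  have 4: "\<bar>partial_deriv i (partial_deriv j (potential \<epsilon> B g s)) y\<bar> \<le> K4" if s: "s \<ge> \<delta>" for s y i j
  proof -
    have "\<bar>partial_deriv i (partial_deriv j (potential \<epsilon> B g s)) y\<bar> \<le> 1 / s + 2 * R\<^sup>2 / (s\<^sup>2 * \<epsilon>)"
      using s \<delta> by (intro partial_deriv2_potential_bound[OF \<epsilon> B] R) auto
    also have "\<dots> \<le> K4"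
      unfolding K4_def using s \<delta> \<epsilon> by (intro add_mono frac_le mult_right_mono power_mono mult_pos_pos) auto
    finally show ?thesis .
  qed
  define K where "K = K1 + K2 + K3 + K4"
  have le: "K1 \<le> K" "K2 \<le> K" "K3 \<le> K" "K4 \<le> K"
    using pos by (auto simp: K_def)
  show ?thesis
  proof (rule that[of K])
    show "K \<ge> 0" using pos by (simp add: K_def)
  next
    fix s :: real and y :: "real^'n" assume s: "s \<ge> \<delta>"
    have "K1 * (1 + (norm y)\<^sup>2) \<le> K * (1 + (norm y)\<^sup>2)" "K2 * (1 + norm y) \<le> K * (1 + norm y)"
      "K3 * (1 + (norm y)\<^sup>2) \<le> K * (1 + (norm y)\<^sup>2)"
      using le by (auto intro!: mult_right_mono)
    then show "\<bar>potential \<epsilon> B g s y\<bar> \<le> K * (1 + (norm y)\<^sup>2)"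
      "norm (potential_grad \<epsilon> B g s y) \<le> K * (1 + norm y)"
      "\<bar>potential_energy \<epsilon> B g s y\<bar> \<le> K * (1 + (norm y)\<^sup>2)"
      using 1[OF s, of y] 2[OF s, of y] 3[OF s, of y] by linarith+
    show "\<bar>partial_deriv i (partial_deriv j (potential \<epsilon> B g s)) y\<bar> \<le> K" for i j
      using 4[OF s, of i j y] le by linarith
  qed
qed

lemma AE_norm_leI: "(\<And>x. \<bar>f x\<bar> \<le> g x) \<Longrightarrow> AE x in M. norm (f x) \<le> norm (g x :: real)"
  by (auto intro!: AE_I2 order_trans[OF _ abs_ge_self])

text \<open>There is a monotone quantity behind the bound: the mean of the potential at time
  \<open>\<sigma> \<theta>\<close> along \<open>Y \<theta>\<close>, plus a multiple of sin \<theta>,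
  does not decrease on [0, pi/2]. The claim compares its values at the two ends.\<close>

lemma potential_interpolation:
  fixes \<nu> :: "(real^'n::finite) measure" and B :: "(real^'n) set"
  assumes \<nu>: "prob_space \<nu>" and sets_\<nu> [measurable_cong]: "sets \<nu> = sets borel" and st: "stein_kernel \<nu> \<tau>"
    and S2: "integrable \<nu> (\<lambda>x. (norm (\<tau> x - mat 1))\<^sup>2)"
    and \<epsilon>: "\<epsilon> > 0" and B: "finite B" "B \<noteq> {}" and \<delta>: "0 < \<delta>" "\<delta> < 1"
  shows "(\<integral>x. potential \<epsilon> B g 1 x \<partial>\<nu>) - (\<integral>x. potential \<epsilon> B g \<delta> x \<partial>std_gaussian)
    \<le> (\<integral>x. (norm (\<tau> x - mat 1))\<^sup>2 \<partial>\<nu>) / (2 * (1 - \<delta>))"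
proof -
  obtain K where K: "K \<ge> 0"
    "\<And>s y. s \<ge> \<delta> \<Longrightarrow> \<bar>potential \<epsilon> B g s y\<bar> \<le> K * (1 + (norm y)\<^sup>2)"
    "\<And>s y. s \<ge> \<delta> \<Longrightarrow> norm (potential_grad \<epsilon> B g s y) \<le> K * (1 + norm y)"
    "\<And>s y. s \<ge> \<delta> \<Longrightarrow> \<bar>potential_energy \<epsilon> B g s y\<bar> \<le> K * (1 + (norm y)\<^sup>2)"
    "\<And>s y i j. s \<ge> \<delta> \<Longrightarrow> \<bar>partial_deriv i (partial_deriv j (potential \<epsilon> B g s)) y\<bar> \<le> K"
    using potential_bounds[OF \<epsilon> B \<delta>(1), where g = g] by metis
  interpret \<nu>: prob_space \<nu> by fact
  interpret \<gamma>: prob_space "std_gaussian :: (real^'n) measure"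
    by (rule prob_space_std_gaussian)
  interpret P: pair_prob_space \<nu> "std_gaussian :: (real^'n) measure" ..
  let ?P = "\<nu> \<Otimes>\<^sub>M (std_gaussian :: (real^'n) measure)"
  have \<tau>_int: "integrable \<nu> (\<lambda>x. \<tau> x $ i $ j)" for i j
    using st by (auto simp: stein_kernel_def)
  have \<tau>_meas [measurable]: "(\<lambda>x. \<tau> x $ i $ j) \<in> borel_measurable \<nu>" for i j
    using \<tau>_int by (rule borel_measurable_integrable)
  have comp_meas [measurable]: "(\<lambda>x::real^'n. x $ j) \<in> borel_measurable borel" for j
    by (intro borel_measurable_continuous_onI continuous_on_component continuous_on_id)
  have m2\<nu>: "integrable \<nu> (\<lambda>x. (norm x)\<^sup>2)" by (rule stein_kernel_second_moment[OF st])
  have m2\<gamma>: "integrable std_gaussian (\<lambda>z::real^'n. (norm z)\<^sup>2)"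
    by (rule integrable_std_gaussian_quadratic[where A = 1]) auto
  \<comment> \<open>A single integrable majorant: the potential, its energy and the products of its
    gradient with x and z are all bounded by multiples of \<open>W\<close>, uniformly in
    \<theta>.\<close>
  define W :: "(real^'n) \<times> (real^'n) \<Rightarrow> real" where "W = (\<lambda>(x, z). 1 + (norm x)\<^sup>2 + (norm z)\<^sup>2)"
  have W: "integrable ?P W"
  proof -
    have "integrable ?P (\<lambda>\<omega>. (1 + (\<lambda>(x, z). (norm x)\<^sup>2 * 1) \<omega>) + (\<lambda>(x, z). 1 * (norm z)\<^sup>2) \<omega>)"
      by (intro Bochner_Integration.integrable_add P.integrable_product m2\<nu> m2\<gamma>) auto
    then show ?thesis by (simp add: W_def case_prod_unfold)
  qed
  define Y where "Y = (\<lambda>\<theta> (x :: real^'n, z :: real^'n). cos \<theta> *\<^sub>R x + sin \<theta> *\<^sub>R z)"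
  \<comment> \<open>The derivative -(1 - \<delta>) cos \<theta> carries the same factor cos \<theta>
    that the two integrations by parts extract from the spatial terms.\<close>
  define \<sigma> where "\<sigma> \<theta> = 1 - (1 - \<delta>) * sin \<theta>" for \<theta>
  define \<phi> where "\<phi> s = potential \<epsilon> B g s" for s
  define G where "G s = potential_grad \<epsilon> B g s" for s
  define Q where "Q s = potential_energy \<epsilon> B g s" for s
  define H where "H s i j = partial_deriv i (partial_deriv j (\<phi> s))" for s i j
  have \<sigma>_ge: "\<sigma> \<theta> \<ge> \<delta>" for \<theta>
  proof -
    have "(1 - \<delta>) * sin \<theta> \<le> (1 - \<delta>) * 1"
      using \<delta> by (intro mult_left_mono) auto
    then show ?thesis by (simp add: \<sigma>_def algebra_simps)
  qed
  have el: "elementary (\<phi> s)" if "s \<ge> \<delta>" for s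
    unfolding \<phi>_def using that \<delta> by (intro elementary_potential[OF \<epsilon> B]) auto
  have pd: "partial_deriv j (\<phi> s) = (\<lambda>y. G s y $ j)" if "s \<ge> \<delta>" for s j
    unfolding \<phi>_def G_def using that \<delta> by (intro partial_deriv_potential[OF \<epsilon> B]) auto
  have grad_eq: "grad (\<phi> s) y = G s y" if "s \<ge> \<delta>" for s y
    by (simp add: grad_def pd[OF that] vec_eq_iff)
  have hess_eq: "T \<bullet> hessian (\<phi> s) y = (\<Sum>i\<in>UNIV. \<Sum>j\<in>UNIV. T $ i $ j * H s i j y)" for T s y
    by (simp add: inner_hessian H_def)
  have [measurable]: "\<phi> (\<sigma> \<theta>) \<in> borel_measurable borel" "(\<lambda>y. G (\<sigma> \<theta>) y $ j) \<in> borel_measurable borel"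
    "H (\<sigma> \<theta>) i j \<in> borel_measurable borel" for \<theta> i j
    unfolding H_def pd[OF \<sigma>_ge, symmetric]
    by (intro elementary_borel elementary_partial_deriv el \<sigma>_ge)+
  have G_norm_meas [measurable]: "(\<lambda>y. (norm (G (\<sigma> \<theta>) y))\<^sup>2) \<in> borel_measurable borel" for \<theta>
    unfolding norm_sq_cart by measurable
  have Q_meas [measurable]: "Q s \<in> borel_measurable borel" for s
    unfolding Q_def potential_energy_def[abs_def] potential_weight_def softmin_weight_def softmin_def by measurable
  have Y_meas [measurable]: "Y \<theta> \<in> measurable ?P borel" for \<theta>
    unfolding Y_def case_prod_unfold by measurable
  have Y_W: "1 + (norm (Y \<theta> \<omega>))\<^sup>2 \<le> 2 * W \<omega>" "norm (fst \<omega>) + norm (snd \<omega>) \<le> 2 * W \<omega>"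
    "norm (Y \<theta> \<omega>) \<le> norm (fst \<omega>) + norm (snd \<omega>)" "1 \<le> W \<omega>"
    "1 + (norm (fst \<omega>) + norm (snd \<omega>))\<^sup>2 \<le> 2 * W \<omega>" for \<theta> \<omega>
  proof -
    obtain x z where \<omega>: "\<omega> = (x, z)" by force
    have "norm (Y \<theta> \<omega>) \<le> \<bar>cos \<theta>\<bar> * norm x + \<bar>sin \<theta>\<bar> * norm z"
      unfolding \<omega> Y_def using norm_triangle_ineq[of "cos \<theta> *\<^sub>R x" "sin \<theta> *\<^sub>R z"] by simp
    also have "\<dots> \<le> 1 * norm x + 1 * norm z"
      by (intro add_mono mult_right_mono) auto
    finally show 1: "norm (Y \<theta> \<omega>) \<le> norm (fst \<omega>) + norm (snd \<omega>)" by (simp add: \<omega>)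
    have "2 * W \<omega> - (1 + (norm x + norm z)\<^sup>2) = (norm x - norm z)\<^sup>2 + 1"
      by (simp add: \<omega> W_def power2_eq_square algebra_simps)
    then have "1 + (norm x + norm z)\<^sup>2 \<le> 2 * W \<omega>"
      using zero_le_power2[of "norm x - norm z"] by linarith
    then show 2: "1 + (norm (fst \<omega>) + norm (snd \<omega>))\<^sup>2 \<le> 2 * W \<omega>"
      by (simp only: \<omega> fst_conv snd_conv)
    show "1 + (norm (Y \<theta> \<omega>))\<^sup>2 \<le> 2 * W \<omega>"
      using power_mono[OF 1 norm_ge_zero, of 2] 2 by linarith
    have "1 + (norm x + norm z)\<^sup>2 - (norm x + norm z) = (norm x + norm z - 1 / 2)\<^sup>2 + 3 / 4"
      by (simp add: power2_eq_square algebra_simps)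
    then have "norm x + norm z \<le> 1 + (norm x + norm z)\<^sup>2"
      using zero_le_power2[of "norm x + norm z - 1 / 2"] by linarith
    with 2 show "norm (fst \<omega>) + norm (snd \<omega>) \<le> 2 * W \<omega>"
      unfolding \<omega> fst_conv snd_conv by linarith
    show "1 \<le> W \<omega>" by (simp add: \<omega> W_def)
  qed
  have G_bd: "norm (G (\<sigma> \<theta>) (Y \<theta> \<omega>)) * (norm (fst \<omega>) + norm (snd \<omega>)) \<le> 4 * K * W \<omega>"
    and G2_bd: "(norm (G (\<sigma> \<theta>) (Y \<theta> \<omega>)))\<^sup>2 \<le> 4 * K\<^sup>2 * W \<omega>" for \<theta> \<omega>
  proof -
    define r where "r = norm (fst \<omega>) + norm (snd \<omega>)"
    have r0: "r \<ge> 0" by (simp add: r_def)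
    have "norm (G (\<sigma> \<theta>) (Y \<theta> \<omega>)) \<le> K * (1 + norm (Y \<theta> \<omega>))"
      unfolding G_def by (intro K \<sigma>_ge)
    also have "\<dots> \<le> K * (1 + r)"
      unfolding r_def using K(1) Y_W(3) by (intro mult_left_mono add_left_mono) auto
    finally have 1: "norm (G (\<sigma> \<theta>) (Y \<theta> \<omega>)) \<le> K * (1 + r)" .
    have "norm (G (\<sigma> \<theta>) (Y \<theta> \<omega>)) * r \<le> K * (1 + r) * r"
      using 1 r0 by (rule mult_right_mono)
    also have "\<dots> = K * ((1 + r) * r)" by simp
    also have "\<dots> \<le> K * (2 * (2 * W \<omega>))"
      using K(1) mult_add_one_le[of r] Y_W(5)[of \<omega>] by (intro mult_left_mono) (auto simp: r_def)
    finally show "norm (G (\<sigma> \<theta>) (Y \<theta> \<omega>)) * (norm (fst \<omega>) + norm (snd \<omega>)) \<le> 4 * K * W \<omega>"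
      by (simp add: r_def)
    have "(norm (G (\<sigma> \<theta>) (Y \<theta> \<omega>)))\<^sup>2 \<le> (K * (1 + r))\<^sup>2"
      using 1 by (rule power_mono) simp
    also have "\<dots> = K\<^sup>2 * (1 + r)\<^sup>2" by (simp add: power_mult_distrib)
    also have "\<dots> \<le> K\<^sup>2 * (2 * (2 * W \<omega>))"
    proof (rule mult_left_mono)
      show "(1 + r)\<^sup>2 \<le> 2 * (2 * W \<omega>)"
        by (rule order_trans[OF one_plus_square_le mult_left_mono]) (use Y_W(5)[of \<omega>] in \<open>simp_all add: r_def\<close>)
    qed simp
    finally show "(norm (G (\<sigma> \<theta>) (Y \<theta> \<omega>)))\<^sup>2 \<le> 4 * K\<^sup>2 * W \<omega>" by (simp add: mult_ac)
  qed
  have Q_bd: "\<bar>Q (\<sigma> \<theta>) (Y \<theta> \<omega>)\<bar> \<le> 2 * K * W \<omega>" for \<theta> \<omega>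
  proof -
    have "\<bar>Q (\<sigma> \<theta>) (Y \<theta> \<omega>)\<bar> \<le> K * (1 + (norm (Y \<theta> \<omega>))\<^sup>2)"
      unfolding Q_def by (intro K \<sigma>_ge)
    also have "\<dots> \<le> K * (2 * W \<omega>)" using K(1) Y_W(1) by (rule mult_left_mono[rotated])
    finally show ?thesis by simp
  qed
  define D where "D = (\<lambda>\<theta> (x, z). G (\<sigma> \<theta>) (Y \<theta> (x, z)) \<bullet> (- sin \<theta> *\<^sub>R x + cos \<theta> *\<^sub>R z) + (1 - \<delta>) * cos \<theta> * Q (\<sigma> \<theta>) (Y \<theta> (x, z)) / 2)"
  have \<Lambda>: "((\<lambda>\<theta>. \<integral>\<omega>. \<phi> (\<sigma> \<theta>) (Y \<theta> \<omega>) \<partial>?P) has_real_derivative (\<integral>\<omega>. D \<theta> \<omega> \<partial>?P)) (at \<theta>)" for \<theta>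
  proof (rule has_real_derivative_integral(2)[where r = 1 and B = "\<lambda>\<omega>. 5 * K * W \<omega>"])
    fix t
    show "integrable ?P (\<lambda>\<omega>. \<phi> (\<sigma> t) (Y t \<omega>))"
    proof (rule Bochner_Integration.integrable_bound[OF integrable_mult_right[OF W, of "2 * K"]])
      have "\<bar>\<phi> (\<sigma> t) (Y t \<omega>)\<bar> \<le> 2 * K * W \<omega>" for \<omega>
      proof -
        have "\<bar>\<phi> (\<sigma> t) (Y t \<omega>)\<bar> \<le> K * (1 + (norm (Y t \<omega>))\<^sup>2)"
          unfolding \<phi>_def by (intro K \<sigma>_ge)
        also have "\<dots> \<le> K * (2 * W \<omega>)" using K(1) Y_W(1) by (rule mult_left_mono[rotated])
        finally show ?thesis by simp
      qed
      then show "AE \<omega> in ?P. norm (\<phi> (\<sigma> t) (Y t \<omega>)) \<le> norm (2 * K * W \<omega>)"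
        by (rule AE_norm_leI)
    qed measurable
    fix \<omega> :: "(real^'n) \<times> (real^'n)"
    obtain x z where \<omega>: "\<omega> = (x, z)" by force
    have "((\<lambda>t. potential \<epsilon> B g (\<sigma> t) (cos t *\<^sub>R x + sin t *\<^sub>R z)) has_derivative
      (\<lambda>h. potential_grad \<epsilon> B g (\<sigma> t) (cos t *\<^sub>R x + sin t *\<^sub>R z) \<bullet> ((- sin t * h) *\<^sub>R x + (cos t * h) *\<^sub>R z)
        - (- ((1 - \<delta>) * (cos t * h))) * potential_energy \<epsilon> B g (\<sigma> t) (cos t *\<^sub>R x + sin t *\<^sub>R z) / 2)) (at t)"
    proof (rule potential_has_derivative[OF \<epsilon> B])
      show "(\<sigma> has_derivative (\<lambda>h. - ((1 - \<delta>) * (cos t * h)))) (at t)"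
        unfolding \<sigma>_def[abs_def] by (auto intro!: derivative_eq_intros)
      show "((\<lambda>t. cos t *\<^sub>R x + sin t *\<^sub>R z) has_derivative (\<lambda>h. (- sin t * h) *\<^sub>R x + (cos t * h) *\<^sub>R z)) (at t)"
        by (auto intro!: derivative_eq_intros simp: mult.commute)
      show "\<sigma> t \<noteq> 0" using \<sigma>_ge[of t] \<delta> by linarith
    qed
    then show "((\<lambda>t. \<phi> (\<sigma> t) (Y t \<omega>)) has_real_derivative D t \<omega>) (at t)"
      unfolding \<omega> Y_def \<phi>_def D_def G_def Q_def prod.case
      by (rule has_derivative_imp_has_field_derivative) (simp add: inner_add_right inner_diff_right field_simps)
    have "\<bar>G (\<sigma> t) (Y t \<omega>) \<bullet> (- sin t *\<^sub>R x + cos t *\<^sub>R z)\<bar> \<le> norm (G (\<sigma> t) (Y t \<omega>)) * norm (- sin t *\<^sub>R x + cos t *\<^sub>R z)"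
      by (rule Cauchy_Schwarz_ineq2)
    also have "\<dots> \<le> norm (G (\<sigma> t) (Y t \<omega>)) * (norm (fst \<omega>) + norm (snd \<omega>))"
    proof (rule mult_left_mono)
      have "norm (- sin t *\<^sub>R x + cos t *\<^sub>R z) \<le> \<bar>sin t\<bar> * norm x + \<bar>cos t\<bar> * norm z"
        using norm_triangle_ineq[of "- sin t *\<^sub>R x" "cos t *\<^sub>R z"] by simp
      also have "\<dots> \<le> 1 * norm x + 1 * norm z"
        by (intro add_mono mult_right_mono) auto
      finally show "norm (- sin t *\<^sub>R x + cos t *\<^sub>R z) \<le> norm (fst \<omega>) + norm (snd \<omega>)" by (simp add: \<omega>)
    qed simp
    also have "\<dots> \<le> 4 * K * W \<omega>" by (rule G_bd)
    finally have 1: "\<bar>G (\<sigma> t) (Y t \<omega>) \<bullet> (- sin t *\<^sub>R x + cos t *\<^sub>R z)\<bar> \<le> 4 * K * W \<omega>" .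
    have "\<bar>(1 - \<delta>) * cos t * Q (\<sigma> t) (Y t \<omega>)\<bar> \<le> (1 * 1) * (2 * K * W \<omega>)"
      unfolding abs_mult using \<delta> by (intro mult_mono Q_bd) auto
    then have 2: "\<bar>(1 - \<delta>) * cos t * Q (\<sigma> t) (Y t \<omega>) / 2\<bar> \<le> K * W \<omega>" by simp
    show "\<bar>D t \<omega>\<bar> \<le> 5 * K * W \<omega>"
      using 1 2 unfolding \<omega> D_def prod.case by linarith
  qed (use W in auto)
  \<comment> \<open>The random vector (\<tau>(X) - Id)^T Z, the only trace of the kernel that
    survives in the derivative.\<close>
  define N where "N = (\<lambda>(x, z :: real^'n). \<chi> j. \<Sum>i\<in>UNIV. (\<tau> x - mat 1) $ i $ j * z $ i)"
  have M_meas [measurable]: "(\<lambda>x. (\<tau> x - mat 1) $ i $ j) \<in> borel_measurable \<nu>" for i j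
    by simp
  have M_sq: "integrable \<nu> (\<lambda>x. (\<tau> x - mat 1) $ i $ j * (\<tau> x - mat 1) $ k $ l)" for i j k l
  proof (rule Bochner_Integration.integrable_bound[OF S2])
    have "\<bar>(\<tau> x - mat 1) $ i $ j * (\<tau> x - mat 1) $ k $ l\<bar> \<le> (norm (\<tau> x - mat 1))\<^sup>2" for x
    proof -
      have "\<bar>(\<tau> x - mat 1) $ i $ j\<bar> \<le> norm (\<tau> x - mat 1)" for i j
        using component_le_norm_cart[of "(\<tau> x - mat 1) $ i" j] Finite_Cartesian_Product.norm_nth_le[of "\<tau> x - mat 1" i] by linarith
      then show ?thesis
        unfolding abs_mult power2_eq_square by (intro mult_mono) auto
    qed
    then show "AE x in \<nu>. norm ((\<tau> x - mat 1) $ i $ j * (\<tau> x - mat 1) $ k $ l) \<le> norm ((norm (\<tau> x - mat 1))\<^sup>2)"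
      by simp
  qed measurable
  have z_sq: "integrable std_gaussian (\<lambda>z::real^'n. z $ i * z $ k)" for i k
  proof (rule integrable_std_gaussian_quadratic[where A = 1])
    show "\<bar>z $ i * z $ k\<bar> \<le> 1 * (1 + (norm z)\<^sup>2)" for z :: "real^'n"
      using mult_mono[OF component_le_norm_cart[of z i] component_le_norm_cart[of z k]]
      by (simp add: abs_mult power2_eq_square)
  qed measurable
  have N_sq_eq: "(norm (N (x, z)))\<^sup>2 = (\<Sum>j\<in>UNIV. \<Sum>i\<in>UNIV. \<Sum>k\<in>UNIV. ((\<tau> x - mat 1) $ i $ j * (\<tau> x - mat 1) $ k $ j) * (z $ i * z $ k))" for x z
    unfolding norm_sq_cart N_def by (simp add: sum_product mult_ac)
  \<comment> \<open>By independence and the identity covariance of Z only the terms with i = k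
    remain, and they add up to the Hilbert-Schmidt norm.\<close>
  have N_int: "integrable ?P (\<lambda>\<omega>. (norm (N \<omega>))\<^sup>2)"
    and N_eq: "(\<integral>\<omega>. (norm (N \<omega>))\<^sup>2 \<partial>?P) = (\<integral>x. (norm (\<tau> x - mat 1))\<^sup>2 \<partial>\<nu>)"
  proof -
    have *: "(\<lambda>\<omega>. (norm (N \<omega>))\<^sup>2) = (\<lambda>\<omega>. \<Sum>j\<in>UNIV. \<Sum>i\<in>UNIV. \<Sum>k\<in>UNIV. (\<lambda>(x, z). ((\<tau> x - mat 1) $ i $ j * (\<tau> x - mat 1) $ k $ j) * (z $ i * z $ k)) \<omega>)"
    proof
      fix \<omega> show "(norm (N \<omega>))\<^sup>2 = (\<Sum>j\<in>UNIV. \<Sum>i\<in>UNIV. \<Sum>k\<in>UNIV. (\<lambda>(x, z). ((\<tau> x - mat 1) $ i $ j * (\<tau> x - mat 1) $ k $ j) * (z $ i * z $ k)) \<omega>)"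
        using N_sq_eq by (cases \<omega>) (simp only: prod.case)
    qed
    show "integrable ?P (\<lambda>\<omega>. (norm (N \<omega>))\<^sup>2)"
      unfolding * by (intro Bochner_Integration.integrable_sum P.integrable_product M_sq z_sq)
    have "(\<integral>\<omega>. (norm (N \<omega>))\<^sup>2 \<partial>?P) = (\<Sum>j\<in>UNIV. \<Sum>i\<in>UNIV. \<Sum>k\<in>UNIV. (\<integral>x. (\<tau> x - mat 1) $ i $ j * (\<tau> x - mat 1) $ k $ j \<partial>\<nu>) * (if i = k then 1 else 0))"
      unfolding * by (simp only: Bochner_Integration.integral_sum Bochner_Integration.integrable_sum P.integrable_product M_sq z_sq std_gaussian_covariance)
    also have "\<dots> = (\<Sum>j\<in>UNIV. \<Sum>i\<in>UNIV. (\<integral>x. (\<tau> x - mat 1) $ i $ j * (\<tau> x - mat 1) $ i $ j \<partial>\<nu>))"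
    proof -
      have "(\<Sum>k\<in>UNIV. h k * (if i = k then 1 else 0)) = h i" for h :: "'n \<Rightarrow> real" and i
      proof -
        have "h k * (if i = k then 1 else 0) = (if k = i then h k else 0)" for k by simp
        then show ?thesis by simp
      qed
      then show ?thesis by (simp only:)
    qed
    also have "\<dots> = (\<integral>x. (\<Sum>j\<in>UNIV. \<Sum>i\<in>UNIV. (\<tau> x - mat 1) $ i $ j * (\<tau> x - mat 1) $ i $ j) \<partial>\<nu>)"
      by (simp only: Bochner_Integration.integral_sum Bochner_Integration.integrable_sum M_sq)
    also have "\<dots> = (\<integral>x. (norm (\<tau> x - mat 1))\<^sup>2 \<partial>\<nu>)"
      by (subst sum.swap) (simp only: power2_norm_eq_inner inner_vec_def inner_real_def)
    finally show "(\<integral>\<omega>. (norm (N \<omega>))\<^sup>2 \<partial>?P) = (\<integral>x. (norm (\<tau> x - mat 1))\<^sup>2 \<partial>\<nu>)" .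
  qed
  \<comment> \<open>Not the discrepancy but its square divided by 2(1 - \<delta>), the constant left
    by Young's inequality.\<close>
  define S where "S = (\<integral>x. (norm (\<tau> x - mat 1))\<^sup>2 \<partial>\<nu>) / (2 * (1 - \<delta>))"
  \<comment> \<open>On the open interval cos \<theta> is positive, so the affine form of the Stein
    identity is applicable.\<close>
  have key: "0 \<le> (\<integral>\<omega>. D \<theta> \<omega> \<partial>?P) + S * cos \<theta>" if \<theta>: "0 < \<theta>" "\<theta> < pi / 2" for \<theta>
  proof -
    define a c s where "a = cos \<theta>" and "c = sin \<theta>" and "s = \<sigma> \<theta>"
    have a: "a > 0" unfolding a_def using \<theta> by (intro cos_gt_zero) auto
    have c: "c > 0" unfolding c_def using \<theta> by (intro sin_gt_zero) auto
    have s: "s \<ge> \<delta>" unfolding s_def by (rule \<sigma>_ge)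
    have Y_eq: "Y \<theta> (x, z) = a *\<^sub>R x + c *\<^sub>R z" for x z
      by (simp add: Y_def a_def c_def)
    define G' where "G' \<omega> = G s (Y \<theta> \<omega>)" for \<omega>
    define XG where "XG \<omega> = fst \<omega> \<bullet> G' \<omega>" for \<omega>
    define ZG where "ZG i j \<omega> = snd \<omega> $ i * G' \<omega> $ j" for i j \<omega>
    define TZG where "TZG i j \<omega> = \<tau> (fst \<omega>) $ i $ j * ZG i j \<omega>" for i j \<omega>
    define TH where "TH i j \<omega> = \<tau> (fst \<omega>) $ i $ j * H s i j (Y \<theta> \<omega>)" for i j \<omega>
    define Q' where "Q' \<omega> = Q s (Y \<theta> \<omega>)" for \<omega>
    have [measurable]: "(\<lambda>\<omega>. G' \<omega> $ j) \<in> borel_measurable ?P" for j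
      unfolding G'_def s_def by measurable
    have [measurable]: "H s i j \<in> borel_measurable borel" for i j
      unfolding s_def by measurable
    have [measurable]: "XG \<in> borel_measurable ?P"
      unfolding XG_def inner_vec_def inner_real_def by measurable
    have [measurable]: "ZG i j \<in> borel_measurable ?P" "TZG i j \<in> borel_measurable ?P" "TH i j \<in> borel_measurable ?P" for i j
      unfolding ZG_def TZG_def TH_def by measurable
    have [measurable]: "Q' \<in> borel_measurable ?P"
      unfolding Q'_def by measurable
    have G'_bd: "norm (G' \<omega>) * norm (fst \<omega>) \<le> 4 * K * W \<omega>" "norm (G' \<omega>) * norm (snd \<omega>) \<le> 4 * K * W \<omega>" for \<omega>
    proof -
      have "0 \<le> norm (G' \<omega>) * norm (fst \<omega>)" "0 \<le> norm (G' \<omega>) * norm (snd \<omega>)" by simp_all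
      then show "norm (G' \<omega>) * norm (fst \<omega>) \<le> 4 * K * W \<omega>" "norm (G' \<omega>) * norm (snd \<omega>) \<le> 4 * K * W \<omega>"
        using G_bd[of \<theta> \<omega>, unfolded distrib_left] unfolding G'_def s_def by linarith+
    qed
    have KW: "integrable ?P (\<lambda>\<omega>. k * W \<omega>)" for k
      using W by simp
    have iXG: "integrable ?P XG"
    proof (rule Bochner_Integration.integrable_bound[OF KW[of "4 * K"]])
      have "\<bar>XG \<omega>\<bar> \<le> 4 * K * W \<omega>" for \<omega>
        using Cauchy_Schwarz_ineq2[of "fst \<omega>" "G' \<omega>"] G'_bd(1)[of \<omega>] by (simp add: XG_def mult.commute)
      then show "AE \<omega> in ?P. norm (XG \<omega>) \<le> norm (4 * K * W \<omega>)"
        by (rule AE_norm_leI)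
    qed measurable
    have iZG: "integrable ?P (ZG i j)" for i j
    proof (rule Bochner_Integration.integrable_bound[OF KW[of "4 * K"]])
      have "\<bar>ZG i j \<omega>\<bar> \<le> 4 * K * W \<omega>" for \<omega>
      proof -
        have "\<bar>ZG i j \<omega>\<bar> \<le> norm (snd \<omega>) * norm (G' \<omega>)"
          unfolding ZG_def abs_mult by (intro mult_mono component_le_norm_cart) auto
        with G'_bd(2)[of \<omega>] show ?thesis by (simp add: mult.commute)
      qed
      then show "AE \<omega> in ?P. norm (ZG i j \<omega>) \<le> norm (4 * K * W \<omega>)"
        by (rule AE_norm_leI)
    qed measurable
    have iQ: "integrable ?P Q'"
    proof (rule Bochner_Integration.integrable_bound[OF KW[of "2 * K"]])
      show "AE \<omega> in ?P. norm (Q' \<omega>) \<le> norm (2 * K * W \<omega>)"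
        using Q_bd[of \<theta>] unfolding Q'_def s_def by (rule AE_norm_leI)
    qed measurable
    \<comment> \<open>No multiple of \<open>W\<close> dominates this product, since
      \<open>\<tau>\<close> may be unbounded. After subtracting the identity, |uv| \<le> u^2 + v^2
      separates the square-integrable factor (\<tau> - Id) z from the gradient.\<close>
    have iTZG: "integrable ?P (TZG i j)" for i j
    proof -
      have "integrable ?P (\<lambda>\<omega>. (\<tau> (fst \<omega>) - mat 1) $ i $ j * ZG i j \<omega>)"
      proof (rule Bochner_Integration.integrable_bound)
        show "integrable ?P (\<lambda>\<omega>. (\<lambda>(x, z). ((\<tau> x - mat 1) $ i $ j * (\<tau> x - mat 1) $ i $ j) * (z $ i * z $ i)) \<omega> + 4 * K\<^sup>2 * W \<omega>)"
          by (intro Bochner_Integration.integrable_add P.integrable_product M_sq z_sq KW)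
        have "\<bar>(\<tau> (fst \<omega>) - mat 1) $ i $ j * ZG i j \<omega>\<bar> \<le> (\<lambda>(x, z). ((\<tau> x - mat 1) $ i $ j * (\<tau> x - mat 1) $ i $ j) * (z $ i * z $ i)) \<omega> + 4 * K\<^sup>2 * W \<omega>" for \<omega>
        proof -
          define u where "u = (\<tau> (fst \<omega>) - mat 1) $ i $ j * snd \<omega> $ i"
          define v where "v = G' \<omega> $ j"
          have "\<bar>v\<bar>\<^sup>2 \<le> (norm (G' \<omega>))\<^sup>2"
            unfolding v_def by (intro power_mono component_le_norm_cart) auto
          also have "\<dots> \<le> 4 * K\<^sup>2 * W \<omega>"
            unfolding G'_def s_def by (rule G2_bd)
          finally have v: "v\<^sup>2 \<le> 4 * K\<^sup>2 * W \<omega>" by simp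
          have "0 \<le> (\<bar>u\<bar> - \<bar>v\<bar>)\<^sup>2" by simp
          also have "(\<bar>u\<bar> - \<bar>v\<bar>)\<^sup>2 = u\<^sup>2 + v\<^sup>2 - 2 * \<bar>u * v\<bar>"
            by (simp add: power2_diff abs_mult)
          finally have "\<bar>u * v\<bar> \<le> u\<^sup>2 + v\<^sup>2"
            using abs_ge_zero[of "u * v"] by linarith
          with v have "\<bar>u * v\<bar> \<le> u\<^sup>2 + 4 * K\<^sup>2 * W \<omega>" by linarith
          then show ?thesis
            unfolding u_def v_def ZG_def by (simp add: case_prod_unfold power2_eq_square mult_ac)
        qed
        then show "AE \<omega> in ?P. norm ((\<tau> (fst \<omega>) - mat 1) $ i $ j * ZG i j \<omega>) \<le> norm ((\<lambda>(x, z). ((\<tau> x - mat 1) $ i $ j * (\<tau> x - mat 1) $ i $ j) * (z $ i * z $ i)) \<omega> + 4 * K\<^sup>2 * W \<omega>)"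
          by (rule AE_norm_leI)
      qed measurable
      from Bochner_Integration.integrable_add[OF this integrable_mult_right[OF iZG[of i j], of "(mat 1 :: real^'n^'n) $ i $ j"]]
      show ?thesis
        unfolding TZG_def[abs_def] by (simp add: left_diff_distrib)
    qed
    have iTH: "integrable ?P (TH i j)" for i j
    proof (rule Bochner_Integration.integrable_bound)
      show "integrable ?P (\<lambda>\<omega>. K * (\<lambda>(x, z). \<tau> x $ i $ j * 1) \<omega>)"
        by (intro integrable_mult_right P.integrable_product \<tau>_int) auto
      have "\<bar>TH i j \<omega>\<bar> \<le> \<bar>\<tau> (fst \<omega>) $ i $ j\<bar> * K" for \<omega>
        unfolding TH_def abs_mult H_def \<phi>_def by (intro mult_left_mono K s) auto
      then show "AE \<omega> in ?P. norm (TH i j \<omega>) \<le> norm (K * (\<lambda>(x, z). \<tau> x $ i $ j * 1) \<omega>)"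
        using K(1) by (intro AE_I2) (auto simp: abs_mult case_prod_unfold mult.commute)
    qed measurable
    \<comment> \<open>The Stein identity in x, applied for each fixed z.\<close>
    have T1: "(\<integral>\<omega>. XG \<omega> \<partial>?P) = a * (\<Sum>i\<in>UNIV. \<Sum>j\<in>UNIV. \<integral>\<omega>. TH i j \<omega> \<partial>?P)"
    proof -
      have "(\<integral>\<omega>. XG \<omega> \<partial>?P) = (\<integral>z. \<integral>x. XG (x, z) \<partial>\<nu> \<partial>std_gaussian)"
        using P.integral_snd[of "\<lambda>x z. XG (x, z)"] iXG by simp
      also have "\<dots> = (\<integral>z. a * (\<integral>x. (\<Sum>i\<in>UNIV. \<Sum>j\<in>UNIV. TH i j (x, z)) \<partial>\<nu>) \<partial>std_gaussian)"
      proof (rule Bochner_Integration.integral_cong[OF refl])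
        fix z :: "real^'n"
        have "(\<integral>x. x \<bullet> grad (\<phi> s) (a *\<^sub>R x + c *\<^sub>R z) \<partial>\<nu>) = a * (\<integral>x. \<tau> x \<bullet> hessian (\<phi> s) (a *\<^sub>R x + c *\<^sub>R z) \<partial>\<nu>)"
          using a K(5)[OF s] by (intro stein_kernel_affine[OF \<nu> sets_\<nu> st el[OF s], where C = K]) (auto simp: \<phi>_def)
        then show "(\<integral>x. XG (x, z) \<partial>\<nu>) = a * (\<integral>x. (\<Sum>i\<in>UNIV. \<Sum>j\<in>UNIV. TH i j (x, z)) \<partial>\<nu>)"
          by (simp add: grad_eq[OF s] hess_eq XG_def G'_def TH_def Y_eq)
      qed
      also have "\<dots> = a * (\<integral>z. \<integral>x. (\<Sum>i\<in>UNIV. \<Sum>j\<in>UNIV. TH i j (x, z)) \<partial>\<nu> \<partial>std_gaussian)"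
        by simp
      also have "(\<integral>z. \<integral>x. (\<Sum>i\<in>UNIV. \<Sum>j\<in>UNIV. TH i j (x, z)) \<partial>\<nu> \<partial>std_gaussian) = (\<integral>\<omega>. (\<Sum>i\<in>UNIV. \<Sum>j\<in>UNIV. TH i j \<omega>) \<partial>?P)"
        using P.integral_snd[of "\<lambda>x z. \<Sum>i\<in>UNIV. \<Sum>j\<in>UNIV. TH i j (x, z)"] iTH
        by (simp add: case_prod_unfold)
      also have "\<dots> = (\<Sum>i\<in>UNIV. \<Sum>j\<in>UNIV. \<integral>\<omega>. TH i j \<omega> \<partial>?P)"
        using iTH by simp
      finally show ?thesis .
    qed
    \<comment> \<open>Integration by parts in z for each fixed x, read backwards: the factor
      \<open>c\<close> in front of \<open>XG\<close> in the derivative turns the Hessian back into a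
      gradient.\<close>
    have T2: "c * (\<integral>\<omega>. TH i j \<omega> \<partial>?P) = (\<integral>\<omega>. TZG i j \<omega> \<partial>?P)" for i j
    proof -
      have "(\<integral>\<omega>. TZG i j \<omega> \<partial>?P) = (\<integral>x. \<integral>z. TZG i j (x, z) \<partial>std_gaussian \<partial>\<nu>)"
        by (rule P.integral_fst'[OF iTZG, symmetric])
      also have "\<dots> = (\<integral>x. c * (\<integral>z. TH i j (x, z) \<partial>std_gaussian) \<partial>\<nu>)"
      proof (rule Bochner_Integration.integral_cong[OF refl])
        fix x :: "real^'n"
        have "(\<integral>z. z $ i * partial_deriv j (\<phi> s) (c *\<^sub>R z + a *\<^sub>R x) \<partial>std_gaussian) = c * (\<integral>z. partial_deriv i (partial_deriv j (\<phi> s)) (c *\<^sub>R z + a *\<^sub>R x) \<partial>std_gaussian)"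
          using K(5)[OF s] by (intro std_gaussian_integration_by_parts_affine[OF elementary_partial_deriv[OF el[OF s]], where C = K]) (auto simp: \<phi>_def)
        then have "(\<integral>z. ZG i j (x, z) \<partial>std_gaussian) = c * (\<integral>z. H s i j (Y \<theta> (x, z)) \<partial>std_gaussian)"
          by (simp add: pd[OF s] H_def ZG_def G'_def Y_eq add.commute)
        then show "(\<integral>z. TZG i j (x, z) \<partial>std_gaussian) = c * (\<integral>z. TH i j (x, z) \<partial>std_gaussian)"
          by (simp add: TZG_def TH_def)
      qed
      also have "\<dots> = c * (\<integral>\<omega>. TH i j \<omega> \<partial>?P)"
        using P.integral_fst'[OF iTH, of i j] by simp
      finally show ?thesis ..
    qed
    \<comment> \<open>What remains of the derivative after the common factor \<open>a\<close> has
      been taken out.\<close>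
    define E where "E \<omega> = (1 - \<delta>) / 2 * Q' \<omega> - ((\<Sum>i\<in>UNIV. \<Sum>j\<in>UNIV. TZG i j \<omega>) - (\<Sum>j\<in>UNIV. ZG j j \<omega>))" for \<omega>
    have E_int: "integrable ?P E"
      unfolding E_def[abs_def] by (intro Bochner_Integration.integrable_diff Bochner_Integration.integrable_sum integrable_mult_right iQ iTZG iZG)
    have "(\<integral>\<omega>. D \<theta> \<omega> \<partial>?P) = (\<integral>\<omega>. - c * XG \<omega> + (a * (\<Sum>j\<in>UNIV. ZG j j \<omega>) + a * ((1 - \<delta>) / 2 * Q' \<omega>)) \<partial>?P)"
    proof (rule Bochner_Integration.integral_cong[OF refl])
      fix \<omega>
      have "snd \<omega> \<bullet> G' \<omega> = (\<Sum>j\<in>UNIV. ZG j j \<omega>)"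
        by (simp add: ZG_def inner_vec_def)
      moreover have "D \<theta> \<omega> = - c * XG \<omega> + (a * (snd \<omega> \<bullet> G' \<omega>) + a * ((1 - \<delta>) / 2 * Q' \<omega>))"
        by (cases \<omega>) (simp add: D_def XG_def G'_def Q'_def a_def c_def s_def inner_add_right inner_diff_right inner_commute)
      ultimately show "D \<theta> \<omega> = - c * XG \<omega> + (a * (\<Sum>j\<in>UNIV. ZG j j \<omega>) + a * ((1 - \<delta>) / 2 * Q' \<omega>))"
        by simp
    qed
    also have "\<dots> = - c * (\<integral>\<omega>. XG \<omega> \<partial>?P) + (a * (\<Sum>j\<in>UNIV. \<integral>\<omega>. ZG j j \<omega> \<partial>?P) + a * ((1 - \<delta>) / 2 * (\<integral>\<omega>. Q' \<omega> \<partial>?P)))"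
      using iXG iZG iQ by simp
    also have "c * (\<integral>\<omega>. XG \<omega> \<partial>?P) = a * (\<Sum>i\<in>UNIV. \<Sum>j\<in>UNIV. \<integral>\<omega>. TZG i j \<omega> \<partial>?P)"
      unfolding T1 T2[symmetric] by (simp add: sum_distrib_left mult_ac)
    then have "- c * (\<integral>\<omega>. XG \<omega> \<partial>?P) = - (a * (\<Sum>i\<in>UNIV. \<Sum>j\<in>UNIV. \<integral>\<omega>. TZG i j \<omega> \<partial>?P))"
      by simp
    also have "- (a * (\<Sum>i\<in>UNIV. \<Sum>j\<in>UNIV. \<integral>\<omega>. TZG i j \<omega> \<partial>?P)) + (a * (\<Sum>j\<in>UNIV. \<integral>\<omega>. ZG j j \<omega> \<partial>?P) + a * ((1 - \<delta>) / 2 * (\<integral>\<omega>. Q' \<omega> \<partial>?P)))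
      = a * (\<integral>\<omega>. E \<omega> \<partial>?P)"
      unfolding E_def using iTZG iZG iQ by (simp add: algebra_simps)
    finally have DE: "(\<integral>\<omega>. D \<theta> \<omega> \<partial>?P) = a * (\<integral>\<omega>. E \<omega> \<partial>?P)" .
    have "- S = (\<integral>\<omega>. - ((norm (N \<omega>))\<^sup>2 / (2 * (1 - \<delta>))) \<partial>?P)"
      using N_int by (simp add: N_eq S_def)
    also have "\<dots> \<le> (\<integral>\<omega>. E \<omega> \<partial>?P)"
    proof (rule integral_mono)
      fix \<omega>
      have "(\<Sum>i\<in>UNIV. \<Sum>j\<in>UNIV. TZG i j \<omega>) - (\<Sum>j\<in>UNIV. ZG j j \<omega>) = N \<omega> \<bullet> G' \<omega>"
      proof -
        have "N \<omega> \<bullet> G' \<omega> = (\<Sum>j\<in>UNIV. \<Sum>i\<in>UNIV. (\<tau> (fst \<omega>) - mat 1) $ i $ j * ZG i j \<omega>)"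
          by (cases \<omega>) (simp add: N_def inner_vec_def ZG_def sum_distrib_right mult.assoc)
        also have "\<dots> = (\<Sum>j\<in>UNIV. \<Sum>i\<in>UNIV. TZG i j \<omega> - (if i = j then ZG i j \<omega> else 0))"
          by (intro sum.cong refl) (simp add: TZG_def mat_def left_diff_distrib)
        also have "\<dots> = (\<Sum>j\<in>UNIV. \<Sum>i\<in>UNIV. TZG i j \<omega>) - (\<Sum>j\<in>UNIV. ZG j j \<omega>)"
          by (simp add: sum_subtractf)
        finally show ?thesis by (subst sum.swap) simp
      qed
      \<comment> \<open>Young's inequality with weight 1 - \<delta>, chosen so that the gradient
        term has exactly the coefficient of the Hamilton-Jacobi term in \<open>E\<close>.\<close>
      moreover have "N \<omega> \<bullet> G' \<omega> \<le> (norm (N \<omega>))\<^sup>2 / (2 * (1 - \<delta>)) + (1 - \<delta>) / 2 * (norm (G' \<omega>))\<^sup>2"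
      proof -
        have "0 \<le> (norm (N \<omega> - (1 - \<delta>) *\<^sub>R G' \<omega>))\<^sup>2" by simp
        also have "\<dots> = (norm (N \<omega>))\<^sup>2 - 2 * (1 - \<delta>) * (N \<omega> \<bullet> G' \<omega>) + (1 - \<delta>)\<^sup>2 * (norm (G' \<omega>))\<^sup>2"
          unfolding power2_norm_eq_inner
          by (simp add: inner_diff_left inner_diff_right inner_commute power2_eq_square algebra_simps)
        finally have "2 * (1 - \<delta>) * (N \<omega> \<bullet> G' \<omega>) \<le> (norm (N \<omega>))\<^sup>2 + (1 - \<delta>)\<^sup>2 * (norm (G' \<omega>))\<^sup>2" by simp
        then have "N \<omega> \<bullet> G' \<omega> \<le> ((norm (N \<omega>))\<^sup>2 + (1 - \<delta>)\<^sup>2 * (norm (G' \<omega>))\<^sup>2) / (2 * (1 - \<delta>))"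
          using \<delta> by (simp add: pos_le_divide_eq mult.commute)
        also have "\<dots> = (norm (N \<omega>))\<^sup>2 / (2 * (1 - \<delta>)) + (1 - \<delta>) / 2 * (norm (G' \<omega>))\<^sup>2"
          using \<delta> by (simp add: add_divide_distrib power2_eq_square nonzero_divide_eq_eq)
        finally show ?thesis .
      qed
      moreover have "(1 - \<delta>) / 2 * (norm (G' \<omega>))\<^sup>2 \<le> (1 - \<delta>) / 2 * Q' \<omega>"
        unfolding G'_def Q'_def G_def Q_def using \<delta> by (intro mult_left_mono potential_grad_energy[OF \<epsilon> B]) auto
      ultimately show "- ((norm (N \<omega>))\<^sup>2 / (2 * (1 - \<delta>))) \<le> E \<omega>"
        unfolding E_def by linarith
    qed (use N_int E_int in auto)
    finally have "a * - S \<le> a * (\<integral>\<omega>. E \<omega> \<partial>?P)"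
      using a by (intro mult_left_mono) auto
    then show ?thesis
      unfolding DE by (simp add: a_def mult.commute)
  qed
  define \<Lambda>' where "\<Lambda>' \<theta> = (\<integral>\<omega>. \<phi> (\<sigma> \<theta>) (Y \<theta> \<omega>) \<partial>?P) + S * sin \<theta>" for \<theta>
  have \<Lambda>'_deriv: "(\<Lambda>' has_real_derivative (\<integral>\<omega>. D \<theta> \<omega> \<partial>?P) + S * cos \<theta>) (at \<theta>)" for \<theta>
    unfolding \<Lambda>'_def[abs_def] by (auto intro!: derivative_eq_intros \<Lambda>)
  have "\<Lambda>' 0 \<le> \<Lambda>' (pi / 2)"
  proof (rule DERIV_nonneg_imp_increasing_open[where f = \<Lambda>' and a = 0 and b = "pi / 2"])
    show "continuous_on {0..pi / 2} \<Lambda>'"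
      using \<Lambda>'_deriv by (intro continuous_at_imp_continuous_on ballI DERIV_isCont)
  qed (use \<Lambda>'_deriv key in auto)
  moreover have "\<Lambda>' 0 = (\<integral>x. \<phi> 1 x \<partial>\<nu>)"
  proof -
    have "integrable \<nu> (\<phi> 1)"
    proof (rule Bochner_Integration.integrable_bound)
      show "integrable \<nu> (\<lambda>x. K * (1 + (norm x)\<^sup>2))" using m2\<nu> by simp
      show "AE x in \<nu>. norm (\<phi> 1 x) \<le> norm (K * (1 + (norm x)\<^sup>2))"
        using K(2)[of 1] \<delta> by (intro AE_norm_leI) (simp add: \<phi>_def)
      have "\<phi> 1 \<in> borel_measurable borel" using \<delta> by (intro elementary_borel el) auto
      then show "\<phi> 1 \<in> borel_measurable \<nu>" by simp
    qed
    from P.integrable_product(2)[OF this, of "\<lambda>_. 1"] show ?thesis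
      using \<gamma>.prob_space by (simp add: \<Lambda>'_def Y_def \<sigma>_def case_prod_unfold)
  qed
  moreover have "\<Lambda>' (pi / 2) = (\<integral>x. \<phi> \<delta> x \<partial>std_gaussian) + S"
  proof -
    have "integrable std_gaussian (\<phi> \<delta>)"
      using K(2)[of \<delta>] unfolding \<phi>_def
      by (intro integrable_std_gaussian_quadratic[where A = K] elementary_borel elementary_potential[OF \<epsilon> B] \<delta>) auto
    from P.integrable_product(2)[OF _ this, of "\<lambda>_. 1"] show ?thesis
      by (simp add: \<Lambda>'_def Y_def \<sigma>_def case_prod_unfold \<nu>.prob_space)
  qed
  ultimately show ?thesis
    by (simp add: \<phi>_def S_def)
qed

section \<open>Semi-discrete entropic transport\<close>

text \<open>Lowering one entry by t multiplies the sum of exponentials by 1 + k, and ln(1 + k) \<le>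
  k. This one-sided estimate takes the place of differentiating the dual functional.\<close>

lemma softmin_update_ge:
  assumes \<epsilon>: "\<epsilon> > 0" and B: "finite B" "B \<noteq> {}" and b: "b \<in> B"
  shows "softmin \<epsilon> B (u(b := u b - t)) \<ge> softmin \<epsilon> B u - \<epsilon> * (exp (t / \<epsilon>) - 1) * softmin_weight \<epsilon> B u b"
proof -
  define Z where "Z = (\<Sum>b\<in>B. exp (- u b / \<epsilon>))"
  define k where "k = (exp (t / \<epsilon>) - 1) * softmin_weight \<epsilon> B u b"
  have Z: "Z > 0" unfolding Z_def by (rule softmin_sum_pos[OF \<epsilon> B])
  have "(\<Sum>c\<in>B. exp (- (u(b := u b - t)) c / \<epsilon>)) = exp (- u b / \<epsilon>) * exp (t / \<epsilon>) + (\<Sum>c\<in>B - {b}. exp (- u c / \<epsilon>))"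
    using B b by (simp add: sum.remove[of _ b] diff_divide_distrib flip: exp_add)
  also have "\<dots> = Z + (exp (t / \<epsilon>) - 1) * exp (- u b / \<epsilon>)"
    unfolding Z_def using B b by (simp add: sum.remove[of _ b] algebra_simps)
  also have "\<dots> = Z * (1 + k)"
    unfolding k_def softmin_weight_eq[OF \<epsilon> B] Z_def[symmetric] using Z by (simp add: distrib_left)
  finally have eq: "(\<Sum>c\<in>B. exp (- (u(b := u b - t)) c / \<epsilon>)) = Z * (1 + k)" .
  then have "0 < Z * (1 + k)"
    using softmin_sum_pos[OF \<epsilon> B, of "u(b := u b - t)"] by simp
  then have k: "1 + k > 0" using Z by (simp add: zero_less_mult_iff)
  have "ln (Z * (1 + k)) = ln Z + ln (1 + k)"
    using Z k by (auto simp: ln_mult)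
  then have "softmin \<epsilon> B (u(b := u b - t)) = softmin \<epsilon> B u - \<epsilon> * ln (1 + k)"
    unfolding softmin_def eq Z_def[symmetric] by (simp add: distrib_left)
  moreover have "\<epsilon> * ln (1 + k) \<le> \<epsilon> * k"
    using \<epsilon> k ln_le_minus_one[of "1 + k"] by (intro mult_left_mono) auto
  ultimately show ?thesis by (simp add: k_def mult.assoc)
qed

text \<open>The function \<open>g\<close> maximises the dual functional \<open>F\<close> of entropy-regularised optimal transport
  between \<open>M\<close> and the finitely supported measure with weights \<open>p\<close>; the first-order condition at a
  maximum prescribes the second marginal.\<close>

lemma entropic_transport_exists:
  fixes c :: "'a \<Rightarrow> 'b \<Rightarrow> real"
  assumes M: "prob_space M" and \<epsilon>: "\<epsilon> > 0" and B: "finite B" "B \<noteq> {}"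
    and c: "\<And>b. b \<in> B \<Longrightarrow> integrable M (\<lambda>x. c x b)"
    and p: "\<And>b. b \<in> B \<Longrightarrow> p b > 0" "(\<Sum>b\<in>B. p b) = 1"
  obtains g where "\<And>b. b \<in> B \<Longrightarrow> (\<integral>x. softmin_weight \<epsilon> B (\<lambda>b. c x b - g b) b \<partial>M) = p b"
proof -
  interpret prob_space M by fact
  define \<phi> where "\<phi> g x = softmin \<epsilon> B (\<lambda>b. c x b - g b)" for g x
  define F where "F g = (\<integral>x. \<phi> g x \<partial>M) + (\<Sum>b\<in>B. p b * g b)" for g
  have c_meas [measurable]: "b \<in> B \<Longrightarrow> (\<lambda>x. c x b) \<in> borel_measurable M" for b
    using c by auto
  have \<phi>_meas [measurable]: "\<phi> g \<in> borel_measurable M" for g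
    unfolding \<phi>_def[abs_def] softmin_def by measurable
  have \<phi>_int: "integrable M (\<phi> g)" for g
  proof (rule Bochner_Integration.integrable_bound)
    show "integrable M (\<lambda>x. (\<Sum>b\<in>B. \<bar>c x b - g b\<bar>) + \<epsilon> * card B)"
      using c by (intro Bochner_Integration.integrable_add Bochner_Integration.integrable_sum integrable_abs Bochner_Integration.integrable_diff) auto
    show "AE x in M. norm (\<phi> g x) \<le> norm ((\<Sum>b\<in>B. \<bar>c x b - g b\<bar>) + \<epsilon> * card B)"
      unfolding \<phi>_def by (rule AE_norm_leI[OF abs_softmin_le[OF \<epsilon> B]])
  qed simp
  have p_le_1: "p b \<le> 1" if "b \<in> B" for b
    using member_le_sum[of b B p] p that B by (simp add: less_imp_le)
  \<comment> \<open>The dual functional is Lipschitz: the soft minimum and the linear part each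
    contribute one copy of the sum, hence the factor 2. Continuity on the compact box
    follows.\<close>
  have F_le: "F g \<le> F h + 2 * (\<Sum>b\<in>B. \<bar>g b - h b\<bar>)" for g h
  proof -
    have "(\<integral>x. \<phi> g x \<partial>M) \<le> (\<integral>x. \<phi> h x + (\<Sum>b\<in>B. \<bar>g b - h b\<bar>) \<partial>M)"
    proof (rule integral_mono)
      fix x
      show "\<phi> g x \<le> \<phi> h x + (\<Sum>b\<in>B. \<bar>g b - h b\<bar>)"
        unfolding \<phi>_def
      proof (rule softmin_mono[OF \<epsilon> B])
        fix b assume "b \<in> B"
        then have "\<bar>g b - h b\<bar> \<le> (\<Sum>b\<in>B. \<bar>g b - h b\<bar>)"
          using B by (intro member_le_sum) auto
        then show "c x b - g b \<le> c x b - h b + (\<Sum>b\<in>B. \<bar>g b - h b\<bar>)" by linarith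
      qed
    qed (use \<phi>_int in auto)
    moreover have "(\<Sum>b\<in>B. p b * g b) \<le> (\<Sum>b\<in>B. p b * h b + \<bar>g b - h b\<bar>)"
    proof (rule sum_mono)
      fix b assume b: "b \<in> B"
      have "p b * (g b - h b) \<le> p b * \<bar>g b - h b\<bar>"
        using p(1)[OF b] by (intro mult_left_mono) auto
      also have "\<dots> \<le> 1 * \<bar>g b - h b\<bar>"
        using p_le_1[OF b] by (intro mult_right_mono) auto
      finally show "p b * g b \<le> p b * h b + \<bar>g b - h b\<bar>" by (simp add: algebra_simps)
    qed
    ultimately show ?thesis
      using \<phi>_int by (simp add: F_def sum.distrib prob_space)
  qed
  define C where "C = (\<integral>x. (\<Sum>b\<in>B. \<bar>c x b\<bar>) \<partial>M)"
  \<comment> \<open>Chosen so that a nonpositive dual variable with some entry below -L cannot beat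
    the zero function. Taking a sum makes \<open>L\<close> dominate the requirement for every b at
    once.\<close>
  define L where "L = (\<Sum>b\<in>B. (\<bar>C\<bar> + \<bar>F (\<lambda>_. 0)\<bar>) / p b)"
  have L: "p b * L \<ge> C - F (\<lambda>_. 0)" if b: "b \<in> B" for b
  proof -
    have "(\<bar>C\<bar> + \<bar>F (\<lambda>_. 0)\<bar>) / p b \<le> L"
      unfolding L_def using b B p(1) by (intro member_le_sum) (auto simp: less_imp_le)
    then have "\<bar>C\<bar> + \<bar>F (\<lambda>_. 0)\<bar> \<le> p b * L"
      using p(1)[OF b] by (simp add: pos_divide_le_eq mult.commute)
    then show ?thesis by linarith
  qed
  have L0: "L \<ge> 0"
    unfolding L_def using p(1) by (intro sum_nonneg divide_nonneg_pos) auto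
  \<comment> \<open>The dual variables are functions on the whole type; fixing the value 0 outside
    \<open>B\<close> makes the box compact in the product topology.\<close>
  define S where "S = (\<Pi>\<^sub>E b\<in>UNIV. if b \<in> B then {-L..0} else {0::real})"
  have "compact S"
  proof -
    have "compactin (product_topology (\<lambda>_. euclidean) UNIV) S"
      unfolding S_def compactin_PiE by auto
    then show ?thesis by (simp add: euclidean_product_topology)
  qed
  moreover have zero: "(\<lambda>_. 0) \<in> S"
    using L0 by (auto simp: S_def)
  moreover have "continuous_on S F"
    unfolding continuous_on_def
  proof
    fix g assume "g \<in> S"
    have "continuous_on S (\<lambda>h. 2 * (\<Sum>b\<in>B. \<bar>h b - g b\<bar>))"
      by (intro continuous_intros continuous_on_product_then_coordinatewise continuous_on_id)
    with \<open>g \<in> S\<close> have lim: "((\<lambda>h. 2 * (\<Sum>b\<in>B. \<bar>h b - g b\<bar>)) \<longlongrightarrow> 0) (at g within S)"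
      unfolding continuous_on_def by (auto dest!: bspec[where x = g] intro: tendsto_mult_right_zero)
    have "((\<lambda>h. F h - F g) \<longlongrightarrow> 0) (at g within S)"
    proof (rule Lim_null_comparison[OF always_eventually lim], rule allI)
      fix h show "norm (F h - F g) \<le> 2 * (\<Sum>b\<in>B. \<bar>h b - g b\<bar>)"
        using F_le[of h g] F_le[of g h] by (simp add: abs_minus_commute abs_le_iff)
    qed
    then show "(F \<longlongrightarrow> F g) (at g within S)"
      by (rule LIM_zero_cancel)
  qed
  ultimately obtain gm where gm: "gm \<in> S" "\<And>g. g \<in> S \<Longrightarrow> F g \<le> F gm"
    using continuous_attains_sup[of S F] by blast
  have max: "F g \<le> F gm" for g
  proof -
    \<comment> \<open>Adding a constant to g leaves the dual functional unchanged because the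
      weights p sum to 1. Subtracting the maximum therefore makes all entries nonpositive with one
      of them 0, and then either g lies in the box or some entry is below -L.\<close>
    define m where "m = Max (g ` B)"
    have "m \<in> g ` B"
      unfolding m_def using B by (intro Max_in) auto
    then obtain b0 where b0: "b0 \<in> B" "g b0 = m" by auto
    define h where "h b = (if b \<in> B then g b - m else 0)" for b
    have h0: "h b \<le> 0" for b
      using B by (auto simp: h_def m_def)
    have "(\<integral>x. \<phi> g x \<partial>M) \<le> (\<integral>x. \<phi> h x + - m \<partial>M)"
    proof (rule integral_mono)
      fix x show "\<phi> g x \<le> \<phi> h x + - m"
        unfolding \<phi>_def by (rule softmin_mono[OF \<epsilon> B]) (simp add: h_def)
    qed (use \<phi>_int in auto)
    moreover have "(\<Sum>b\<in>B. p b * g b) = (\<Sum>b\<in>B. p b * h b + m * p b)"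
      by (intro sum.cong) (auto simp: h_def algebra_simps)
    then have "(\<Sum>b\<in>B. p b * g b) = (\<Sum>b\<in>B. p b * h b) + m"
      by (simp add: sum.distrib p flip: sum_distrib_left)
    ultimately have gh: "F g \<le> F h"
      using \<phi>_int by (simp add: F_def prob_space)
    show ?thesis
    proof (cases "h \<in> S")
      case True
      with gh gm show ?thesis by (meson order_trans)
    next
      case False
      then obtain b1 where b1: "b1 \<in> B" "h b1 < - L"
        using h0 by (auto simp: S_def h_def PiE_iff split: if_splits)
      have "(\<integral>x. \<phi> h x \<partial>M) \<le> C"
        unfolding C_def
      proof (rule integral_mono)
        fix x
        have "\<phi> h x \<le> c x b0 - h b0"
          unfolding \<phi>_def by (rule softmin_le[OF \<epsilon> B b0(1)])
        also have "\<dots> \<le> \<bar>c x b0\<bar>" using b0 by (simp add: h_def)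
        also have "\<dots> \<le> (\<Sum>b\<in>B. \<bar>c x b\<bar>)"
          using B b0 by (intro member_le_sum) auto
        finally show "\<phi> h x \<le> (\<Sum>b\<in>B. \<bar>c x b\<bar>)" .
      qed (use \<phi>_int c in auto)
      moreover have "(\<Sum>b\<in>B. p b * h b) \<le> (\<Sum>b\<in>{b1}. p b * h b)"
      proof -
        have "(\<Sum>b\<in>{b1}. - (p b * h b)) \<le> (\<Sum>b\<in>B. - (p b * h b))"
          using B b1 h0 p(1) by (intro sum_mono2) (auto simp: mult_nonneg_nonpos less_imp_le)
        then show ?thesis by (simp add: sum_negf)
      qed
      moreover have "p b1 * h b1 \<le> p b1 * - L"
        using b1 p(1)[OF b1(1)] by (intro mult_left_mono) auto
      ultimately have "F h \<le> F (\<lambda>_. 0)"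
        using L[OF b1(1)] by (simp add: F_def)
      with gh gm(2)[OF zero] show ?thesis by linarith
    qed
  qed
  define w where "w b x = softmin_weight \<epsilon> B (\<lambda>b. c x b - gm b) b" for b x
  have w_int: "integrable M (w b)" if b: "b \<in> B" for b
  proof (rule Bochner_Integration.integrable_bound)
    show "integrable M (\<lambda>_. 1 :: real)" by simp
    show "w b \<in> borel_measurable M"
      using b unfolding w_def[abs_def] softmin_weight_def softmin_def by measurable
    show "AE x in M. norm (w b x) \<le> norm (1 :: real)"
      using softmin_weight_le_1[OF \<epsilon> B b] softmin_weight_pos[OF \<epsilon> B] by (auto simp: w_def less_imp_le)
  qed
  have le: "p b \<le> (\<integral>x. w b x \<partial>M)" if b: "b \<in> B" for b
  proof (rule ccontr)
    define I where "I = (\<integral>x. w b x \<partial>M)"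
    assume "\<not> p b \<le> (\<integral>x. w b x \<partial>M)"
    then have I: "I < p b" by (simp add: I_def)
    have I0: "I \<ge> 0"
      unfolding I_def w_def using softmin_weight_pos[OF \<epsilon> B] by (intro integral_nonneg_AE) (auto simp: less_imp_le)
    \<comment> \<open>Comparison of the maximiser with its perturbation in the single coordinate b.
      The step t = \<open>\<epsilon>\<close> r makes the temperature cancel.\<close>
    have upd: "r * p b \<le> (exp r - 1) * I" for r
    proof -
      define t where "t = \<epsilon> * r"
      have r: "r = t / \<epsilon>" using \<epsilon> by (simp add: t_def)
      define h where "h = gm(b := gm b + t)"
      have "(\<integral>x. \<phi> gm x - \<epsilon> * (exp r - 1) * w b x \<partial>M) \<le> (\<integral>x. \<phi> h x \<partial>M)"
      proof (rule integral_mono)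
        fix x
        have "(\<lambda>b'. c x b' - h b') = (\<lambda>b. c x b - gm b)(b := (c x b - gm b) - t)"
          by (auto simp: h_def)
        then show "\<phi> gm x - \<epsilon> * (exp r - 1) * w b x \<le> \<phi> h x"
          using softmin_update_ge[OF \<epsilon> B b, of "\<lambda>b. c x b - gm b" t] by (simp add: \<phi>_def w_def r)
      qed (use \<phi>_int w_int[OF b] in auto)
      then have "(\<integral>x. \<phi> gm x \<partial>M) - \<epsilon> * (exp r - 1) * I \<le> (\<integral>x. \<phi> h x \<partial>M)"
        using \<phi>_int w_int[OF b] by (simp add: I_def)
      moreover have "(\<Sum>b\<in>B. p b * h b) = (\<Sum>b\<in>B. p b * gm b) + p b * t"
        using B b by (simp add: h_def sum.remove[of _ b] distrib_left)
      ultimately have "p b * t \<le> \<epsilon> * (exp r - 1) * I"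
        using max[of h] by (simp add: F_def)
      then have "\<epsilon> * (r * p b) \<le> \<epsilon> * ((exp r - 1) * I)"
        by (simp add: t_def mult_ac)
      then show ?thesis using \<epsilon> by simp
    qed
    \<comment> \<open>The bound 1 permits exp r \<le> 1 + r + r^2; the other bound makes r I smaller
      than the gap p b - I, which contradicts the first-order estimate.\<close>
    define r where "r = min 1 ((p b - I) / (2 * (I + 1)))"
    have r: "0 < r" "r \<le> 1" "r \<le> (p b - I) / (2 * (I + 1))"
      using I I0 by (auto simp: r_def)
    have "r * p b \<le> (r + r\<^sup>2) * I"
    proof -
      have "exp r \<le> 1 + r + r\<^sup>2" using r by (intro exp_bound) auto
      then have "(exp r - 1) * I \<le> (r + r\<^sup>2) * I" using I0 by (intro mult_right_mono) auto
      with upd[of r] show ?thesis by linarith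
    qed
    then have "r * p b \<le> r * ((1 + r) * I)"
      by (simp add: power2_eq_square algebra_simps)
    then have "p b \<le> (1 + r) * I" using r by simp
    moreover have "r * I < p b - I"
    proof -
      have "r * I \<le> (p b - I) / (2 * (I + 1)) * I" using r I0 by (intro mult_right_mono) auto
      also have "\<dots> = (p b - I) * (I / (2 * (I + 1)))" by simp
      also have "\<dots> < (p b - I) * 1" using I I0 by (intro mult_strict_left_mono) (auto simp: divide_simps)
      finally show ?thesis by simp
    qed
    ultimately show False by (simp add: distrib_right)
  qed
  \<comment> \<open>Both families of weights sum to 1, so the one-sided inequalities are
    equalities.\<close>
  have "(\<Sum>b\<in>B. p b) = (\<Sum>b\<in>B. \<integral>x. w b x \<partial>M)"
  proof -
    have "(\<Sum>b\<in>B. \<integral>x. w b x \<partial>M) = (\<integral>x. (\<Sum>b\<in>B. w b x) \<partial>M)"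
      using w_int by (intro Bochner_Integration.integral_sum[symmetric])
    also have "\<dots> = 1"
      unfolding w_def by (simp add: sum_softmin_weight[OF \<epsilon> B] prob_space)
    finally show ?thesis using p by simp
  qed
  from sum_mono_inv[OF this le _ B(1)] have "(\<integral>x. w b x \<partial>M) = p b" if "b \<in> B" for b
    using that by force
  then show ?thesis
    by (intro that[of gm]) (simp add: w_def)
qed

text \<open>Simple functions approximate the identity pointwise with at most twice its norm, so the
  second moment turns this into mean square convergence. Values of zero mass are removed because the
  entropic transport divides by the masses.\<close>

lemma finite_range_approximation:
  fixes M :: "'a::{real_normed_vector, second_countable_topology} measure"
  assumes M: "prob_space M" and sets_M [measurable_cong]: "sets M = sets borel"
    and m2: "integrable M (\<lambda>x. (norm x)\<^sup>2)" and e: "e > 0"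
  obtains B \<beta> where "finite B" "B \<noteq> {}" "\<beta> \<in> borel_measurable borel" "range \<beta> \<subseteq> B"
    "\<forall>b\<in>B. measure M {x. \<beta> x = b} > 0"
    "integrable M (\<lambda>x. (norm (x - \<beta> x))\<^sup>2)" "(\<integral>x. (norm (x - \<beta> x))\<^sup>2 \<partial>M) < e"
proof -
  interpret prob_space M by fact
  have space_M: "space M = UNIV" using sets_eq_imp_space_eq[OF sets_M] by simp
  obtain F :: "nat \<Rightarrow> 'a \<Rightarrow> 'a" where F: "\<And>i. simple_function M (F i)" "\<And>x. (\<lambda>i. F i x) \<longlonglongrightarrow> x"
    "\<And>i x. dist (F i x) 0 \<le> 2 * dist x 0"
    using borel_measurable_implies_sequence_metric[of "\<lambda>x. x" M 0] space_M by auto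
  have F_meas [measurable]: "F i \<in> borel_measurable borel" for i
    using borel_measurable_simple_function[OF F(1)] measurable_cong_sets[OF sets_M refl] by blast
  \<comment> \<open>9 is the square of 1 + 2, where 2 is the constant in the bound on
    \<open>F i x\<close>.\<close>
  have bd: "(norm (x - F i x))\<^sup>2 \<le> 9 * (norm x)\<^sup>2" for x i
  proof -
    have "norm (x - F i x) \<le> 3 * norm x"
      using norm_triangle_ineq4[of x "F i x"] F(3)[of i x] by simp
    then have "(norm (x - F i x))\<^sup>2 \<le> (3 * norm x)\<^sup>2" by (rule power_mono) simp
    then show ?thesis by (simp add: power_mult_distrib)
  qed
  have int: "integrable M (\<lambda>x. (norm (x - F i x))\<^sup>2)" for i
    by (rule Bochner_Integration.integrable_bound[OF integrable_mult_right[OF m2, of 9]]) (use bd in auto)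
  have "(\<lambda>i. \<integral>x. (norm (x - F i x))\<^sup>2 \<partial>M) \<longlonglongrightarrow> (\<integral>x. 0 \<partial>M)"
  proof (rule integral_dominated_convergence[where w = "\<lambda>x. 9 * (norm x)\<^sup>2"])
    show "AE x in M. (\<lambda>i. (norm (x - F i x))\<^sup>2) \<longlonglongrightarrow> 0"
    proof (rule AE_I2)
      fix x
      have "(\<lambda>i. (norm (x - F i x))\<^sup>2) \<longlonglongrightarrow> (norm (x - x))\<^sup>2"
        by (intro tendsto_intros F)
      then show "(\<lambda>i. (norm (x - F i x))\<^sup>2) \<longlonglongrightarrow> 0" by simp
    qed
  qed (use m2 bd in auto)
  then have "\<forall>\<^sub>F i in sequentially. (\<integral>x. (norm (x - F i x))\<^sup>2 \<partial>M) < e"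
    using e by (intro order_tendstoD) auto
  then obtain i where i: "(\<integral>x. (norm (x - F i x))\<^sup>2 \<partial>M) < e"
    using eventually_happens by force
  define R where "R = range (F i)"
  have R: "finite R"
    using F(1)[of i] space_M by (simp add: simple_function_def R_def)
  define B where "B = {b \<in> R. measure M {x. F i x = b} > 0}"
  have sing [measurable]: "{x. F i x = b} \<in> sets M" for b
  proof -
    have "F i -` {b} \<inter> space borel \<in> sets borel" by (rule measurable_sets[OF F_meas]) simp
    moreover have "F i -` {b} \<inter> space borel = {x. F i x = b}" by auto
    ultimately show ?thesis by (simp add: sets_M)
  qed
  have AE: "AE x in M. F i x \<in> B"
  proof -
    have "AE x in M. \<forall>b\<in>R - B. \<not> F i x = b"
    proof (rule AE_finite_allI)
      fix b assume "b \<in> R - B"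
      then have "measure M {x. F i x = b} = 0"
        using measure_nonneg[of M "{x. F i x = b}"] by (auto simp: B_def not_less)
      then have "emeasure M {x. F i x = b} = 0" by (simp add: emeasure_eq_measure)
      then show "AE x in M. \<not> F i x = b"
        by (intro AE_I[where N = "{x. F i x = b}"]) (auto simp: sing)
    qed (use R in simp)
    then show ?thesis by eventually_elim (auto simp: R_def)
  qed
  have "B \<noteq> {}"
  proof
    assume "B = {}"
    with AE have "AE x in M. False" by simp
    then show False by (simp add: AE_False)
  qed
  then obtain b0 where b0: "b0 \<in> B" by blast
  have B: "finite B" using R by (simp add: B_def)
  \<comment> \<open>The default value \<open>b0\<close> is taken on a null set; it makes the range
    lie in \<open>B\<close> everywhere and not just almost everywhere.\<close>
  define \<beta> where "\<beta> x = (if F i x \<in> B then F i x else b0)" for x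
  have [measurable]: "B \<in> sets borel" using B by (simp add: borel_closed finite_imp_closed)
  have \<beta>_meas [measurable]: "\<beta> \<in> borel_measurable borel"
    unfolding \<beta>_def[abs_def] by measurable
  have \<beta>_AE: "AE x in M. \<beta> x = F i x"
    using AE by eventually_elim (simp add: \<beta>_def)
  have eq: "AE x in M. (norm (x - \<beta> x))\<^sup>2 = (norm (x - F i x))\<^sup>2"
    using \<beta>_AE by eventually_elim simp
  show ?thesis
  proof (rule that[of B \<beta>])
    show "range \<beta> \<subseteq> B" using b0 by (auto simp: \<beta>_def)
    show "integrable M (\<lambda>x. (norm (x - \<beta> x))\<^sup>2)"
      by (subst integrable_cong_AE[OF _ _ eq]) (use int in auto)
    have "(\<integral>x. (norm (x - \<beta> x))\<^sup>2 \<partial>M) = (\<integral>x. (norm (x - F i x))\<^sup>2 \<partial>M)"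
      by (rule integral_cong_AE[OF _ _ eq]) auto
    with i show "(\<integral>x. (norm (x - \<beta> x))\<^sup>2 \<partial>M) < e" by simp
    show "\<forall>b\<in>B. measure M {x. \<beta> x = b} > 0"
    proof
      fix b assume b: "b \<in> B"
      have "{x. \<beta> x = b} \<in> sets M"
      proof -
        have "\<beta> -` {b} \<inter> space borel \<in> sets borel" by (rule measurable_sets[OF \<beta>_meas]) simp
        moreover have "\<beta> -` {b} \<inter> space borel = {x. \<beta> x = b}" by auto
        ultimately show ?thesis by (simp add: sets_M)
      qed
      then have "measure M {x. F i x = b} \<le> measure M {x. \<beta> x = b}"
        using b by (intro finite_measure_mono) (auto simp: \<beta>_def)
      with b show "measure M {x. \<beta> x = b} > 0" by (simp add: B_def)
    qed
  qed (use B \<open>B \<noteq> {}\<close> \<beta>_meas in auto)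
qed

section \<open>The transport inequality\<close>

lemma integral_finite_range:
  fixes h :: "'b \<Rightarrow> real"
  assumes "prob_space M" and B: "finite B" and \<beta>: "\<And>x. x \<in> space M \<Longrightarrow> \<beta> x \<in> B"
    and meas: "\<And>b. b \<in> B \<Longrightarrow> {x \<in> space M. \<beta> x = b} \<in> sets M"
  shows "integrable M (\<lambda>x. h (\<beta> x))"
    and "(\<integral>x. h (\<beta> x) \<partial>M) = (\<Sum>b\<in>B. h b * measure M {x \<in> space M. \<beta> x = b})"
proof -
  interpret prob_space M by fact
  have eq: "h (\<beta> x) = (\<Sum>b\<in>B. h b * indicator {x \<in> space M. \<beta> x = b} x)" if "x \<in> space M" for x
  proof -
    have "h b * indicator {x \<in> space M. \<beta> x = b} x = (if b = \<beta> x then h b else 0)" for b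
      using that by auto
    then show ?thesis using \<beta>[OF that] B by simp
  qed
  have int: "integrable M (\<lambda>x. h b * indicator {x \<in> space M. \<beta> x = b} x)" if "b \<in> B" for b
    using meas[OF that] by (intro integrable_mult_right integrable_real_indicator) (auto simp: emeasure_eq_measure)
  show "integrable M (\<lambda>x. h (\<beta> x))"
    by (subst Bochner_Integration.integrable_cong[OF refl eq]) (auto intro: int)
  have "(\<integral>x. h (\<beta> x) \<partial>M) = (\<integral>x. (\<Sum>b\<in>B. h b * indicator {x \<in> space M. \<beta> x = b} x) \<partial>M)"
    by (rule Bochner_Integration.integral_cong[OF refl eq])
  also have "\<dots> = (\<Sum>b\<in>B. \<integral>x. h b * indicator {x \<in> space M. \<beta> x = b} x \<partial>M)"
    by (rule Bochner_Integration.integral_sum[OF int])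
  also have "\<dots> = (\<Sum>b\<in>B. h b * measure M {x \<in> space M. \<beta> x = b})"
    using meas by (intro sum.cong) (auto simp: Int_absorb2 Collect_mono_iff)
  finally show "(\<integral>x. h (\<beta> x) \<partial>M) = (\<Sum>b\<in>B. h b * measure M {x \<in> space M. \<beta> x = b})" .
qed

lemma (in pair_prob_space) density_in_couplings:
  assumes k [measurable]: "k \<in> borel_measurable (M1 \<Otimes>\<^sub>M M2)"
    and k1: "\<And>x. x \<in> space M1 \<Longrightarrow> (\<integral>\<^sup>+y. k (x, y) \<partial>M2) = 1"
    and k2: "\<And>y. y \<in> space M2 \<Longrightarrow> (\<integral>\<^sup>+x. k (x, y) \<partial>M1) = 1"
  shows "density (M1 \<Otimes>\<^sub>M M2) k \<in> couplings M1 M2"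
proof -
  have "distr (density (M1 \<Otimes>\<^sub>M M2) k) M1 fst = M1"
  proof (rule measure_eqI)
    fix A assume "A \<in> sets (distr (density (M1 \<Otimes>\<^sub>M M2) k) M1 fst)"
    then have A [measurable]: "A \<in> sets M1" by simp
    have "emeasure (distr (density (M1 \<Otimes>\<^sub>M M2) k) M1 fst) A = (\<integral>\<^sup>+\<omega>. k \<omega> * indicator A (fst \<omega>) \<partial>(M1 \<Otimes>\<^sub>M M2))"
      by (subst emeasure_distr, simp, simp, subst emeasure_density)
        (auto intro!: nn_integral_cong split: split_indicator)
    also have "\<dots> = (\<integral>\<^sup>+x. \<integral>\<^sup>+y. k (x, y) * indicator A x \<partial>M2 \<partial>M1)"
      by (subst M2.nn_integral_fst[symmetric]) auto
    also have "\<dots> = (\<integral>\<^sup>+x. indicator A x \<partial>M1)"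
      by (intro nn_integral_cong) (simp add: nn_integral_multc k1)
    finally show "emeasure (distr (density (M1 \<Otimes>\<^sub>M M2) k) M1 fst) A = emeasure M1 A" by simp
  qed simp
  moreover have "distr (density (M1 \<Otimes>\<^sub>M M2) k) M2 snd = M2"
  proof (rule measure_eqI)
    fix A assume "A \<in> sets (distr (density (M1 \<Otimes>\<^sub>M M2) k) M2 snd)"
    then have A [measurable]: "A \<in> sets M2" by simp
    have "emeasure (distr (density (M1 \<Otimes>\<^sub>M M2) k) M2 snd) A = (\<integral>\<^sup>+\<omega>. k \<omega> * indicator A (snd \<omega>) \<partial>(M1 \<Otimes>\<^sub>M M2))"
      by (subst emeasure_distr, simp, simp, subst emeasure_density)
        (auto intro!: nn_integral_cong split: split_indicator)
    also have "\<dots> = (\<integral>\<^sup>+y. \<integral>\<^sup>+x. k (x, y) * indicator A y \<partial>M1 \<partial>M2)"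
      by (subst nn_integral_snd[symmetric]) (auto simp: case_prod_unfold)
    also have "\<dots> = (\<integral>\<^sup>+y. indicator A y \<partial>M2)"
      by (intro nn_integral_cong) (simp add: nn_integral_multc k2)
    finally show "emeasure (distr (density (M1 \<Otimes>\<^sub>M M2) k) M2 snd) A = emeasure M2 A" by simp
  qed simp
  ultimately show ?thesis by (simp add: couplings_def)
qed

lemma ennreal_sqrt_ennreal: "ennreal_sqrt (ennreal a) = ennreal (sqrt (max a 0))"
  by (simp add: ennreal_sqrt_def enn2real_ennreal max_def) (auto simp: ennreal_neg)

lemma ennreal_sqrt_mono:
  assumes "a \<le> b" shows "ennreal_sqrt a \<le> ennreal_sqrt b"
proof (cases "b = \<top>")
  case False
  then have "a \<noteq> \<top>" using assms by (auto simp: top_unique)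
  moreover have "enn2real a \<le> enn2real b"
    using assms False by (intro enn2real_mono) (simp_all add: less_top)
  ultimately show ?thesis
    using False by (simp add: ennreal_sqrt_def ennreal_leI)
qed (simp add: ennreal_sqrt_def)

text \<open>Three errors are tied to the one parameter \<open>\<delta>\<close>: the entropy of the
  plan, the distance of the Gaussian from its finite-range approximation, and the weight in the
  triangle inequality. The plan to finitely many points is lifted to a coupling with the Gaussian
  itself, so no intermediate Wasserstein distance appears.\<close>

lemma wasserstein2_le_approx:
  fixes \<nu> :: "(real^'n::finite) measure"
  assumes \<nu>: "prob_space \<nu>" and sets_\<nu> [measurable_cong]: "sets \<nu> = sets borel" and st: "stein_kernel \<nu> \<tau>"
    and S2: "integrable \<nu> (\<lambda>x. (norm (\<tau> x - mat 1))\<^sup>2)" and \<delta>: "0 < \<delta>" "\<delta> < 1"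
  defines "S \<equiv> \<integral>x. (norm (\<tau> x - mat 1))\<^sup>2 \<partial>\<nu>"
  shows "wasserstein2 \<nu> std_gaussian \<le> ennreal_sqrt (ennreal ((1 + \<delta>) * (S / (1 - \<delta>) + 2 * \<delta>) + (1 + 1 / \<delta>) * \<delta>\<^sup>2))"
proof -
  let ?\<gamma> = "std_gaussian :: (real^'n) measure"
  interpret \<nu>: prob_space \<nu> by fact
  interpret \<gamma>: prob_space ?\<gamma> by (rule prob_space_std_gaussian)
  interpret P: pair_prob_space \<nu> ?\<gamma> ..
  let ?P = "\<nu> \<Otimes>\<^sub>M ?\<gamma>"
  have m2\<nu>: "integrable \<nu> (\<lambda>x. (norm x)\<^sup>2)" by (rule stein_kernel_second_moment[OF st])
  have m2\<gamma>: "integrable ?\<gamma> (\<lambda>z. (norm z)\<^sup>2)"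
    by (rule integrable_std_gaussian_quadratic[where A = 1]) auto
  have \<delta>2: "\<delta>\<^sup>2 > 0" using \<delta> by simp
  \<comment> \<open>The tolerance is \<open>\<delta>\<^sup>2\<close> because the error is later
    divided by \<open>\<delta>\<close>, both in the potential at time \<open>\<delta>\<close> and in
    the weighted triangle inequality.\<close>
  obtain B and \<beta> :: "real^'n \<Rightarrow> real^'n" where B: "finite B" "B \<noteq> {}" and \<beta>_meas [measurable]: "\<beta> \<in> borel_measurable borel"
    and \<beta>_range: "range \<beta> \<subseteq> B" and p_pos: "\<forall>b\<in>B. measure ?\<gamma> {x. \<beta> x = b} > 0"
    and \<beta>_int: "integrable ?\<gamma> (\<lambda>x. (norm (x - \<beta> x))\<^sup>2)" and \<beta>_e: "(\<integral>x. (norm (x - \<beta> x))\<^sup>2 \<partial>?\<gamma>) < \<delta>\<^sup>2"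
    by (rule finite_range_approximation[OF \<gamma>.prob_space_axioms sets_std_gaussian m2\<gamma> \<delta>2]) (rule that)
  define e where "e = (\<integral>x. (norm (x - \<beta> x))\<^sup>2 \<partial>?\<gamma>)"
  have e0: "e \<ge> 0" and e_less: "e < \<delta>\<^sup>2" using \<beta>_e by (simp_all add: e_def)
  have \<beta>B: "\<beta> x \<in> B" for x using \<beta>_range by auto
  define p where "p b = measure ?\<gamma> {x. \<beta> x = b}" for b
  have sing: "{x \<in> space ?\<gamma>. \<beta> x = b} \<in> sets ?\<gamma>" for b
  proof -
    have "\<beta> -` {b} \<inter> space borel \<in> sets borel" by (rule measurable_sets[OF \<beta>_meas]) simp
    moreover have "\<beta> -` {b} \<inter> space borel = {x \<in> space ?\<gamma>. \<beta> x = b}" by auto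
    ultimately show ?thesis by simp
  qed
  have \<gamma>_sum: "integrable ?\<gamma> (\<lambda>y. h (\<beta> y))" "(\<integral>y. h (\<beta> y) \<partial>?\<gamma>) = (\<Sum>b\<in>B. h b * p b)" for h :: "real^'n \<Rightarrow> real"
    using integral_finite_range[OF \<gamma>.prob_space_axioms B(1) \<beta>B sing, of h] by (simp_all add: p_def)
  have p: "\<And>b. b \<in> B \<Longrightarrow> p b > 0" "(\<Sum>b\<in>B. p b) = 1"
    using p_pos \<gamma>_sum(2)[of "\<lambda>_. 1"] \<gamma>.prob_space by (simp_all add: p_def)
  have card: "real (card B) > 0" using B by (simp add: card_gt_0_iff)
  \<comment> \<open>The entropy term is at most \<open>\<epsilon>\<close> times the number of
    points; doubled, it contributes \<open>\<delta>\<close> to the squared cost.\<close>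
  define \<epsilon> where "\<epsilon> = \<delta> / (2 * card B)"
  have \<epsilon>: "\<epsilon> > 0" and \<epsilon>_card: "\<epsilon> * card B = \<delta> / 2"
    using \<delta> card by (simp_all add: \<epsilon>_def)
  have c_int: "integrable \<nu> (\<lambda>x. (norm (x - b))\<^sup>2)" for b
  proof (rule Bochner_Integration.integrable_bound)
    show "integrable \<nu> (\<lambda>x. 2 * ((norm x)\<^sup>2 + (norm b)\<^sup>2))" using m2\<nu> by simp
    have "(norm (x - b))\<^sup>2 \<le> 2 * ((norm x)\<^sup>2 + (norm b)\<^sup>2)" for x
    proof -
      have "(norm (x - b))\<^sup>2 + (norm (x + b))\<^sup>2 = 2 * ((norm x)\<^sup>2 + (norm b)\<^sup>2)"
        by (simp add: power2_norm_eq_inner inner_diff_left inner_diff_right inner_add_left inner_add_right inner_commute)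
      then show ?thesis using zero_le_power2[of "norm (x + b)"] by linarith
    qed
    then show "AE x in \<nu>. norm ((norm (x - b))\<^sup>2) \<le> norm (2 * ((norm x)\<^sup>2 + (norm b)\<^sup>2))"
      by (intro AE_norm_leI) simp
  qed measurable
  obtain g where g: "\<And>b. b \<in> B \<Longrightarrow> (\<integral>x. softmin_weight \<epsilon> B (\<lambda>b. (norm (x - b))\<^sup>2 / 2 - g b) b \<partial>\<nu>) = p b"
    using entropic_transport_exists[OF \<nu> \<epsilon> B _ p, of "\<lambda>x b. (norm (x - b))\<^sup>2 / 2"] c_int by auto
  define \<phi> where "\<phi> = potential \<epsilon> B g"
  define w where "w x b = potential_weight \<epsilon> B g 1 x b" for x b
  have w_pos: "w x b > 0" for x b
    unfolding w_def by (rule potential_weight_pos[OF \<epsilon> B])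
  have w_sum: "(\<Sum>b\<in>B. w x b) = 1" for x
    unfolding w_def by (rule sum_potential_weight[OF \<epsilon> B])
  have w_le_1: "w x b \<le> 1" if "b \<in> B" for x b
    unfolding w_def potential_weight_def by (rule softmin_weight_le_1[OF \<epsilon> B that])
  have w_meas [measurable]: "(\<lambda>x. w x b) \<in> borel_measurable borel" for b
    unfolding w_def potential_weight_def softmin_weight_def softmin_def by measurable
  have w_int: "(\<integral>x. w x b \<partial>\<nu>) = p b" if "b \<in> B" for b
    using g[OF that] by (simp add: w_def potential_weight_def)
  have w_integrable: "integrable \<nu> (\<lambda>x. w x b * f x)" if b: "b \<in> B" and f: "integrable \<nu> f" for b and f :: "real^'n \<Rightarrow> real"
  proof (rule Bochner_Integration.integrable_bound[OF f])
    show "AE x in \<nu>. norm (w x b * f x) \<le> norm (f x)"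
      using w_le_1[OF b] w_pos by (intro AE_I2) (simp add: abs_mult mult_left_le_one_le less_imp_le)
    show "(\<lambda>x. w x b * f x) \<in> borel_measurable \<nu>" using f by simp
  qed
  \<comment> \<open>Given x, the cell of b has conditional probability \<open>w x b\<close>;
    dividing by its Gaussian mass \<open>p b\<close> distributes that probability inside the cell in
    proportion to the Gaussian.\<close>
  define k where "k x b = ennreal (w x b / p b)" for x b
  have k_meas [measurable]: "(\<lambda>\<omega>. k (fst \<omega>) (\<beta> (snd \<omega>))) \<in> borel_measurable ?P"
  proof -
    have "k (fst \<omega>) (\<beta> (snd \<omega>)) = ennreal (\<Sum>b\<in>B. w (fst \<omega>) b / p b * indicator {b} (\<beta> (snd \<omega>)))" for \<omega>
    proof -
      have "w (fst \<omega>) b / p b * indicator {b} (\<beta> (snd \<omega>)) = (if b = \<beta> (snd \<omega>) then w (fst \<omega>) b / p b else 0)" for b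
        by auto
      then show ?thesis using B \<beta>B by (simp add: k_def)
    qed
    then show ?thesis by simp
  qed
  have nn_\<gamma>: "(\<integral>\<^sup>+y. k x (\<beta> y) * ennreal (f (\<beta> y)) \<partial>?\<gamma>) = ennreal (\<Sum>b\<in>B. w x b * f b)" if "\<And>b. f b \<ge> 0" for x f
  proof -
    have "(\<integral>\<^sup>+y. k x (\<beta> y) * ennreal (f (\<beta> y)) \<partial>?\<gamma>) = (\<integral>\<^sup>+y. ennreal (w x (\<beta> y) / p (\<beta> y) * f (\<beta> y)) \<partial>?\<gamma>)"
      unfolding k_def by (intro nn_integral_cong) (simp only: ennreal_mult''[OF that])
    also have "\<dots> = ennreal (\<Sum>b\<in>B. w x b / p b * f b * p b)"
      using w_pos p(1)[OF \<beta>B] that unfolding \<gamma>_sum(2)[of "\<lambda>b. w x b / p b * f b", symmetric]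
      by (intro nn_integral_eq_integral \<gamma>_sum(1)[of "\<lambda>b. w x b / p b * f b"] AE_I2 mult_nonneg_nonneg divide_nonneg_nonneg)
        (auto simp: less_imp_le)
    also have "(\<Sum>b\<in>B. w x b / p b * f b * p b) = (\<Sum>b\<in>B. w x b * f b)"
      using p(1) by (intro sum.cong) (auto simp: less_imp_neq[symmetric])
    finally show ?thesis .
  qed
  have nn_\<nu>: "(\<integral>\<^sup>+x. k x b \<partial>\<nu>) = 1" if b: "b \<in> B" for b
  proof -
    have "(\<integral>\<^sup>+x. k x b \<partial>\<nu>) = ennreal (\<integral>x. w x b / p b \<partial>\<nu>)"
      unfolding k_def
    proof (rule nn_integral_eq_integral)
      show "integrable \<nu> (\<lambda>x. w x b / p b)"
        using w_integrable[OF b, of "\<lambda>_. 1 / p b"] by simp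
      show "AE x in \<nu>. 0 \<le> w x b / p b"
        using w_pos p(1)[OF b] by (simp add: less_imp_le)
    qed
    also have "\<dots> = 1" using w_int[OF b] p(1)[OF b] by simp
    finally show ?thesis .
  qed
  define \<pi> where "\<pi> = density ?P (\<lambda>\<omega>. k (fst \<omega>) (\<beta> (snd \<omega>)))"
  have \<pi>: "\<pi> \<in> couplings \<nu> ?\<gamma>"
    unfolding \<pi>_def
  proof (rule P.density_in_couplings)
    show "(\<integral>\<^sup>+y. k (fst (x, y)) (\<beta> (snd (x, y))) \<partial>?\<gamma>) = 1" for x
      using nn_\<gamma>[of "\<lambda>_. 1" x] by (simp add: w_sum)
    show "(\<integral>\<^sup>+x. k (fst (x, y)) (\<beta> (snd (x, y))) \<partial>\<nu>) = 1" for y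
      using nn_\<nu>[OF \<beta>B] by simp
  qed simp
  define D where "D = (\<integral>x. (\<Sum>b\<in>B. w x b * (norm (x - b))\<^sup>2) \<partial>\<nu>)"
  have D_integrable: "integrable \<nu> (\<lambda>x. \<Sum>b\<in>B. w x b * (norm (x - b))\<^sup>2)"
    by (intro Bochner_Integration.integrable_sum w_integrable c_int)
  have \<phi>_le: "\<bar>\<phi> s y\<bar> \<le> (\<Sum>b\<in>B. \<bar>(norm (y - b))\<^sup>2 / (2 * s) - g b\<bar>) + \<epsilon> * card B" for s y
    unfolding \<phi>_def potential_def by (rule abs_softmin_le[OF \<epsilon> B])
  have \<phi>_int: "integrable \<nu> (\<phi> 1)"
  proof (rule Bochner_Integration.integrable_bound)
    show "integrable \<nu> (\<lambda>y. (\<Sum>b\<in>B. \<bar>(norm (y - b))\<^sup>2 / (2 * 1) - g b\<bar>) + \<epsilon> * card B)"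
      using c_int by simp
    show "AE y in \<nu>. norm (\<phi> 1 y) \<le> norm ((\<Sum>b\<in>B. \<bar>(norm (y - b))\<^sup>2 / (2 * 1) - g b\<bar>) + \<epsilon> * card B)"
      by (rule AE_norm_leI[OF \<phi>_le])
    have "\<phi> 1 \<in> borel_measurable borel"
      unfolding \<phi>_def by (intro elementary_borel elementary_potential[OF \<epsilon> B]) simp
    then show "\<phi> 1 \<in> borel_measurable \<nu>" by simp
  qed
  obtain K where K: "\<And>s y. s \<ge> \<delta> \<Longrightarrow> \<bar>potential \<epsilon> B g s y\<bar> \<le> K * (1 + (norm y)\<^sup>2)"
    using potential_bounds[OF \<epsilon> B \<delta>(1), where g = g] by metis
  have \<phi>_int_\<gamma>: "integrable ?\<gamma> (\<phi> \<delta>)"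
    unfolding \<phi>_def using K[of \<delta>]
    by (intro integrable_std_gaussian_quadratic[where A = K] elementary_borel elementary_potential[OF \<epsilon> B] \<delta>) auto
  \<comment> \<open>The marginal condition turns the means of \<open>w x b * g b\<close> into
    \<open>p b * g b\<close>. The same sum occurs with the opposite sign in the bound for the
    potential at time \<open>\<delta>\<close>, so \<open>g\<close> drops out.\<close>
  have D_le: "D \<le> S / (1 - \<delta>) + e / \<delta> + \<delta>"
  proof -
    have "D \<le> (\<integral>x. 2 * (\<Sum>b\<in>B. w x b * g b) + 2 * \<phi> 1 x + \<delta> \<partial>\<nu>)"
      unfolding D_def
    proof (rule integral_mono[OF D_integrable])
      show "integrable \<nu> (\<lambda>x. 2 * (\<Sum>b\<in>B. w x b * g b) + 2 * \<phi> 1 x + \<delta>)"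
        using \<phi>_int w_integrable[of _ "\<lambda>_. g _"] by (intro Bochner_Integration.integrable_add integrable_mult_right Bochner_Integration.integrable_sum) auto
      fix x
      have "(\<Sum>b\<in>B. w x b * ((norm (x - b))\<^sup>2 / 2 - g b)) \<le> \<phi> 1 x + \<epsilon> * card B"
        using sum_softmin_weight_mult_le[OF \<epsilon> B, of "\<lambda>b. (norm (x - b))\<^sup>2 / 2 - g b"]
        by (simp add: w_def potential_weight_def \<phi>_def potential_def)
      moreover have "(\<Sum>b\<in>B. w x b * ((norm (x - b))\<^sup>2 / 2 - g b)) = (\<Sum>b\<in>B. w x b * (norm (x - b))\<^sup>2) / 2 - (\<Sum>b\<in>B. w x b * g b)"
        by (simp add: right_diff_distrib sum_subtractf sum_divide_distrib)
      ultimately show "(\<Sum>b\<in>B. w x b * (norm (x - b))\<^sup>2) \<le> 2 * (\<Sum>b\<in>B. w x b * g b) + 2 * \<phi> 1 x + \<delta>"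
        unfolding \<epsilon>_card by linarith
    qed
    also have "\<dots> = 2 * (\<Sum>b\<in>B. p b * g b) + 2 * (\<integral>x. \<phi> 1 x \<partial>\<nu>) + \<delta>"
      using \<phi>_int w_integrable[of _ "\<lambda>_. g _"] w_integrable[of _ "\<lambda>_. 1"] by (simp add: \<nu>.prob_space w_int)
    finally have 1: "D \<le> 2 * (\<Sum>b\<in>B. p b * g b) + 2 * (\<integral>x. \<phi> 1 x \<partial>\<nu>) + \<delta>" .
    have 2: "(\<integral>x. \<phi> 1 x \<partial>\<nu>) - (\<integral>x. \<phi> \<delta> x \<partial>?\<gamma>) \<le> S / (2 * (1 - \<delta>))"
      unfolding \<phi>_def S_def by (rule potential_interpolation[OF \<nu> sets_\<nu> st S2 \<epsilon> B \<delta>])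
    \<comment> \<open>The soft minimum is bounded by its entry at the representative
      \<open>\<beta> y\<close>, which is within the approximation error of y.\<close>
    have "(\<integral>y. \<phi> \<delta> y \<partial>?\<gamma>) \<le> (\<integral>y. (norm (y - \<beta> y))\<^sup>2 / (2 * \<delta>) - g (\<beta> y) \<partial>?\<gamma>)"
    proof (rule integral_mono[OF \<phi>_int_\<gamma>])
      show "integrable ?\<gamma> (\<lambda>y. (norm (y - \<beta> y))\<^sup>2 / (2 * \<delta>) - g (\<beta> y))"
        using \<beta>_int \<gamma>_sum(1)[of g] by simp
      show "\<phi> \<delta> y \<le> (norm (y - \<beta> y))\<^sup>2 / (2 * \<delta>) - g (\<beta> y)" for y
        unfolding \<phi>_def potential_def by (rule softmin_le[OF \<epsilon> B \<beta>B])
    qed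
    also have "\<dots> = e / (2 * \<delta>) - (\<Sum>b\<in>B. p b * g b)"
      using \<beta>_int \<gamma>_sum[of g] by (simp add: e_def mult.commute)
    finally have 3: "(\<integral>y. \<phi> \<delta> y \<partial>?\<gamma>) \<le> e / (2 * \<delta>) - (\<Sum>b\<in>B. p b * g b)" .
    define s t where "s = S / (2 * (1 - \<delta>))" and "t = e / (2 * \<delta>)"
    have "D \<le> 2 * s + 2 * t + \<delta>"
      using 1 2 3 unfolding s_def[symmetric] t_def[symmetric] by linarith
    moreover have "2 * s = S / (1 - \<delta>)" "2 * t = e / \<delta>"
      using \<delta> by (simp_all add: s_def t_def divide_simps)
    ultimately show ?thesis by simp
  qed
  have "e / \<delta> \<le> \<delta>"
    using e_less \<delta> by (simp add: divide_le_eq power2_eq_square)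
  with D_le have D_le': "D \<le> S / (1 - \<delta>) + 2 * \<delta>" by linarith
  \<comment> \<open>Transport cost and approximation error use opposite orders of integration:
    conditioning on x gives a finite Gibbs average, while conditioning on y leaves the total mass 1
    of the kernel.\<close>
  have first: "(\<integral>\<^sup>+\<omega>. k (fst \<omega>) (\<beta> (snd \<omega>)) * ennreal ((norm (fst \<omega> - \<beta> (snd \<omega>)))\<^sup>2) \<partial>?P) = ennreal D"
  proof -
    have "(\<integral>\<^sup>+\<omega>. k (fst \<omega>) (\<beta> (snd \<omega>)) * ennreal ((norm (fst \<omega> - \<beta> (snd \<omega>)))\<^sup>2) \<partial>?P)
      = (\<integral>\<^sup>+x. \<integral>\<^sup>+y. k x (\<beta> y) * ennreal ((norm (x - \<beta> y))\<^sup>2) \<partial>?\<gamma> \<partial>\<nu>)"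
      by (subst \<gamma>.nn_integral_fst[symmetric]) auto
    also have "\<dots> = (\<integral>\<^sup>+x. ennreal (\<Sum>b\<in>B. w x b * (norm (x - b))\<^sup>2) \<partial>\<nu>)"
      using nn_\<gamma>[of "\<lambda>b. (norm (_ - b))\<^sup>2"] by (intro nn_integral_cong) simp
    also have "\<dots> = ennreal D"
      unfolding D_def using w_pos by (intro nn_integral_eq_integral D_integrable AE_I2 sum_nonneg) (simp add: less_imp_le)
    finally show ?thesis .
  qed
  have second: "(\<integral>\<^sup>+\<omega>. k (fst \<omega>) (\<beta> (snd \<omega>)) * ennreal ((norm (snd \<omega> - \<beta> (snd \<omega>)))\<^sup>2) \<partial>?P) = ennreal e"
  proof -
    have "(\<integral>\<^sup>+\<omega>. k (fst \<omega>) (\<beta> (snd \<omega>)) * ennreal ((norm (snd \<omega> - \<beta> (snd \<omega>)))\<^sup>2) \<partial>?P)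
      = (\<integral>\<^sup>+y. \<integral>\<^sup>+x. k x (\<beta> y) * ennreal ((norm (y - \<beta> y))\<^sup>2) \<partial>\<nu> \<partial>?\<gamma>)"
      by (subst P.nn_integral_snd[symmetric]) (auto simp: case_prod_unfold)
    also have "\<dots> = (\<integral>\<^sup>+y. ennreal ((norm (y - \<beta> y))\<^sup>2) \<partial>?\<gamma>)"
    proof (rule nn_integral_cong)
      fix y
      have "(\<integral>\<^sup>+x. k x (\<beta> y) * ennreal ((norm (y - \<beta> y))\<^sup>2) \<partial>\<nu>) = (\<integral>\<^sup>+x. k x (\<beta> y) \<partial>\<nu>) * ennreal ((norm (y - \<beta> y))\<^sup>2)"
        by (rule nn_integral_multc) (simp add: k_def)
      then show "(\<integral>\<^sup>+x. k x (\<beta> y) * ennreal ((norm (y - \<beta> y))\<^sup>2) \<partial>\<nu>) = ennreal ((norm (y - \<beta> y))\<^sup>2)"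
        by (simp add: nn_\<nu>[OF \<beta>B])
    qed
    also have "\<dots> = ennreal e"
      unfolding e_def by (intro nn_integral_eq_integral \<beta>_int) simp
    finally show ?thesis .
  qed
  \<comment> \<open>A weighted triangle inequality through z; the deficit is the square (\<delta> a
    - b)^2 divided by \<delta>.\<close>
  have young: "(norm (x - y))\<^sup>2 \<le> (1 + \<delta>) * (norm (x - z))\<^sup>2 + (1 + 1 / \<delta>) * (norm (y - z))\<^sup>2" for x y z :: "real^'n"
  proof -
    define a b where "a = norm (x - z)" and "b = norm (y - z)"
    have "norm (x - y) \<le> a + b"
      unfolding a_def b_def by (metis dist_norm dist_triangle2)
    then have "(norm (x - y))\<^sup>2 \<le> (a + b)\<^sup>2" by (rule power_mono) simp
    moreover have "(1 + \<delta>) * a\<^sup>2 + (1 + 1 / \<delta>) * b\<^sup>2 - (a + b)\<^sup>2 = (\<delta> * a - b)\<^sup>2 / \<delta>"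
      using \<delta> by (simp add: power2_eq_square field_simps)
    moreover have "(\<delta> * a - b)\<^sup>2 / \<delta> \<ge> 0" using \<delta> by simp
    ultimately show ?thesis unfolding a_def b_def by linarith
  qed
  have "(\<integral>\<^sup>+z. ennreal ((norm (fst z - snd z))\<^sup>2) \<partial>\<pi>)
    = (\<integral>\<^sup>+\<omega>. k (fst \<omega>) (\<beta> (snd \<omega>)) * ennreal ((norm (fst \<omega> - snd \<omega>))\<^sup>2) \<partial>?P)"
    unfolding \<pi>_def by (subst nn_integral_density) auto
  also have "\<dots> \<le> (\<integral>\<^sup>+\<omega>. ennreal (1 + \<delta>) * (k (fst \<omega>) (\<beta> (snd \<omega>)) * ennreal ((norm (fst \<omega> - \<beta> (snd \<omega>)))\<^sup>2))
      + ennreal (1 + 1 / \<delta>) * (k (fst \<omega>) (\<beta> (snd \<omega>)) * ennreal ((norm (snd \<omega> - \<beta> (snd \<omega>)))\<^sup>2)) \<partial>?P)"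
  proof (rule nn_integral_mono)
    fix \<omega> :: "(real^'n) \<times> (real^'n)"
    have "ennreal ((norm (fst \<omega> - snd \<omega>))\<^sup>2) \<le> ennreal ((1 + \<delta>) * (norm (fst \<omega> - \<beta> (snd \<omega>)))\<^sup>2 + (1 + 1 / \<delta>) * (norm (snd \<omega> - \<beta> (snd \<omega>)))\<^sup>2)"
      by (intro ennreal_leI young)
    also have "\<dots> = ennreal (1 + \<delta>) * ennreal ((norm (fst \<omega> - \<beta> (snd \<omega>)))\<^sup>2) + ennreal (1 + 1 / \<delta>) * ennreal ((norm (snd \<omega> - \<beta> (snd \<omega>)))\<^sup>2)"
      using \<delta> by (subst ennreal_plus) (auto simp: ennreal_mult)
    finally have "k (fst \<omega>) (\<beta> (snd \<omega>)) * ennreal ((norm (fst \<omega> - snd \<omega>))\<^sup>2) \<le> k (fst \<omega>) (\<beta> (snd \<omega>)) *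
      (ennreal (1 + \<delta>) * ennreal ((norm (fst \<omega> - \<beta> (snd \<omega>)))\<^sup>2) + ennreal (1 + 1 / \<delta>) * ennreal ((norm (snd \<omega> - \<beta> (snd \<omega>)))\<^sup>2))"
      by (rule mult_left_mono) simp
    then show "k (fst \<omega>) (\<beta> (snd \<omega>)) * ennreal ((norm (fst \<omega> - snd \<omega>))\<^sup>2) \<le>
      ennreal (1 + \<delta>) * (k (fst \<omega>) (\<beta> (snd \<omega>)) * ennreal ((norm (fst \<omega> - \<beta> (snd \<omega>)))\<^sup>2))
      + ennreal (1 + 1 / \<delta>) * (k (fst \<omega>) (\<beta> (snd \<omega>)) * ennreal ((norm (snd \<omega> - \<beta> (snd \<omega>)))\<^sup>2))"
      by (simp only: distrib_left mult.left_commute)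
  qed
  also have "\<dots> = ennreal (1 + \<delta>) * ennreal D + ennreal (1 + 1 / \<delta>) * ennreal e"
    by (subst nn_integral_add, simp, simp, subst nn_integral_cmult, simp, subst nn_integral_cmult, simp, simp only: first second)
  also have "\<dots> = ennreal ((1 + \<delta>) * D + (1 + 1 / \<delta>) * e)"
  proof -
    have "D \<ge> 0"
      unfolding D_def using w_pos by (intro integral_nonneg_AE AE_I2 sum_nonneg) (simp add: less_imp_le)
    then show ?thesis using \<delta> e0 by (subst ennreal_plus) (auto simp: ennreal_mult)
  qed
  also have "\<dots> \<le> ennreal ((1 + \<delta>) * (S / (1 - \<delta>) + 2 * \<delta>) + (1 + 1 / \<delta>) * \<delta>\<^sup>2)"
    using \<delta> D_le' e_less by (intro ennreal_leI add_mono mult_left_mono) auto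
  finally have "ennreal_sqrt (\<integral>\<^sup>+z. ennreal ((norm (fst z - snd z))\<^sup>2) \<partial>\<pi>) \<le> ennreal_sqrt (ennreal ((1 + \<delta>) * (S / (1 - \<delta>) + 2 * \<delta>) + (1 + 1 / \<delta>) * \<delta>\<^sup>2))"
    by (rule ennreal_sqrt_mono)
  then show ?thesis
    unfolding wasserstein2_def by (rule INF_lower2[OF \<pi>])
qed

theorem proposition3p1:
  fixes \<nu> :: "(real^'n::finite) measure"
    and \<tau> :: "real^'n \<Rightarrow> real^'n^'n"
  assumes "prob_space \<nu>" and "sets \<nu> = sets borel"
    and "centered \<nu>"
    and "stein_kernel \<nu> \<tau>"
  shows "wasserstein2 \<nu> std_gaussian \<le> stein_discrepancy \<nu> \<tau>"
proof (cases "(\<integral>\<^sup>+x. ennreal ((norm (\<tau> x - mat 1))\<^sup>2) \<partial>\<nu>) = \<top>")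
  case True
  then show ?thesis by (simp add: stein_discrepancy_def ennreal_sqrt_def)
next
  case False
  have [measurable]: "\<tau> \<in> borel_measurable \<nu>"
    using assms by (simp add: stein_kernel_def)
  have S2: "integrable \<nu> (\<lambda>x. (norm (\<tau> x - mat 1))\<^sup>2)"
    using False by (intro integrableI_bounded) (auto simp: less_top)
  define S where "S = (\<integral>x. (norm (\<tau> x - mat 1))\<^sup>2 \<partial>\<nu>)"
  have disc: "stein_discrepancy \<nu> \<tau> = ennreal_sqrt (ennreal S)"
    unfolding stein_discrepancy_def S_def using S2 by (subst nn_integral_eq_integral) auto
  define R where "R \<delta> = (1 + \<delta>) * (S / (1 - \<delta>) + 2 * \<delta>) + (1 + 1 / \<delta>) * \<delta>\<^sup>2" for \<delta> :: real
  have "((\<lambda>\<delta>. ennreal (sqrt (max (R \<delta>) 0))) \<longlongrightarrow> ennreal (sqrt (max S 0))) (at_right 0)"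
  proof (intro tendsto_ennrealI tendsto_real_sqrt tendsto_max tendsto_const)
    \<comment> \<open>For positive \<delta> the last term equals (\<delta> + 1) \<delta>; in this
      form the apparent pole at 0 is gone and the limit is immediate.\<close>
    have "((\<lambda>\<delta>. (1 + \<delta>) * (S / (1 - \<delta>) + 2 * \<delta>) + (\<delta> + 1) * \<delta>) \<longlongrightarrow> (1 + 0) * (S / (1 - 0) + 2 * 0) + (0 + 1) * 0) (at_right 0)"
      by (intro tendsto_intros) auto
    moreover have "\<forall>\<^sub>F \<delta> in at_right 0. (1 + \<delta>) * (S / (1 - \<delta>) + 2 * \<delta>) + (\<delta> + 1) * \<delta> = R \<delta>"
      using eventually_at_right_less[of "0::real"]
      by eventually_elim (simp add: R_def power2_eq_square field_simps)
    ultimately show "(R \<longlongrightarrow> S) (at_right 0)"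
      by (simp add: tendsto_cong)
  qed
  moreover have "\<forall>\<^sub>F \<delta> in at_right 0. wasserstein2 \<nu> std_gaussian \<le> ennreal (sqrt (max (R \<delta>) 0))"
  proof (rule eventually_at_rightI[where b = 1])
    fix \<delta> :: real assume "\<delta> \<in> {0<..<1}"
    then have "0 < \<delta>" "\<delta> < 1" by auto
    from wasserstein2_le_approx[OF assms(1,2,4) S2 this]
    show "wasserstein2 \<nu> std_gaussian \<le> ennreal (sqrt (max (R \<delta>) 0))"
      by (simp only: R_def S_def ennreal_sqrt_ennreal)
  qed simp
  ultimately have "wasserstein2 \<nu> std_gaussian \<le> ennreal (sqrt (max S 0))"
    by (intro tendsto_lowerbound[of _ _ "at_right 0"]) auto
  then show ?thesis by (simp add: disc ennreal_sqrt_ennreal)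
qed

end
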